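(* Let $\mathbf{C}$ be a model category in which every object is fibrant. Suppose that the class of cofibrations is generated by a set $I$ (that is, $I\text{-}\mathrm{cof}$ is the class of cofibrations) such that the domains and the codomains of maps in $I$ are small relative to $I\text{-}\mathrm{cell}$. Then the model structure is cofibrantly generated with $J_I = \{\iota_0 : V \to C_U(V) \mid (U \to V) \in I\}$ as a set of generating trivial cofibrations.
   Context: A model category is a complete and cocomplete category with three classes of maps (fibrations, cofibrations, weak equivalences) such that weak equivalences satisfy 2-out-of-3 and (cofibrations, trivial fibrations) and (trivial cofibrations, fibrations) are weak factorization systems. An object is fibrant if its map to the terminal object is a fibration. For each map $i : U \to V$ in $I$, $C_U(V)$ denotes the relative cylinder object with maps $\iota_0,\iota_1 : V \to C_U(V)$ obtained by factoring $[\mathrm{id}_V,\mathrm{id}_V] : V \amalg_U V \to V$ into a cofibration $[\iota_0,\iota_1] : V \amalg_U V \to C_U(V)$ followed by a trivial fibration $C_U(V) \to V$. For a class $K$ of maps: $K\text{-}\mathrm{inj}$ is the class of maps with the RLP with respect to all maps in $K$; $K\text{-}\mathrm{cof}$ is the class of maps with the LLP with respect to all maps in $K\text{-}\mathrm{inj}$; $K\text{-}\mathrm{cell}$ is the class of transfinite compositions of pushouts of elements of $K$. A set $K$ permits the small object argument if the domains of maps in $K$ are small relative to $K\text{-}\mathrm{cell}$. A model structure is cofibrantly generated, with $I$ as generating cofibrations and $J$ as generating trivial cofibrations, if $I$ and $J$ are sets of maps permitting the small object argument, the class of fibrations is $J\text{-}\mathrm{inj}$, and the class of trivial fibrations is $I\text{-}\mathrm{inj}$.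 *)

theory Defs
  imports Main
begin

unbundle cardinal_syntax

section \<open>Size\<close>

text \<open>
  Set-theoretic size conditions are relative to a Grothendieck universe, given by a strongly
  inaccessible cardinal \<open>\<kappa>\<close>; \<open>small\<close> means of cardinality less than \<open>\<kappa>\<close>. As \<open>\<kappa>\<close> is a relation on
  the type \<open>'u\<close>, every small set is equipotent to a subset of \<open>'u\<close>. Hence nothing is lost
  by quantifying over small index categories, small ordinals and small cardinals carried
  by \<open>'u\<close> only.
\<close>

definition inaccessible :: "'u rel \<Rightarrow> bool" where
  "inaccessible \<kappa> \<longleftrightarrow>
     Card_order \<kappa> \<and> natLeq <o \<kappa> \<and> regularCard \<kappa> \<and>
     (\<forall>A :: 'u set. |A| <o \<kappa> \<longrightarrow> |Pow A| <o \<kappa>)"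

definition small :: "'u rel \<Rightarrow> 'b set \<Rightarrow> bool" where
  "small \<kappa> A \<longleftrightarrow> |A| <o \<kappa>"


section \<open>Categories, limits and colimits\<close>

text \<open>\<open>Comp C g f\<close>, written \<open>g \<cdot>\<^bsub>C\<^esub> f\<close>, is the composite \<open>g\<close> after \<open>f\<close>; its value is
  unspecified if \<open>Dom C g \<noteq> Cod C f\<close>.\<close>

record ('o, 'm) category =
  Obj :: "'o set"
  Mor :: "'m set"
  Dom :: "'m \<Rightarrow> 'o"
  Cod :: "'m \<Rightarrow> 'o"
  Ident :: "'o \<Rightarrow> 'm"
  Comp :: "'m \<Rightarrow> 'm \<Rightarrow> 'm"  (infixl \<open>\<cdot>\<index>\<close> 70)

definition hom :: "('o, 'm, 'x) category_scheme \<Rightarrow> 'o \<Rightarrow> 'o \<Rightarrow> 'm set" where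
  "hom C X Y = {f \<in> Mor C. Dom C f = X \<and> Cod C f = Y}"

locale category =
  fixes C :: "('o, 'm, 'x) category_scheme" (structure)
  assumes Dom_in_Obj: "f \<in> Mor C \<Longrightarrow> Dom C f \<in> Obj C"
    and Cod_in_Obj: "f \<in> Mor C \<Longrightarrow> Cod C f \<in> Obj C"
    and Ident_in_hom: "X \<in> Obj C \<Longrightarrow> Ident C X \<in> hom C X X"
    and Comp_in_hom: "f \<in> hom C X Y \<Longrightarrow> g \<in> hom C Y Z \<Longrightarrow> g \<cdot> f \<in> hom C X Z"
    and Comp_Ident: "f \<in> hom C X Y \<Longrightarrow> f \<cdot> Ident C X = f"
    and Ident_Comp: "f \<in> hom C X Y \<Longrightarrow> Ident C Y \<cdot> f = f"
    and Comp_assoc: "f \<in> hom C W X \<Longrightarrow> g \<in> hom C X Y \<Longrightarrow> h \<in> hom C Y Z \<Longrightarrow>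
      h \<cdot> (g \<cdot> f) = (h \<cdot> g) \<cdot> f"

definition is_functor ::
  "('i, 'j, 'y) category_scheme \<Rightarrow> ('o, 'm, 'x) category_scheme \<Rightarrow> ('i \<Rightarrow> 'o) \<Rightarrow> ('j \<Rightarrow> 'm) \<Rightarrow> bool"
  where
  "is_functor D C Fo Fm \<longleftrightarrow>
     (\<forall>i \<in> Obj D. Fo i \<in> Obj C \<and> Fm (Ident D i) = Ident C (Fo i)) \<and>
     (\<forall>u \<in> Mor D. Fm u \<in> hom C (Fo (Dom D u)) (Fo (Cod D u))) \<and>
     (\<forall>u \<in> Mor D. \<forall>v \<in> Mor D. Dom D v = Cod D u \<longrightarrow> Fm (v \<cdot>\<^bsub>D\<^esub> u) = Fm v \<cdot>\<^bsub>C\<^esub> Fm u)"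

definition is_cone ::
  "('i, 'j, 'y) category_scheme \<Rightarrow> ('o, 'm, 'x) category_scheme \<Rightarrow> ('i \<Rightarrow> 'o) \<Rightarrow> ('j \<Rightarrow> 'm) \<Rightarrow>
   'o \<Rightarrow> ('i \<Rightarrow> 'm) \<Rightarrow> bool"
  where
  "is_cone D C Fo Fm L \<pi> \<longleftrightarrow>
     L \<in> Obj C \<and> (\<forall>i \<in> Obj D. \<pi> i \<in> hom C L (Fo i)) \<and>
     (\<forall>u \<in> Mor D. Fm u \<cdot>\<^bsub>C\<^esub> \<pi> (Dom D u) = \<pi> (Cod D u))"

definition is_limit ::
  "('i, 'j, 'y) category_scheme \<Rightarrow> ('o, 'm, 'x) category_scheme \<Rightarrow> ('i \<Rightarrow> 'o) \<Rightarrow> ('j \<Rightarrow> 'm) \<Rightarrow>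
   'o \<Rightarrow> ('i \<Rightarrow> 'm) \<Rightarrow> bool"
  where
  "is_limit D C Fo Fm L \<pi> \<longleftrightarrow>
     is_cone D C Fo Fm L \<pi> \<and>
     (\<forall>L' \<pi>'. is_cone D C Fo Fm L' \<pi>' \<longrightarrow>
        (\<exists>!h. h \<in> hom C L' L \<and> (\<forall>i \<in> Obj D. \<pi> i \<cdot>\<^bsub>C\<^esub> h = \<pi>' i)))"

definition is_cocone ::
  "('i, 'j, 'y) category_scheme \<Rightarrow> ('o, 'm, 'x) category_scheme \<Rightarrow> ('i \<Rightarrow> 'o) \<Rightarrow> ('j \<Rightarrow> 'm) \<Rightarrow>
   'o \<Rightarrow> ('i \<Rightarrow> 'm) \<Rightarrow> bool"
  where
  "is_cocone D C Fo Fm L \<iota> \<longleftrightarrow>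
     L \<in> Obj C \<and> (\<forall>i \<in> Obj D. \<iota> i \<in> hom C (Fo i) L) \<and>
     (\<forall>u \<in> Mor D. \<iota> (Cod D u) \<cdot>\<^bsub>C\<^esub> Fm u = \<iota> (Dom D u))"

definition is_colimit ::
  "('i, 'j, 'y) category_scheme \<Rightarrow> ('o, 'm, 'x) category_scheme \<Rightarrow> ('i \<Rightarrow> 'o) \<Rightarrow> ('j \<Rightarrow> 'm) \<Rightarrow>
   'o \<Rightarrow> ('i \<Rightarrow> 'm) \<Rightarrow> bool"
  where
  "is_colimit D C Fo Fm L \<iota> \<longleftrightarrow>
     is_cocone D C Fo Fm L \<iota> \<and>
     (\<forall>L' \<iota>'. is_cocone D C Fo Fm L' \<iota>' \<longrightarrow>
        (\<exists>!h. h \<in> hom C L L' \<and> (\<forall>i \<in> Obj D. h \<cdot>\<^bsub>C\<^esub> \<iota> i = \<iota>' i)))"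

definition complete :: "'u rel \<Rightarrow> ('o, 'm, 'x) category_scheme \<Rightarrow> bool" where
  "complete \<kappa> C \<longleftrightarrow>
     (\<forall>(D :: ('u, 'u) category) Fo Fm.
        category D \<and> small \<kappa> (Obj D) \<and> small \<kappa> (Mor D) \<and> is_functor D C Fo Fm \<longrightarrow>
        (\<exists>L \<pi>. is_limit D C Fo Fm L \<pi>))"

definition cocomplete :: "'u rel \<Rightarrow> ('o, 'm, 'x) category_scheme \<Rightarrow> bool" where
  "cocomplete \<kappa> C \<longleftrightarrow>
     (\<forall>(D :: ('u, 'u) category) Fo Fm.
        category D \<and> small \<kappa> (Obj D) \<and> small \<kappa> (Mor D) \<and> is_functor D C Fo Fm \<longrightarrow>
        (\<exists>L \<iota>. is_colimit D C Fo Fm L \<iota>))"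

definition terminal :: "('o, 'm, 'x) category_scheme \<Rightarrow> 'o \<Rightarrow> bool" where
  "terminal C T \<longleftrightarrow> T \<in> Obj C \<and> (\<forall>X \<in> Obj C. \<exists>!t. t \<in> hom C X T)"

text \<open>
  \<open>is_pushout C f g p q\<close>: the square \<open>p \<cdot> f = q \<cdot> g\<close> is a pushout of the span \<open>f\<close>, \<open>g\<close>.
  Thus \<open>q\<close> is a pushout of \<open>f\<close> along \<open>g\<close>.
\<close>

definition is_pushout :: "('o, 'm, 'x) category_scheme \<Rightarrow> 'm \<Rightarrow> 'm \<Rightarrow> 'm \<Rightarrow> 'm \<Rightarrow> bool" where
  "is_pushout C f g p q \<longleftrightarrow>
     f \<in> Mor C \<and> g \<in> Mor C \<and> p \<in> Mor C \<and> q \<in> Mor C \<and>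
     Dom C f = Dom C g \<and> Dom C p = Cod C f \<and> Dom C q = Cod C g \<and> Cod C p = Cod C q \<and>
     p \<cdot>\<^bsub>C\<^esub> f = q \<cdot>\<^bsub>C\<^esub> g \<and>
     (\<forall>Z. \<forall>p' \<in> hom C (Cod C f) Z. \<forall>q' \<in> hom C (Cod C g) Z. p' \<cdot>\<^bsub>C\<^esub> f = q' \<cdot>\<^bsub>C\<^esub> g \<longrightarrow>
        (\<exists>!h. h \<in> hom C (Cod C p) Z \<and> h \<cdot>\<^bsub>C\<^esub> p = p' \<and> h \<cdot>\<^bsub>C\<^esub> q = q'))"

definition pushouts_of :: "('o, 'm, 'x) category_scheme \<Rightarrow> 'm set \<Rightarrow> 'm set" where
  "pushouts_of C K = {q. \<exists>k \<in> K. \<exists>g p. is_pushout C k g p q}"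


section \<open>Lifting properties\<close>

definition lifts_against :: "('o, 'm, 'x) category_scheme \<Rightarrow> 'm \<Rightarrow> 'm \<Rightarrow> bool" where
  "lifts_against C i p \<longleftrightarrow>
     (\<forall>f \<in> hom C (Dom C i) (Dom C p). \<forall>g \<in> hom C (Cod C i) (Cod C p).
        p \<cdot>\<^bsub>C\<^esub> f = g \<cdot>\<^bsub>C\<^esub> i \<longrightarrow>
        (\<exists>h \<in> hom C (Cod C i) (Dom C p). h \<cdot>\<^bsub>C\<^esub> i = f \<and> p \<cdot>\<^bsub>C\<^esub> h = g))"

definition RLP :: "('o, 'm, 'x) category_scheme \<Rightarrow> 'm set \<Rightarrow> 'm set" where
  "RLP C K = {p \<in> Mor C. \<forall>i \<in> K. lifts_against C i p}"

definition LLP :: "('o, 'm, 'x) category_scheme \<Rightarrow> 'm set \<Rightarrow> 'm set" where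
  "LLP C K = {i \<in> Mor C. \<forall>p \<in> K. lifts_against C i p}"

definition inj_maps :: "('o, 'm, 'x) category_scheme \<Rightarrow> 'm set \<Rightarrow> 'm set" where
  "inj_maps C K = RLP C K"

definition cof_maps :: "('o, 'm, 'x) category_scheme \<Rightarrow> 'm set \<Rightarrow> 'm set" where
  "cof_maps C K = LLP C (inj_maps C K)"

definition weak_factorization_system ::
  "('o, 'm, 'x) category_scheme \<Rightarrow> 'm set \<Rightarrow> 'm set \<Rightarrow> bool" where
  "weak_factorization_system C L R \<longleftrightarrow>
     L = LLP C R \<and> R = RLP C L \<and>
     (\<forall>f \<in> Mor C. \<exists>l \<in> L. \<exists>r \<in> R. Cod C l = Dom C r \<and> f = r \<cdot>\<^bsub>C\<^esub> l)"


section \<open>Transfinite composition and smallness\<close>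

text \<open>
  An ordinal is a well-order on a subset of \<open>'u\<close>. Its elements are the smaller ordinals, and
  \<open>order_cat\<close> is the associated poset category, with a unique arrow \<open>(a, b)\<close> whenever \<open>a \<le> b\<close>.
\<close>

definition small_ordinal :: "'u rel \<Rightarrow> 'u rel \<Rightarrow> bool" where
  "small_ordinal \<kappa> r \<longleftrightarrow> Well_order r \<and> small \<kappa> (Field r)"

definition order_cat :: "'a rel \<Rightarrow> ('a, 'a \<times> 'a) category" where
  "order_cat r =
     \<lparr>Obj = Field r, Mor = r, Dom = fst, Cod = snd, Ident = (\<lambda>a. (a, a)),
      Comp = (\<lambda>v u. (fst u, snd v))\<rparr>"

definition is_bottom :: "'a rel \<Rightarrow> 'a \<Rightarrow> bool" where
  "is_bottom r z \<longleftrightarrow> z \<in> Field r \<and> (\<forall>a \<in> Field r. (z, a) \<in> r)"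

definition is_successor :: "'a rel \<Rightarrow> 'a \<Rightarrow> 'a \<Rightarrow> bool" where
  "is_successor r a b \<longleftrightarrow>
     (a, b) \<in> r \<and> a \<noteq> b \<and> (\<forall>c. (a, c) \<in> r \<and> a \<noteq> c \<longrightarrow> (b, c) \<in> r)"

definition is_limit_element :: "'a rel \<Rightarrow> 'a \<Rightarrow> bool" where
  "is_limit_element r b \<longleftrightarrow> b \<in> Field r \<and> \<not> is_bottom r b \<and> (\<nexists>a. is_successor r a b)"

definition is_limit_ordinal :: "'a rel \<Rightarrow> bool" where
  "is_limit_ordinal r \<longleftrightarrow>
     Well_order r \<and> Field r \<noteq> {} \<and> (\<forall>a \<in> Field r. \<exists>b. is_successor r a b)"

text \<open>A \<open>\<lambda>\<close>-sequence is a colimit-preserving functor from a (nonzero) ordinal \<open>\<lambda>\<close>, that is, a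
  functor whose value at each limit \<open>b < \<lambda>\<close> is the colimit of its values below \<open>b\<close>.\<close>

definition is_sequence ::
  "('o, 'm, 'x) category_scheme \<Rightarrow> 'a rel \<Rightarrow> ('a \<Rightarrow> 'o) \<Rightarrow> ('a \<times> 'a \<Rightarrow> 'm) \<Rightarrow> bool" where
  "is_sequence C r Xo Xm \<longleftrightarrow>
     Well_order r \<and> Field r \<noteq> {} \<and> is_functor (order_cat r) C Xo Xm \<and>
     (\<forall>b. is_limit_element r b \<longrightarrow>
        is_colimit (order_cat (Restr r (underS r b))) C Xo Xm (Xo b) (\<lambda>a. Xm (a, b)))"

definition steps_in :: "'a rel \<Rightarrow> ('a \<times> 'a \<Rightarrow> 'm) \<Rightarrow> 'm set \<Rightarrow> bool" where
  "steps_in r Xm K \<longleftrightarrow> (\<forall>a b. is_successor r a b \<longrightarrow> Xm (a, b) \<in> K)"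

definition transfinite_compositions ::
  "'u rel \<Rightarrow> ('o, 'm, 'x) category_scheme \<Rightarrow> 'm set \<Rightarrow> 'm set" where
  "transfinite_compositions \<kappa> C K =
     {f. \<exists>(r :: 'u rel) Xo Xm L \<iota> z.
        small_ordinal \<kappa> r \<and> is_sequence C r Xo Xm \<and> steps_in r Xm K \<and>
        is_colimit (order_cat r) C Xo Xm L \<iota> \<and> is_bottom r z \<and> f = \<iota> z}"

definition cell_maps :: "'u rel \<Rightarrow> ('o, 'm, 'x) category_scheme \<Rightarrow> 'm set \<Rightarrow> 'm set" where
  "cell_maps \<kappa> C K = transfinite_compositions \<kappa> C (pushouts_of C K)"

definition filtered_ordinal :: "'u rel \<Rightarrow> 'u rel \<Rightarrow> bool" where
  "filtered_ordinal \<mu> r \<longleftrightarrow>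
     is_limit_ordinal r \<and>
     (\<forall>A \<subseteq> Field r. |A| \<le>o \<mu> \<longrightarrow> (\<exists>b \<in> Field r. \<forall>a \<in> A. (a, b) \<in> r))"

text \<open>
  The colimit in sets of the \<open>\<lambda>\<close>-sequence of sets \<open>hom C A (X a)\<close>, as the usual quotient of
  the disjoint union, and the canonical map from it to \<open>hom C A (colim X)\<close>, which sends the class
  of \<open>g \<in> hom C A (X a)\<close> to \<open>\<iota> a \<cdot> g\<close> (so all elements of a class have the same image).
\<close>

definition hom_colim_rel ::
  "('o, 'm, 'x) category_scheme \<Rightarrow> 'o \<Rightarrow> 'a rel \<Rightarrow> ('a \<Rightarrow> 'o) \<Rightarrow> ('a \<times> 'a \<Rightarrow> 'm) \<Rightarrow>
   ('a \<times> 'm) rel" where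
  "hom_colim_rel C A r Xo Xm =
     {((a, g), (b, h)) | a g b h.
        a \<in> Field r \<and> g \<in> hom C A (Xo a) \<and> b \<in> Field r \<and> h \<in> hom C A (Xo b) \<and>
        (\<exists>c. (a, c) \<in> r \<and> (b, c) \<in> r \<and> Xm (a, c) \<cdot>\<^bsub>C\<^esub> g = Xm (b, c) \<cdot>\<^bsub>C\<^esub> h)}"

definition hom_colim ::
  "('o, 'm, 'x) category_scheme \<Rightarrow> 'o \<Rightarrow> 'a rel \<Rightarrow> ('a \<Rightarrow> 'o) \<Rightarrow> ('a \<times> 'a \<Rightarrow> 'm) \<Rightarrow>
   ('a \<times> 'm) set set" where
  "hom_colim C A r Xo Xm =
     (SIGMA a : Field r. hom C A (Xo a)) // hom_colim_rel C A r Xo Xm"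

definition hom_colim_map ::
  "('o, 'm, 'x) category_scheme \<Rightarrow> ('a \<Rightarrow> 'm) \<Rightarrow> ('a \<times> 'm) set \<Rightarrow> 'm" where
  "hom_colim_map C \<iota> Q = the_elem ((\<lambda>(a, g). \<iota> a \<cdot>\<^bsub>C\<^esub> g) ` Q)"

definition cardinal_small_relative ::
  "'u rel \<Rightarrow> ('o, 'm, 'x) category_scheme \<Rightarrow> 'u rel \<Rightarrow> 'm set \<Rightarrow> 'o \<Rightarrow> bool" where
  "cardinal_small_relative \<kappa> C \<mu> K A \<longleftrightarrow>
     (\<forall>(r :: 'u rel) Xo Xm L \<iota>.
        small_ordinal \<kappa> r \<and> filtered_ordinal \<mu> r \<and> is_sequence C r Xo Xm \<and> steps_in r Xm K \<and>
        is_colimit (order_cat r) C Xo Xm L \<iota> \<longrightarrow>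
        bij_betw (hom_colim_map C \<iota>) (hom_colim C A r Xo Xm) (hom C A L))"

definition small_relative ::
  "'u rel \<Rightarrow> ('o, 'm, 'x) category_scheme \<Rightarrow> 'm set \<Rightarrow> 'o \<Rightarrow> bool" where
  "small_relative \<kappa> C K A \<longleftrightarrow>
     (\<exists>\<mu> :: 'u rel. Card_order \<mu> \<and> \<mu> <o \<kappa> \<and> cardinal_small_relative \<kappa> C \<mu> K A)"

definition permits_small_object_argument ::
  "'u rel \<Rightarrow> ('o, 'm, 'x) category_scheme \<Rightarrow> 'm set \<Rightarrow> bool" where
  "permits_small_object_argument \<kappa> C K \<longleftrightarrow>
     (\<forall>k \<in> K. small_relative \<kappa> C (cell_maps \<kappa> C K) (Dom C k))"


section \<open>Model categories\<close>

record ('o, 'm) model_structure = "('o, 'm) category" +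
  Fib :: "'m set"
  Cof :: "'m set"
  Weq :: "'m set"

definition TFib :: "('o, 'm, 'x) model_structure_scheme \<Rightarrow> 'm set" where
  "TFib M = Fib M \<inter> Weq M"

definition TCof :: "('o, 'm, 'x) model_structure_scheme \<Rightarrow> 'm set" where
  "TCof M = Cof M \<inter> Weq M"

locale model_category = category M
  for M :: "('o, 'm, 'x) model_structure_scheme" (structure) +
  fixes \<kappa> :: "'u rel"
  assumes hom_small: "X \<in> Obj M \<Longrightarrow> Y \<in> Obj M \<Longrightarrow> small \<kappa> (hom M X Y)"
    and complete: "complete \<kappa> M"
    and cocomplete: "cocomplete \<kappa> M"
    and Weq_subset: "Weq M \<subseteq> Mor M"
    and two_out_of_three: "f \<in> hom M X Y \<Longrightarrow> g \<in> hom M Y Z \<Longrightarrow>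
      (f \<in> Weq M \<and> g \<in> Weq M \<longrightarrow> g \<cdot> f \<in> Weq M) \<and>
      (f \<in> Weq M \<and> g \<cdot> f \<in> Weq M \<longrightarrow> g \<in> Weq M) \<and>
      (g \<in> Weq M \<and> g \<cdot> f \<in> Weq M \<longrightarrow> f \<in> Weq M)"
    and wfs_Cof_TFib: "weak_factorization_system M (Cof M) (TFib M)"
    and wfs_TCof_Fib: "weak_factorization_system M (TCof M) (Fib M)"

definition fibrant :: "('o, 'm, 'x) model_structure_scheme \<Rightarrow> 'o \<Rightarrow> bool" where
  "fibrant M X \<longleftrightarrow> (\<exists>T. terminal M T \<and> (\<exists>t \<in> hom M X T. t \<in> Fib M))"

text \<open>
  \<open>relative_cylinder M i \<iota>\<^sub>0 \<iota>\<^sub>1 s\<close>: for \<open>i : U \<rightarrow> V\<close>, the maps \<open>\<iota>\<^sub>0, \<iota>\<^sub>1 : V \<rightarrow> C\<^sub>U(V)\<close> and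
  \<open>s : C\<^sub>U(V) \<rightarrow> V\<close> arise from a factorization \<open>s \<cdot> k\<close> of the codiagonal of \<open>i\<close>.
  Here \<open>in\<^sub>0\<close> and \<open>in\<^sub>1\<close> are the coprojections of \<open>V \<amalg>\<^sub>U V\<close>, and \<open>s \<cdot> k\<close> is \<open>[id\<^sub>V, id\<^sub>V]\<close>
  as it restricts to the identity along each of them.
\<close>

definition relative_cylinder ::
  "('o, 'm, 'x) model_structure_scheme \<Rightarrow> 'm \<Rightarrow> 'm \<Rightarrow> 'm \<Rightarrow> 'm \<Rightarrow> bool" where
  "relative_cylinder M i \<iota>\<^sub>0 \<iota>\<^sub>1 s \<longleftrightarrow>
     (\<exists>in\<^sub>0 in\<^sub>1 k.
        is_pushout M i i in\<^sub>0 in\<^sub>1 \<and>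
        k \<in> Cof M \<and> Dom M k = Cod M in\<^sub>0 \<and>
        s \<in> TFib M \<and> Dom M s = Cod M k \<and>
        (s \<cdot>\<^bsub>M\<^esub> k) \<cdot>\<^bsub>M\<^esub> in\<^sub>0 = Ident M (Cod M i) \<and> (s \<cdot>\<^bsub>M\<^esub> k) \<cdot>\<^bsub>M\<^esub> in\<^sub>1 = Ident M (Cod M i) \<and>
        \<iota>\<^sub>0 = k \<cdot>\<^bsub>M\<^esub> in\<^sub>0 \<and> \<iota>\<^sub>1 = k \<cdot>\<^bsub>M\<^esub> in\<^sub>1)"

definition cofibrantly_generated ::
  "'u rel \<Rightarrow> ('o, 'm, 'x) model_structure_scheme \<Rightarrow> 'm set \<Rightarrow> 'm set \<Rightarrow> bool" where
  "cofibrantly_generated \<kappa> M I J \<longleftrightarrow>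
     I \<subseteq> Mor M \<and> small \<kappa> I \<and> permits_small_object_argument \<kappa> M I \<and>
     J \<subseteq> Mor M \<and> small \<kappa> J \<and> permits_small_object_argument \<kappa> M J \<and>
     Fib M = inj_maps M J \<and> TFib M = inj_maps M I"

end

theory Submission
  imports Defs
begin

text \<open>
  Write \<open>J\<close> for the set of the maps \<open>\<iota>\<^sub>0 : V \<rightarrow> C\<^sub>U(V)\<close>. They are trivial cofibrations, so every fibration is
  in \<open>J\<close>-inj, and the point is the converse. It has a homotopical and a transfinite half.

  The homotopical half (\<open>weak_equivalence_lifts\<close>) says that a weak equivalence \<open>f\<close> in \<open>J\<close>-inj is a trivial
  fibration. Since all objects are fibrant, a lifting problem of some \<open>i : U \<rightarrow> V\<close> in \<open>I\<close> against \<open>f\<close> has a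
  solution up to a homotopy \<open>C\<^sub>U(V) \<rightarrow> Y\<close> relative to \<open>U\<close>. Lifting this homotopy along \<open>\<iota>\<^sub>0\<close> and restricting
  the result to the other end gives a strict solution.

  If \<open>J\<close> permits the small object argument, an arbitrary trivial cofibration \<open>t\<close> is a composite of
  a relative \<open>J\<close>-cell complex \<open>c\<close> and a map in \<open>J\<close>-inj. The latter is a weak equivalence by two-out-of-three,
  hence a trivial fibration by the homotopical half, so that \<open>t\<close> is a retract of \<open>c\<close>. Thus every map in \<open>J\<close>-inj
  lifts against all trivial cofibrations and is a fibration (\<open>Fib_eq_inj_maps\<close>).

  It remains that the domains \<open>V\<close> of the maps in \<open>J\<close> are small relative to the \<open>J\<close>-cell complexes. The
  hypothesis gives smallness relative to the \<open>I\<close>-cell complexes. A \<open>J\<close>-cell complex is merely a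
  cofibration, but each sequence of cofibrations is a retract of a sequence of \<open>I\<close>-cell complexes
  (\<open>cofibration_sequence_retract\<close>), and smallness passes to retracts.

  Both transfinite steps rest on the small object argument (\<open>small_object_argument\<close>). Cell complexes are
  transfinite compositions of pushouts of single generators. To obtain one without reindexing
  iterated compositions, cells are attached one at a time along the inaccessible cardinal \<open>\<kappa>\<close>
  itself, with bookkeeping, and the construction is stopped at a suitable ordinal below \<open>\<kappa>\<close>. The
  sequences with their additional structure come from a general principle of transfinite
  recursion (\<open>transfinite_section\<close>).
\<close>

section \<open>Small sets and the ordinal of all small ordinals\<close>

lemma Well_orderD:
  assumes "Well_order r"
  shows "\<And>a. a \<in> Field r \<Longrightarrow> (a, a) \<in> r"
    and "\<And>a b c. (a, b) \<in> r \<Longrightarrow> (b, c) \<in> r \<Longrightarrow> (a, c) \<in> r"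
    and "\<And>a b. (a, b) \<in> r \<Longrightarrow> (b, a) \<in> r \<Longrightarrow> a = b"
    and "\<And>a b. a \<in> Field r \<Longrightarrow> b \<in> Field r \<Longrightarrow> (a, b) \<in> r \<or> (b, a) \<in> r"
    and "wf (r - Id)"
proof -
  have r: "refl_on (Field r) r" "trans r" "antisym r" "total_on (Field r) r" "wf (r - Id)"
    using assms by (auto simp: order_on_defs)
  show "(a, a) \<in> r" if "a \<in> Field r" for a using r(1) that by (rule refl_onD)
  then show "(a, b) \<in> r \<or> (b, a) \<in> r" if "a \<in> Field r" "b \<in> Field r" for a b
    using r(4) that unfolding total_on_def by metis
  show "(a, c) \<in> r" if "(a, b) \<in> r" "(b, c) \<in> r" for a b c using r(2) that by (rule transD)
  show "a = b" if "(a, b) \<in> r" "(b, a) \<in> r" for a b using r(3) that by (rule antisymD)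
  show "wf (r - Id)" by fact
qed

lemma Well_order_least:
  assumes r: "Well_order r" and "A \<subseteq> Field r" "A \<noteq> {}"
  shows "\<exists>m\<in>A. \<forall>a\<in>A. (m, a) \<in> r"
proof -
  obtain m where m: "m \<in> A" "\<And>a. (a, m) \<in> r - Id \<Longrightarrow> a \<notin> A"
    using wfE_min[OF Well_orderD(5)[OF r]] assms(3) by (metis ex_in_conv)
  have "(m, a) \<in> r" if "a \<in> A" for a
    using Well_orderD(1,4)[OF r, of m] Well_orderD(4)[OF r, of m a] m that assms(2)
    by (metis DiffI in_mono pair_in_Id_conv)
  with m show ?thesis by blast
qed

lemma ex_bottom:
  assumes "Well_order r" "Field r \<noteq> {}"
  shows "\<exists>z. is_bottom r z"
  using Well_order_least[OF assms(1) order_refl assms(2)] by (auto simp: is_bottom_def)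

lemma bottom_unique:
  "Well_order r \<Longrightarrow> is_bottom r z \<Longrightarrow> is_bottom r z' \<Longrightarrow> z = z'"
  by (auto simp: is_bottom_def dest: Well_orderD(3))

lemma ex_successor:
  assumes r: "Well_order r" and "(a, b) \<in> r" "a \<noteq> b"
  shows "\<exists>c. is_successor r a c"
proof -
  obtain m where "m \<in> {c. (a, c) \<in> r \<and> a \<noteq> c}" "\<forall>c\<in>{c. (a, c) \<in> r \<and> a \<noteq> c}. (m, c) \<in> r"
    using Well_order_least[OF r, of "{c. (a, c) \<in> r \<and> a \<noteq> c}"] assms by (auto simp: Field_def)
  then show ?thesis unfolding is_successor_def by blast
qed

lemma successor_below:
  assumes r: "Well_order r" and s: "is_successor r a b"
  shows "underS r b = under r a" "a \<in> underS r b" "\<not> is_bottom r b"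
proof -
  have ab: "(a, b) \<in> r" "a \<noteq> b" and least: "\<And>c. (a, c) \<in> r \<Longrightarrow> a \<noteq> c \<Longrightarrow> (b, c) \<in> r"
    using s by (auto simp: is_successor_def)
  show "underS r b = under r a"
    unfolding underS_def under_def
    using ab least Well_orderD[OF r] by safe (metis FieldI1 FieldI2)+
  show "a \<in> underS r b" using ab by (simp add: underS_def)
  show "\<not> is_bottom r b"
    using ab Well_orderD(3)[OF r] by (auto simp: is_bottom_def Field_def)
qed

lemma successor_unique:
  "Well_order r \<Longrightarrow> is_successor r a b \<Longrightarrow> is_successor r a' b \<Longrightarrow> a = a'"
  unfolding is_successor_def by (metis FieldI1 Well_orderD(3,4))

lemma bottom_successor_limit:
  "b \<in> Field r \<Longrightarrow> is_bottom r b \<or> (\<exists>a. is_successor r a b) \<or> is_limit_element r b"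
  by (auto simp: is_limit_element_def)

lemma Field_Restr_underS:
  assumes "Well_order r"
  shows "Field (Restr r (underS r b)) = underS r b"
  using Well_orderD(1)[OF assms] by (auto simp: Field_def underS_def)

locale universe =
  fixes \<kappa> :: "'u rel"
  assumes inaccessible: "inaccessible \<kappa>"
begin

lemma card_order: "Card_order \<kappa>" and regular: "regularCard \<kappa>" and uncountable: "natLeq <o \<kappa>"
  using inaccessible by (auto simp: inaccessible_def)

lemma well_order: "Well_order \<kappa>"
  using card_order by (auto simp: card_order_on_def)

lemma infinite_Field: "infinite (Field \<kappa>)"
  using infinite_iff_natLeq_ordLeq[of "Field \<kappa>"] uncountable card_of_Field_ordIso[OF card_order]
  by (metis ordIso_symmetric ordLeq_ordIso_trans ordLess_imp_ordLeq)

lemma small_surj: "small \<kappa> A \<Longrightarrow> B \<subseteq> f ` A \<Longrightarrow> small \<kappa> B"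
  unfolding small_def using surj_imp_ordLeq ordLeq_ordLess_trans by blast

lemma small_subset: "small \<kappa> A \<Longrightarrow> B \<subseteq> A \<Longrightarrow> small \<kappa> B"
  using small_surj[of A B id] by simp

lemma small_image: "small \<kappa> A \<Longrightarrow> small \<kappa> (f ` A)"
  by (rule small_surj) auto

lemma small_finite: "finite A \<Longrightarrow> small \<kappa> A"
  unfolding small_def using uncountable finite_iff_ordLess_natLeq ordLess_transitive by blast

lemma small_UNION:
  assumes "small \<kappa> A" "\<And>a. a \<in> A \<Longrightarrow> small \<kappa> (B a)"
  shows "small \<kappa> (\<Union>a\<in>A. B a)"
  using card_of_UNION_ordLess_infinite_Field_regularCard[of \<kappa> A B] regular card_order infinite_Field
    assms by (auto simp: small_def cinfinite_def)

lemma small_Sigma: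
  assumes "small \<kappa> A" "\<And>a. a \<in> A \<Longrightarrow> small \<kappa> (B a)"
  shows "small \<kappa> (Sigma A B)"
proof -
  have "Sigma A B = (\<Union>a\<in>A. Pair a ` B a)" by auto
  then show ?thesis using assms by (metis (no_types, lifting) small_UNION small_image)
qed

lemma small_underS: "b \<in> Field \<kappa> \<Longrightarrow> small \<kappa> (underS \<kappa> b)"
  unfolding small_def by (rule card_of_underS[OF card_order])

lemma small_embeds:
  assumes "small \<kappa> A"
  shows "\<exists>f. inj_on f A \<and> f ` A \<subseteq> Field \<kappa>"
proof -
  have "|A| \<le>o |Field \<kappa>|"
    using assms card_of_Field_ordIso[OF card_order] unfolding small_def
    by (metis ordIso_symmetric ordLess_imp_ordLeq ordLess_ordIso_trans)
  then show ?thesis using card_of_ordLeq by blast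
qed

lemma no_maximum: "a \<in> Field \<kappa> \<Longrightarrow> \<exists>b\<in>Field \<kappa>. a \<noteq> b \<and> (a, b) \<in> \<kappa>"
  using infinite_Card_order_limit[OF card_order infinite_Field] by blast

text \<open>This is regularity of \<open>\<kappa>\<close>; the strict bound costs one more step, as \<open>\<kappa>\<close> has no greatest element.\<close>

lemma small_bounded:
  assumes "A \<subseteq> Field \<kappa>" "small \<kappa> A"
  shows "\<exists>b\<in>Field \<kappa>. \<forall>a\<in>A. a \<in> underS \<kappa> b"
proof -
  have "\<not> cofinal A \<kappa>"
    using regular assms not_ordLess_ordIso unfolding regularCard_def small_def by blast
  then obtain b where b: "b \<in> Field \<kappa>" "\<And>a. a \<in> A \<Longrightarrow> b = a \<or> (b, a) \<notin> \<kappa>"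
    unfolding cofinal_def by blast
  obtain c where c: "c \<in> Field \<kappa>" "b \<noteq> c" "(b, c) \<in> \<kappa>"
    using no_maximum[OF b(1)] by blast
  have "a \<in> underS \<kappa> c" if "a \<in> A" for a
    unfolding underS_def using b c that assms(1) Well_orderD[OF well_order]
    by (metis (mono_tags, lifting) mem_Collect_eq subsetD)
  with c show ?thesis by blast
qed

lemma Pow_small:
  assumes "small \<kappa> A"
  shows "small \<kappa> (Pow A)"
proof -
  obtain f where f: "inj_on f A" "f ` A \<subseteq> Field \<kappa>" using small_embeds[OF assms] by blast
  have "small \<kappa> (Pow (f ` A))"
    using inaccessible small_image[OF assms, of f] by (simp add: inaccessible_def small_def)
  moreover have "Pow A \<subseteq> (\<lambda>B. {a\<in>A. f a \<in> B}) ` Pow (f ` A)"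
  proof
    fix B assume "B \<in> Pow A"
    then have "B = {a\<in>A. f a \<in> f ` B}" using f(1) by (auto simp: inj_on_def)
    with \<open>B \<in> Pow A\<close> show "B \<in> (\<lambda>B. {a\<in>A. f a \<in> B}) ` Pow (f ` A)" by blast
  qed
  ultimately show ?thesis by (rule small_surj)
qed

lemma small_cardSuc:
  assumes "small \<kappa> A"
  shows "cardSuc |A| <o \<kappa>"
proof -
  have "cardSuc |A| \<le>o |Pow A|"
    using card_of_Pow by (rule cardSuc_least[OF card_of_Card_order card_of_Card_order])
  then show ?thesis using Pow_small[OF assms] unfolding small_def by (rule ordLeq_ordLess_trans)
qed

text \<open>
  The witness is the supremum of a chain of ordinals \<open>\<delta>\<^sub>i\<close>, where \<open>i\<close> runs over the successor
  cardinal of \<open>A\<close> and \<open>\<delta>\<^sub>i\<close> exceeds the earlier \<open>\<delta>\<^sub>j\<close> and all values of \<open>H\<close> up to them. Inaccessibility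
  keeps the successor cardinal, hence also the supremum, below \<open>\<kappa>\<close>; regularity of the successor
  cardinal makes the cofinality of the supremum larger than the cardinality of \<open>A\<close>.
\<close>

lemma closed_ordinal_of_large_cofinality:
  fixes A :: "'b set"
  assumes A: "small \<kappa> A" "infinite A" and H: "\<And>a. a \<in> Field \<kappa> \<Longrightarrow> H a \<in> Field \<kappa>"
  obtains \<delta> where "\<delta> \<in> Field \<kappa>" "underS \<kappa> \<delta> \<noteq> {}" "\<And>a. a \<in> underS \<kappa> \<delta> \<Longrightarrow> H a \<in> underS \<kappa> \<delta>"
    "\<And>a. a \<in> underS \<kappa> \<delta> \<Longrightarrow> \<exists>b\<in>underS \<kappa> \<delta>. a \<noteq> b \<and> (a, b) \<in> \<kappa>"
    "\<And>B. B \<subseteq> underS \<kappa> \<delta> \<Longrightarrow> |B| \<le>o |A| \<Longrightarrow> \<exists>b\<in>underS \<kappa> \<delta>. \<forall>a\<in>B. (a, b) \<in> \<kappa>"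
proof -
  note ord = Well_orderD[OF well_order]
  define \<Lambda> where "\<Lambda> = cardSuc |A|"
  have \<Lambda>: "Card_order \<Lambda>" "infinite (Field \<Lambda>)" "regularCard \<Lambda>" "\<Lambda> <o \<kappa>" "|A| <o \<Lambda>"
    unfolding \<Lambda>_def
    using infinite_cardSuc_regularCard[OF _ card_of_Card_order, of A] cardSuc_finite[OF card_of_Card_order, of A]
      cardSuc_Card_order[OF card_of_Card_order, of A] cardSuc_greater[OF card_of_Card_order, of A]
      small_cardSuc[OF A(1)] A(2) by (simp_all only: Field_card_of not_False_eq_True)
  then have wo: "Well_order \<Lambda>" by (simp add: card_order_on_def)
  note ord\<Lambda> = Well_orderD[OF wo]
  have small\<Lambda>: "small \<kappa> (Field \<Lambda>)" unfolding small_def using \<Lambda>(4) by (rule ordLess_Field)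
  define P where "P f i x \<longleftrightarrow> (i \<in> Field \<Lambda> \<longrightarrow> x \<in> Field \<kappa> \<and>
      (\<forall>j\<in>underS \<Lambda> i. \<forall>\<beta>\<in>under \<kappa> (f j). \<beta> \<in> underS \<kappa> x \<and> H \<beta> \<in> underS \<kappa> x))"
    for f :: "'b set \<Rightarrow> 'u" and i x
  have "\<exists>f. \<forall>i. P f i (f i)"
  proof (rule dependent_wf_choice[OF ord\<Lambda>(5)])
    fix f g :: "'b set \<Rightarrow> 'u" and i x
    assume "\<And>j. (j, i) \<in> \<Lambda> - Id \<Longrightarrow> f j = g j"
    then show "P f i x = P g i x" unfolding P_def underS_def by auto
  next
    fix i and f :: "'b set \<Rightarrow> 'u"
    assume IH: "\<And>j. (j, i) \<in> \<Lambda> - Id \<Longrightarrow> P f j (f j)"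
    show "\<exists>x. P f i x"
    proof (cases "i \<in> Field \<Lambda>")
      case True
      let ?B = "\<Union>j\<in>underS \<Lambda> i. under \<kappa> (f j)"
      have f: "f j \<in> Field \<kappa>" if "j \<in> underS \<Lambda> i" for j
        using IH that by (auto simp: P_def underS_def Field_def)
      have "small \<kappa> (under \<kappa> b)" if b: "b \<in> Field \<kappa>" for b
      proof -
        obtain c where c: "c \<in> Field \<kappa>" "b \<noteq> c" "(b, c) \<in> \<kappa>" using no_maximum[OF b] by blast
        have "under \<kappa> b \<subseteq> underS \<kappa> c"
          unfolding under_def underS_def using c ord(2,3) by blast
        then show ?thesis using small_subset small_underS[OF c(1)] by blast
      qed
      then have "small \<kappa> ?B"
        using f small\<Lambda> by (intro small_UNION) (auto intro: small_subset simp: underS_Field underS_def Field_def)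
      moreover have B: "?B \<subseteq> Field \<kappa>" by (auto simp: under_def Field_def)
      ultimately have "small \<kappa> (?B \<union> H ` ?B)"
        using small_image[of ?B H] card_of_Un_ordLess_infinite_Field[OF infinite_Field card_order]
        by (auto simp: small_def)
      moreover have "?B \<union> H ` ?B \<subseteq> Field \<kappa>" using H B by auto
      ultimately obtain x where "x \<in> Field \<kappa>" "\<forall>a\<in>?B \<union> H ` ?B. a \<in> underS \<kappa> x"
        using small_bounded by meson
      then show ?thesis unfolding P_def by blast
    qed (simp add: P_def)
  qed
  then obtain d where d: "\<And>i. P d i (d i)" by blast
  have dF: "d i \<in> Field \<kappa>" if "i \<in> Field \<Lambda>" for i using d[of i] that by (simp add: P_def)
  have dH: "\<beta> \<in> underS \<kappa> (d i)" "H \<beta> \<in> underS \<kappa> (d i)"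
    if "j \<in> underS \<Lambda> i" "\<beta> \<in> under \<kappa> (d j)" for i j \<beta>
    using d[of i] that by (auto simp: P_def underS_def Field_def)
  have next_exists: "\<exists>i. i \<in> Field \<Lambda> \<and> j \<in> underS \<Lambda> i" if "j \<in> Field \<Lambda>" for j
    using infinite_Card_order_limit[OF \<Lambda>(1,2) that] by (auto simp: underS_def)
  have mono: "(d j, d i) \<in> \<kappa>" if "(j, i) \<in> \<Lambda>" for i j
    using dH(1)[of j i "d j"] that dF[of j] ord(1)
    by (cases "j = i") (auto simp: underS_def under_def Field_def)
  \<comment> \<open>The supremum is the least element of the nonempty set of upper bounds.\<close>
  define ub where "ub = {x \<in> Field \<kappa>. \<forall>i\<in>Field \<Lambda>. (d i, x) \<in> \<kappa>}"
  have "ub \<noteq> {}"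
    using small_bounded[of "d ` Field \<Lambda>"] small_image[OF small\<Lambda>] dF
    by (fastforce simp: ub_def underS_def)
  moreover have "ub \<subseteq> Field \<kappa>" by (auto simp: ub_def)
  ultimately obtain \<delta> where \<delta>: "\<delta> \<in> ub" "\<And>x. x \<in> ub \<Longrightarrow> (\<delta>, x) \<in> \<kappa>"
    using Well_order_least[OF well_order] by meson
  have below: "\<exists>i\<in>Field \<Lambda>. a \<in> under \<kappa> (d i)" if "a \<in> underS \<kappa> \<delta>" for a
  proof (rule ccontr)
    assume "\<not> ?thesis"
    then have "(d i, a) \<in> \<kappa>" if "i \<in> Field \<Lambda>" for i
      using ord(4)[of a "d i"] dF[OF that] that \<open>a \<in> underS \<kappa> \<delta>\<close>
      by (auto simp: under_def underS_def Field_def)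
    then have "a \<in> ub" using that by (auto simp: ub_def underS_def Field_def)
    then show False using \<delta>(2)[of a] that ord(3)[of a \<delta>] by (auto simp: underS_def)
  qed
  have underS_under: "b \<in> underS \<kappa> c" if "(a, c) \<in> \<kappa>" "b \<in> underS \<kappa> a" for a b c
    using that ord(2)[of b a c] ord(3)[of a b] by (auto simp: underS_def)
  have d_below: "d i \<in> underS \<kappa> \<delta>" if i: "i \<in> Field \<Lambda>" for i
  proof -
    obtain i' where i': "i' \<in> Field \<Lambda>" "i \<in> underS \<Lambda> i'" using next_exists i by blast
    then have "(d i', \<delta>) \<in> \<kappa>" "d i \<in> underS \<kappa> (d i')"
      using \<delta>(1) dH(1)[of i i' "d i"] dF[OF i] ord(1) by (auto simp: ub_def under_def)
    then show ?thesis by (rule underS_under)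
  qed
  have chain: "\<beta> \<in> underS \<kappa> \<delta> \<and> H \<beta> \<in> underS \<kappa> \<delta>" if i: "i \<in> Field \<Lambda>" "\<beta> \<in> under \<kappa> (d i)" for i \<beta>
  proof -
    obtain i' where i': "i' \<in> Field \<Lambda>" "i \<in> underS \<Lambda> i'" using next_exists i by blast
    have "(d i', \<delta>) \<in> \<kappa>" using \<delta>(1) i' by (auto simp: ub_def)
    then show ?thesis using dH[OF i'(2) i(2)] underS_under by blast
  qed
  show thesis
  proof
    show "\<delta> \<in> Field \<kappa>" using \<delta>(1) by (simp add: ub_def)
    show "underS \<kappa> \<delta> \<noteq> {}" using d_below \<Lambda>(2) by (metis empty_iff finite.emptyI ex_in_conv)
    show "H a \<in> underS \<kappa> \<delta>" if "a \<in> underS \<kappa> \<delta>" for a using below[OF that] chain by blast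
    show "\<exists>b\<in>underS \<kappa> \<delta>. a \<noteq> b \<and> (a, b) \<in> \<kappa>" if a: "a \<in> underS \<kappa> \<delta>" for a
    proof -
      obtain i where i: "i \<in> Field \<Lambda>" "a \<in> under \<kappa> (d i)" using below a by blast
      obtain i' where i': "i' \<in> Field \<Lambda>" "i \<in> underS \<Lambda> i'" using next_exists i by blast
      show ?thesis using dH(1)[OF i'(2) i(2)] d_below[OF i'(1)] by (auto simp: underS_def)
    qed
    show "\<exists>b\<in>underS \<kappa> \<delta>. \<forall>a\<in>B. (a, b) \<in> \<kappa>" if B: "B \<subseteq> underS \<kappa> \<delta>" "|B| \<le>o |A|" for B
    proof -
      obtain s where s: "\<And>a. a \<in> B \<Longrightarrow> s a \<in> Field \<Lambda> \<and> a \<in> under \<kappa> (d (s a))"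
        using below B(1) by (metis subsetD)
      have "|s ` B| <o \<Lambda>"
        using card_of_image[of s B] B(2) \<Lambda>(5) ordLeq_transitive ordLeq_ordLess_trans by blast
      then have "\<not> cofinal (s ` B) \<Lambda>"
        using \<Lambda>(3) s not_ordLess_ordIso unfolding regularCard_def by blast
      then obtain i where i: "i \<in> Field \<Lambda>" "\<And>a. a \<in> B \<Longrightarrow> (s a, i) \<in> \<Lambda>"
        unfolding cofinal_def using s ord\<Lambda>(1,4) by (metis image_eqI)
      have "(a, d i) \<in> \<kappa>" if "a \<in> B" for a
        using s[OF that] mono[OF i(2)[OF that]] ord(2) by (auto simp: under_def)
      then show ?thesis using d_below[OF i(1)] by blast
    qed
  qed
qed

text \<open>
  The fibres of a bijection from \<open>\<kappa>\<close> to its cube, composed with a projection, are as large as \<open>\<kappa>\<close>,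
  hence unbounded. So a construction of length \<open>\<kappa>\<close> that treats the task \<open>e c\<close> at stage \<open>c\<close> treats each
  of \<open>\<kappa> \<times> \<kappa>\<close> many tasks after any given stage.
\<close>

lemma ex_bookkeeping:
  "\<exists>e :: 'u \<Rightarrow> 'u \<times> 'u. \<forall>x\<in>Field \<kappa>. \<forall>y\<in>Field \<kappa>. \<forall>a\<in>Field \<kappa>. \<exists>c. (a, c) \<in> \<kappa> \<and> e c = (x, y)"
proof -
  let ?F = "Field \<kappa>"
  have "|?F \<times> ?F| =o |?F|" using card_of_Times_same_infinite[OF infinite_Field] .
  moreover have "|(?F \<times> ?F) \<times> ?F| =o |?F|"
    using infinite_Field calculation card_of_Times_infinite_simps(3)[of ?F "?F \<times> ?F"]
    by (metis Sigma_empty1 card_of_Times_infinite_simps(3) finite.emptyI ordIso_iff_ordLeq Times_empty)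
  ultimately obtain g where g: "bij_betw g ?F ((?F \<times> ?F) \<times> ?F)"
    using card_of_ordIso ordIso_symmetric by blast
  have "\<exists>c. (a, c) \<in> \<kappa> \<and> fst (g c) = (x, y)" if xy: "x \<in> ?F" "y \<in> ?F" "a \<in> ?F" for x y a
  proof (rule ccontr)
    assume *: "\<not> ?thesis"
    have "?F \<subseteq> (\<lambda>c. snd (g c)) ` underS \<kappa> a"
    proof
      fix z assume "z \<in> ?F"
      then obtain c where c: "c \<in> ?F" "g c = ((x, y), z)"
        using g xy unfolding bij_betw_def by (metis (no_types, lifting) SigmaI imageE)
      then have "(a, c) \<notin> \<kappa>" using * by auto
      then have "c \<in> underS \<kappa> a"
        using Well_orderD(1,4)[OF well_order] c(1) xy(3) unfolding underS_def by blast
      then show "z \<in> (\<lambda>c. snd (g c)) ` underS \<kappa> a" using c by force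
    qed
    then have "small \<kappa> ?F" using small_surj[OF small_underS[OF xy(3)]] by blast
    then show False
      using card_of_Field_ordIso[OF card_order] not_ordLess_ordIso by (auto simp: small_def)
  qed
  then show ?thesis by (intro exI[of _ "\<lambda>c. fst (g c)"]) blast
qed

end


section \<open>Diagrams indexed by ordered sets\<close>

lemma homD:
  "f \<in> hom C X Y \<Longrightarrow> f \<in> Mor C" "f \<in> hom C X Y \<Longrightarrow> Dom C f = X" "f \<in> hom C X Y \<Longrightarrow> Cod C f = Y"
  by (auto simp: hom_def)

lemma in_hom: "f \<in> Mor C \<Longrightarrow> f \<in> hom C (Dom C f) (Cod C f)"
  by (simp add: hom_def)

context category
begin

lemma hom_Obj: "f \<in> hom C X Y \<Longrightarrow> X \<in> Obj C" "f \<in> hom C X Y \<Longrightarrow> Y \<in> Obj C"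
  using Dom_in_Obj Cod_in_Obj by (auto simp: hom_def)

lemma Comp_Mor: "f \<in> Mor C \<Longrightarrow> g \<in> Mor C \<Longrightarrow> Cod C f = Dom C g \<Longrightarrow> g \<cdot> f \<in> hom C (Dom C f) (Cod C g)"
  using Comp_in_hom[of f "Dom C f" "Cod C f" g "Cod C g"] by (simp add: hom_def)

end

lemma order_cat_simps [simp]:
  "Obj (order_cat r) = Field r" "Mor (order_cat r) = r" "Dom (order_cat r) = fst"
  "Cod (order_cat r) = snd" "Ident (order_cat r) = (\<lambda>a. (a, a))"
  "Comp (order_cat r) = (\<lambda>v u. (fst u, snd v))"
  by (simp_all add: order_cat_def)

lemma category_order_cat:
  assumes "\<And>a. a \<in> Field r \<Longrightarrow> (a, a) \<in> r" "\<And>a b c. (a, b) \<in> r \<Longrightarrow> (b, c) \<in> r \<Longrightarrow> (a, c) \<in> r"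
  shows "category (order_cat r)"
  by unfold_locales (auto simp: hom_def FieldI1 FieldI2 intro: assms)

lemma is_functor_order_cat:
  "is_functor (order_cat r) C Fo Fm \<longleftrightarrow>
     (\<forall>a\<in>Field r. Fo a \<in> Obj C \<and> Fm (a, a) = Ident C (Fo a)) \<and>
     (\<forall>a b. (a, b) \<in> r \<longrightarrow> Fm (a, b) \<in> hom C (Fo a) (Fo b)) \<and>
     (\<forall>a b c. (a, b) \<in> r \<longrightarrow> (b, c) \<in> r \<longrightarrow> Fm (a, c) = Fm (b, c) \<cdot>\<^bsub>C\<^esub> Fm (a, b))"
  unfolding is_functor_def by (auto simp: Ball_def split_paired_All)

lemma is_cocone_order_cat:
  "is_cocone (order_cat r) C Fo Fm L \<iota> \<longleftrightarrow>
     L \<in> Obj C \<and> (\<forall>a\<in>Field r. \<iota> a \<in> hom C (Fo a) L) \<and>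
     (\<forall>a b. (a, b) \<in> r \<longrightarrow> \<iota> b \<cdot>\<^bsub>C\<^esub> Fm (a, b) = \<iota> a)"
  unfolding is_cocone_def by auto

lemma is_colimit_cong:
  assumes "\<And>a. a \<in> Field r \<Longrightarrow> Fo a = Fo' a" "\<And>a b. (a, b) \<in> r \<Longrightarrow> Fm (a, b) = Fm' (a, b)"
    "\<And>a. a \<in> Field r \<Longrightarrow> \<iota> a = \<iota>' a"
  shows "is_colimit (order_cat r) C Fo Fm L \<iota> = is_colimit (order_cat r) C Fo' Fm' L \<iota>'"
proof -
  have "is_cocone (order_cat r) C Fo Fm L' j = is_cocone (order_cat r) C Fo' Fm' L' j" for L' j
    unfolding is_cocone_order_cat using assms(1,2) by simp
  moreover have "is_cocone (order_cat r) C Fo' Fm' L \<iota> = is_cocone (order_cat r) C Fo' Fm' L \<iota>'"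
    unfolding is_cocone_order_cat using assms(3) by (simp add: FieldI1 FieldI2)
  ultimately show ?thesis unfolding is_colimit_def using assms(3) by simp
qed

context category
begin

lemma colimit_cocone:
  assumes "is_colimit (order_cat r) C Fo Fm L \<iota>"
  shows "L \<in> Obj C" "\<And>a. a \<in> Field r \<Longrightarrow> \<iota> a \<in> hom C (Fo a) L"
    "\<And>a b. (a, b) \<in> r \<Longrightarrow> \<iota> b \<cdot> Fm (a, b) = \<iota> a"
  using assms unfolding is_colimit_def is_cocone_order_cat by blast+

lemma colimit_induced:
  assumes "is_colimit (order_cat r) C Fo Fm L \<iota>" "Z \<in> Obj C"
    "\<And>a. a \<in> Field r \<Longrightarrow> j a \<in> hom C (Fo a) Z" "\<And>a b. (a, b) \<in> r \<Longrightarrow> j b \<cdot> Fm (a, b) = j a"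
  obtains h where "h \<in> hom C L Z" "\<And>a. a \<in> Field r \<Longrightarrow> h \<cdot> \<iota> a = j a"
proof -
  have "is_cocone (order_cat r) C Fo Fm Z j" unfolding is_cocone_order_cat using assms by blast
  then have "\<exists>h. h \<in> hom C L Z \<and> (\<forall>a\<in>Obj (order_cat r). h \<cdot> \<iota> a = j a)"
    using assms(1) unfolding is_colimit_def by blast
  then show thesis using that by auto
qed

lemma colimit_eqI:
  assumes col: "is_colimit (order_cat r) C Fo Fm L \<iota>" and F: "is_functor (order_cat r) C Fo Fm"
    and h: "h \<in> hom C L Z" "h' \<in> hom C L Z" "\<And>a. a \<in> Field r \<Longrightarrow> h \<cdot> \<iota> a = h' \<cdot> \<iota> a"
  shows "h = h'"
proof -
  note c = colimit_cocone[OF col]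
  have "is_cocone (order_cat r) C Fo Fm Z (\<lambda>a. h \<cdot> \<iota> a)"
    unfolding is_cocone_order_cat
  proof (intro conjI ballI allI impI)
    show "Z \<in> Obj C" using h hom_Obj by blast
    show "h \<cdot> \<iota> a \<in> hom C (Fo a) Z" if "a \<in> Field r" for a using c(2)[OF that] h(1) Comp_in_hom by blast
    show "h \<cdot> \<iota> b \<cdot> Fm (a, b) = h \<cdot> \<iota> a" if "(a, b) \<in> r" for a b
    proof -
      have "Fm (a, b) \<in> hom C (Fo a) (Fo b)" using F that by (auto simp: is_functor_order_cat)
      then show ?thesis
        using c(3)[OF that] Comp_assoc[OF _ c(2)[OF FieldI2[OF that]] h(1), of "Fm (a, b)" "Fo a"] by simp
    qed
  qed
  then have "\<exists>!k. k \<in> hom C L Z \<and> (\<forall>a\<in>Obj (order_cat r). k \<cdot> \<iota> a = h \<cdot> \<iota> a)"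
    using col unfolding is_colimit_def by blast
  then show ?thesis using h by (metis order_cat_simps(1))
qed

end

section \<open>Small colimits\<close>

locale cocomplete_category = category C + universe \<kappa>
  for C :: "('o, 'm, 'x) category_scheme" (structure) and \<kappa> :: "'u rel" +
  assumes cocomplete: "cocomplete \<kappa> C"
    and hom_small: "X \<in> Obj C \<Longrightarrow> Y \<in> Obj C \<Longrightarrow> small \<kappa> (hom C X Y)"
begin

text \<open>
  Cocompleteness speaks of index categories carried by \<open>'u\<close>; a small index category on other
  types is copied there along injections.
\<close>

lemma small_colimit_exists:
  fixes D :: "('i, 'j, 'y) category_scheme"
  assumes D: "category D" and small: "small \<kappa> (Obj D)" "small \<kappa> (Mor D)" and F: "is_functor D C Fo Fm"
  shows "\<exists>L \<iota>. is_colimit D C Fo Fm L \<iota>"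
proof -
  interpret D: category D by fact
  obtain \<phi> :: "'i \<Rightarrow> 'u" where \<phi>: "inj_on \<phi> (Obj D)" using small_embeds[OF small(1)] by blast
  obtain \<psi> :: "'j \<Rightarrow> 'u" where \<psi>: "inj_on \<psi> (Mor D)" using small_embeds[OF small(2)] by blast
  define \<phi>' where "\<phi>' = inv_into (Obj D) \<phi>"
  define \<psi>' where "\<psi>' = inv_into (Mor D) \<psi>"
  have \<phi>' [simp]: "\<phi>' (\<phi> i) = i" if "i \<in> Obj D" for i using \<phi> that by (simp add: \<phi>'_def)
  have \<psi>' [simp]: "\<psi>' (\<psi> u) = u" if "u \<in> Mor D" for u using \<psi> that by (simp add: \<psi>'_def)
  define E :: "('u, 'u) category" where
    "E = \<lparr>Obj = \<phi> ` Obj D, Mor = \<psi> ` Mor D, Dom = (\<lambda>u. \<phi> (Dom D (\<psi>' u))), Cod = (\<lambda>u. \<phi> (Cod D (\<psi>' u))),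
       Ident = (\<lambda>i. \<psi> (Ident D (\<phi>' i))), Comp = (\<lambda>v u. \<psi> (\<psi>' v \<cdot>\<^bsub>D\<^esub> \<psi>' u))\<rparr>"
  have [simp]: "Obj E = \<phi> ` Obj D" "Mor E = \<psi> ` Mor D" "Dom E = (\<lambda>u. \<phi> (Dom D (\<psi>' u)))"
    "Cod E = (\<lambda>u. \<phi> (Cod D (\<psi>' u)))" "Ident E = (\<lambda>i. \<psi> (Ident D (\<phi>' i)))"
    "Comp E = (\<lambda>v u. \<psi> (\<psi>' v \<cdot>\<^bsub>D\<^esub> \<psi>' u))"
    by (simp_all add: E_def)
  have Id [simp]: "Ident D i \<in> Mor D" "Dom D (Ident D i) = i" "Cod D (Ident D i) = i" if "i \<in> Obj D" for i
    using D.Ident_in_hom[OF that] by (auto dest: homD)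
  have Cp [simp]: "v \<cdot>\<^bsub>D\<^esub> u \<in> Mor D" "Dom D (v \<cdot>\<^bsub>D\<^esub> u) = Dom D u" "Cod D (v \<cdot>\<^bsub>D\<^esub> u) = Cod D v"
    if "u \<in> Mor D" "v \<in> Mor D" "Cod D u = Dom D v" for u v
    using D.Comp_Mor[OF that] by (auto dest: homD)
  have \<phi>_eq [simp]: "\<phi> i = \<phi> j \<longleftrightarrow> i = j" if "i \<in> Obj D" "j \<in> Obj D" for i j
    using \<phi> that by (auto simp: inj_on_def)
  have homE: "f \<in> hom E X Y \<longleftrightarrow> (\<exists>u\<in>Mor D. f = \<psi> u \<and> X = \<phi> (Dom D u) \<and> Y = \<phi> (Cod D u))" for f X Y
    by (auto simp: hom_def)
  have "category E"
  proof
    show "Dom E f \<in> Obj E" "Cod E f \<in> Obj E" if "f \<in> Mor E" for f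
      using that by (auto intro!: D.Dom_in_Obj D.Cod_in_Obj)
    show "Ident E X \<in> hom E X X" if "X \<in> Obj E" for X
      using that unfolding homE by (auto intro!: bexI[of _ "Ident D _"])
    show "Comp E g f \<in> hom E X Z" if "f \<in> hom E X Y" "g \<in> hom E Y Z" for f g X Y Z
      using that unfolding homE by (fastforce simp: D.Dom_in_Obj D.Cod_in_Obj)
    show "Comp E f (Ident E X) = f" "Comp E (Ident E Y) f = f" if "f \<in> hom E X Y" for f X Y
      using that unfolding homE
      by (auto simp: D.Dom_in_Obj D.Cod_in_Obj D.Comp_Ident[OF in_hom] D.Ident_Comp[OF in_hom])
    show "Comp E h (Comp E g f) = Comp E (Comp E h g) f"
      if "f \<in> hom E W X" "g \<in> hom E X Y" "h \<in> hom E Y Z" for f g h W X Y Z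
      using that unfolding homE
      by (auto simp: D.Dom_in_Obj D.Cod_in_Obj) (metis D.Comp_assoc in_hom)
  qed
  moreover have "is_functor E C (\<lambda>i. Fo (\<phi>' i)) (\<lambda>u. Fm (\<psi>' u))"
    using F unfolding is_functor_def by (auto simp: D.Dom_in_Obj D.Cod_in_Obj)
  moreover have "small \<kappa> (Obj E)" "small \<kappa> (Mor E)" using small by (auto intro: small_image)
  ultimately obtain L \<iota> where L: "is_colimit E C (\<lambda>i. Fo (\<phi>' i)) (\<lambda>u. Fm (\<psi>' u)) L \<iota>"
    using cocomplete unfolding cocomplete_def by meson
  have cocone: "is_cocone E C (\<lambda>i. Fo (\<phi>' i)) (\<lambda>u. Fm (\<psi>' u)) Z j \<longleftrightarrow> is_cocone D C Fo Fm Z (\<lambda>i. j (\<phi> i))"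
    for Z j
    unfolding is_cocone_def by (auto simp: D.Dom_in_Obj D.Cod_in_Obj)
  have "is_colimit D C Fo Fm L (\<lambda>i. \<iota> (\<phi> i))"
    unfolding is_colimit_def
  proof (intro conjI allI impI)
    show "is_cocone D C Fo Fm L (\<lambda>i. \<iota> (\<phi> i))" using L cocone by (simp add: is_colimit_def)
    fix Z j assume j: "is_cocone D C Fo Fm Z j"
    have "is_cocone D C Fo Fm Z (\<lambda>i. j (\<phi>' (\<phi> i)))"
      using j unfolding is_cocone_def by (auto simp: D.Dom_in_Obj D.Cod_in_Obj)
    then have "is_cocone E C (\<lambda>i. Fo (\<phi>' i)) (\<lambda>u. Fm (\<psi>' u)) Z (\<lambda>i. j (\<phi>' i))" using cocone by blast
    then have "\<exists>!h. h \<in> hom C L Z \<and> (\<forall>i\<in>Obj E. h \<cdot> \<iota> i = j (\<phi>' i))"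
      using L unfolding is_colimit_def by blast
    then show "\<exists>!h. h \<in> hom C L Z \<and> (\<forall>i\<in>Obj D. h \<cdot> \<iota> (\<phi> i) = j i)" by simp
  qed
  then show ?thesis by blast
qed

lemma order_colimit_exists:
  assumes "\<And>a. a \<in> Field r \<Longrightarrow> (a, a) \<in> r" "\<And>a b c. (a, b) \<in> r \<Longrightarrow> (b, c) \<in> r \<Longrightarrow> (a, c) \<in> r"
    and "small \<kappa> (Field r)" and "is_functor (order_cat r) C Fo Fm"
  shows "\<exists>L \<iota>. is_colimit (order_cat r) C Fo Fm L \<iota>"
proof (rule small_colimit_exists)
  have "r \<subseteq> Field r \<times> Field r" by (auto simp: Field_def)
  then show "small \<kappa> (Mor (order_cat r))"
    using small_subset small_Sigma assms(3) by (metis order_cat_simps(2))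
  show "category (order_cat r)" using assms(1,2) by (rule category_order_cat)
qed (use assms in auto)

text \<open>A span is a diagram on the poset with elements \<open>0\<close>, \<open>1\<close>, \<open>2\<close> and \<open>0 < 1\<close>, \<open>0 < 2\<close>.\<close>

lemma pushout_exists:
  assumes f: "f \<in> hom C A B" and g: "g \<in> hom C A X"
  shows "\<exists>p q. is_pushout C f g p q"
proof -
  define r :: "nat rel" where "r = {(0,0), (1,1), (2,2), (0,1), (0,2)}"
  have Fr: "Field r = {0, 1, 2}" by (auto simp: r_def Field_def)
  define Fo where "Fo n = (if n = 0 then A else if n = 1 then B else X)" for n :: nat
  define Fm where "Fm u = (if fst u = snd u then Ident C (Fo (fst u)) else if snd u = 1 then f else g)"
    for u :: "nat \<times> nat"
  have Obj: "A \<in> Obj C" "B \<in> Obj C" "X \<in> Obj C" using f g hom_Obj by blast+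
  have F: "is_functor (order_cat r) C Fo Fm"
    unfolding is_functor_order_cat Fr
    using Obj f g
    by (auto simp: r_def Fm_def Fo_def Ident_in_hom Comp_Ident[OF f] Comp_Ident[OF g] Ident_Comp[OF f]
        Ident_Comp[OF g] Comp_Ident[OF Ident_in_hom])
  have "\<exists>L \<iota>. is_colimit (order_cat r) C Fo Fm L \<iota>"
    using F by (rule order_colimit_exists[rotated -1]) (auto simp: r_def Field_def intro: small_finite)
  then obtain L \<iota> where L: "is_colimit (order_cat r) C Fo Fm L \<iota>" by blast
  note c = colimit_cocone[OF L, unfolded Fr]
  have \<iota>: "\<iota> 0 \<in> hom C A L" "\<iota> 1 \<in> hom C B L" "\<iota> 2 \<in> hom C X L"
    using c(2)[of 0] c(2)[of 1] c(2)[of 2] by (auto simp: Fo_def)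
  have \<iota>f: "\<iota> 1 \<cdot> f = \<iota> 0" and \<iota>g: "\<iota> 2 \<cdot> g = \<iota> 0"
    using c(3)[of 0 1] c(3)[of 0 2] by (auto simp: r_def Fm_def)
  have "is_pushout C f g (\<iota> 1) (\<iota> 2)"
    unfolding is_pushout_def
  proof (intro conjI allI ballI impI)
    fix Z p' q' assume p: "p' \<in> hom C (Cod C f) Z" and q: "q' \<in> hom C (Cod C g) Z" and pq: "p' \<cdot> f = q' \<cdot> g"
    have p': "p' \<in> hom C B Z" "q' \<in> hom C X Z" using p q f g homD(3) by metis+
    define j where "j n = (if n = 0 then p' \<cdot> f else if n = 1 then p' else q')" for n :: nat
    obtain h where h: "h \<in> hom C L Z" "\<And>a. a \<in> Field r \<Longrightarrow> h \<cdot> \<iota> a = j a"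
    proof (rule colimit_induced[OF L, where Z = Z and j = j])
      show "Z \<in> Obj C" using p' hom_Obj by blast
      show "j a \<in> hom C (Fo a) Z" if "a \<in> Field r" for a
        using that p' f Comp_in_hom unfolding Fr by (auto simp: j_def Fo_def)
      show "j b \<cdot> Fm (a, b) = j a" if "(a, b) \<in> r" for a b
        using that p' pq Comp_Ident[OF Comp_in_hom[OF f p'(1)]]
        by (auto simp: r_def j_def Fm_def Fo_def Comp_Ident)
    qed blast
    show "\<exists>!h. h \<in> hom C (Cod C (\<iota> 1)) Z \<and> h \<cdot> \<iota> 1 = p' \<and> h \<cdot> \<iota> 2 = q'"
      unfolding homD(3)[OF \<iota>(2)]
    proof (rule ex1I[of _ h])
      show "h \<in> hom C L Z \<and> h \<cdot> \<iota> 1 = p' \<and> h \<cdot> \<iota> 2 = q'"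
        using h(1) h(2)[of 1] h(2)[of 2] by (auto simp: Fr j_def)
      fix k assume k: "k \<in> hom C L Z \<and> k \<cdot> \<iota> 1 = p' \<and> k \<cdot> \<iota> 2 = q'"
      have "k \<cdot> \<iota> 0 = p' \<cdot> f" "h \<cdot> \<iota> 0 = p' \<cdot> f"
        using k h(1) h(2)[of 1] Comp_assoc[OF f \<iota>(2)] by (auto simp: Fr \<iota>f[symmetric] j_def)
      then show "k = h"
        using k h(2)[of 1] h(2)[of 2] by (intro colimit_eqI[OF L F _ h(1)]) (auto simp: Fr j_def)
    qed
  qed (use f g \<iota> \<iota>f \<iota>g in \<open>auto simp: hom_def\<close>)
  then show ?thesis by blast
qed

end

context category
begin

lemma pushoutD:
  assumes "is_pushout C f g p q"
  shows "f \<in> hom C (Dom C f) (Cod C f)" "g \<in> hom C (Dom C f) (Cod C g)"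
    "p \<in> hom C (Cod C f) (Cod C p)" "q \<in> hom C (Cod C g) (Cod C p)" "p \<cdot> f = q \<cdot> g"
  using assms by (auto simp: is_pushout_def hom_def)

lemma pushout_induced:
  assumes "is_pushout C f g p q" "p' \<in> hom C (Cod C f) Z" "q' \<in> hom C (Cod C g) Z" "p' \<cdot> f = q' \<cdot> g"
  obtains h where "h \<in> hom C (Cod C p) Z" "h \<cdot> p = p'" "h \<cdot> q = q'"
  using assms unfolding is_pushout_def by blast

lemma pushout_eqI:
  assumes P: "is_pushout C f g p q" and h: "h \<in> hom C (Cod C p) Z" "h' \<in> hom C (Cod C p) Z"
    "h \<cdot> p = h' \<cdot> p" "h \<cdot> q = h' \<cdot> q"
  shows "h = h'"
proof -
  note D = pushoutD[OF P]
  have "h \<cdot> p \<cdot> f = h \<cdot> q \<cdot> g"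
    using Comp_assoc[OF D(1,3) h(1)] Comp_assoc[OF D(2,4) h(1)] D(5) by simp
  moreover have "h \<cdot> p \<in> hom C (Cod C f) Z" "h \<cdot> q \<in> hom C (Cod C g) Z"
    using D h(1) Comp_in_hom by blast+
  ultimately have "\<exists>!k. k \<in> hom C (Cod C p) Z \<and> k \<cdot> p = h \<cdot> p \<and> k \<cdot> q = h \<cdot> q"
    using P unfolding is_pushout_def by blast
  then show ?thesis using h by metis
qed

end

section \<open>Transfinite recursion for sequences\<close>

text \<open>
  Sequences in a category \<open>C\<close> are constructed together with additional structure on their
  values. A state \<open>e\<close> is an object \<open>U e\<close> of \<open>C\<close> with such structure, \<open>St a\<close> are the states that are
  admissible at the stage \<open>a\<close>, and \<open>H e e' m\<close> says that \<open>m : U e \<rightarrow> U e'\<close> respects the structure.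
\<close>

definition is_section_on ::
  "('o, 'm, 'x) category_scheme \<Rightarrow> 'a rel \<Rightarrow> ('a \<Rightarrow> 's set) \<Rightarrow> ('s \<Rightarrow> 'o) \<Rightarrow> ('s \<Rightarrow> 's \<Rightarrow> 'm \<Rightarrow> bool) \<Rightarrow>
   'a set \<Rightarrow> ('a \<Rightarrow> 's) \<Rightarrow> ('a \<times> 'a \<Rightarrow> 'm) \<Rightarrow> bool" where
  "is_section_on C r St U H A F Fm \<longleftrightarrow>
     (\<forall>a\<in>A. F a \<in> St a \<and> Fm (a, a) = Ident C (U (F a))) \<and>
     (\<forall>a\<in>A. \<forall>b\<in>A. (a, b) \<in> r \<longrightarrow> H (F a) (F b) (Fm (a, b))) \<and>
     (\<forall>a\<in>A. \<forall>b\<in>A. \<forall>c\<in>A. (a, b) \<in> r \<longrightarrow> (b, c) \<in> r \<longrightarrow> Fm (b, c) \<cdot>\<^bsub>C\<^esub> Fm (a, b) = Fm (a, c))"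

lemma is_section_onD:
  assumes "is_section_on C r St U H A F Fm"
  shows "\<And>a. a \<in> A \<Longrightarrow> F a \<in> St a" "\<And>a. a \<in> A \<Longrightarrow> Fm (a, a) = Ident C (U (F a))"
    "\<And>a b. a \<in> A \<Longrightarrow> b \<in> A \<Longrightarrow> (a, b) \<in> r \<Longrightarrow> H (F a) (F b) (Fm (a, b))"
    "\<And>a b c. a \<in> A \<Longrightarrow> b \<in> A \<Longrightarrow> c \<in> A \<Longrightarrow> (a, b) \<in> r \<Longrightarrow> (b, c) \<in> r \<Longrightarrow>
      Fm (b, c) \<cdot>\<^bsub>C\<^esub> Fm (a, b) = Fm (a, c)"
  using assms unfolding is_section_on_def by blast+

lemma is_section_on_subset:
  "is_section_on C r St U H A F Fm \<Longrightarrow> B \<subseteq> A \<Longrightarrow> is_section_on C r St U H B F Fm"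
  unfolding is_section_on_def by blast

context category
begin

lemma section_is_functor:
  assumes "is_section_on C r St U H A F Fm"
    and "\<And>e e' m. H e e' m \<Longrightarrow> m \<in> hom C (U e) (U e')" and "\<And>a e. e \<in> St a \<Longrightarrow> U e \<in> Obj C"
  shows "is_functor (order_cat (Restr r A)) C (\<lambda>a. U (F a)) Fm"
proof -
  have A: "Field (Restr r A) \<subseteq> A" by (auto simp: Field_def)
  have "U (F a) \<in> Obj C" "Fm (a, a) = Ident C (U (F a))" if "a \<in> A" for a
    using assms(1) assms(3)[of "F a" a] that by (auto simp: is_section_on_def)
  moreover have "Fm (a, b) \<in> hom C (U (F a)) (U (F b))" if "(a, b) \<in> Restr r A" for a b
    using assms(1) assms(2)[of "F a" "F b"] that by (auto simp: is_section_on_def)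
  moreover have "Fm (a, c) = Fm (b, c) \<cdot> Fm (a, b)" if "(a, b) \<in> Restr r A" "(b, c) \<in> Restr r A" for a b c
    using assms(1) that unfolding is_section_on_def by (metis (no_types, lifting) IntD1 IntD2 SigmaD1 SigmaD2)
  ultimately show ?thesis unfolding is_functor_order_cat using A by blast
qed

text \<open>
  The values at \<open>b\<close> of the functor and of its arrows into \<open>b\<close> are chosen simultaneously, by
  well-founded recursion. The condition \<open>T\<close> imposed on a successor step may depend on the whole
  construction up to this step.
\<close>

lemma transfinite_section:
  fixes r :: "'a rel" and St :: "'a \<Rightarrow> 's set" and U :: "'s \<Rightarrow> 'o" and H :: "'s \<Rightarrow> 's \<Rightarrow> 'm \<Rightarrow> bool"
    and T :: "'a \<Rightarrow> ('a \<Rightarrow> 's) \<Rightarrow> ('a \<times> 'a \<Rightarrow> 'm) \<Rightarrow> 's \<Rightarrow> 'm \<Rightarrow> bool"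
  assumes r: "Well_order r"
    and U: "\<And>a e. e \<in> St a \<Longrightarrow> U e \<in> Obj C"
    and H: "\<And>e e' m. H e e' m \<Longrightarrow> m \<in> hom C (U e) (U e')"
    and H_Ident: "\<And>a e. e \<in> St a \<Longrightarrow> H e e (Ident C (U e))"
    and H_Comp: "\<And>e e' e'' m m'. H e e' m \<Longrightarrow> H e' e'' m' \<Longrightarrow> H e e'' (m' \<cdot> m)"
    and T_cong: "\<And>a F F' Fm Fm' e m. (\<And>c. c \<in> under r a \<Longrightarrow> F c = F' c) \<Longrightarrow>
      (\<And>c d. (c, d) \<in> r \<Longrightarrow> (d, a) \<in> r \<Longrightarrow> Fm (c, d) = Fm' (c, d)) \<Longrightarrow> T a F Fm e m \<Longrightarrow> T a F' Fm' e m"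
    and colimits: "\<And>b Xo Xm. b \<in> Field r \<Longrightarrow> is_functor (order_cat (Restr r (underS r b))) C Xo Xm \<Longrightarrow>
      \<exists>L \<iota>. is_colimit (order_cat (Restr r (underS r b))) C Xo Xm L \<iota>"
    and bottom: "\<And>z. is_bottom r z \<Longrightarrow> e0 \<in> St z"
    and succ: "\<And>a b F Fm. is_successor r a b \<Longrightarrow> is_section_on C r St U H (under r a) F Fm \<Longrightarrow>
      \<exists>e\<in>St b. \<exists>m. H (F a) e m \<and> T a F Fm e m"
    and limit: "\<And>b F Fm L \<iota>. is_limit_element r b \<Longrightarrow> is_section_on C r St U H (underS r b) F Fm \<Longrightarrow>
      is_colimit (order_cat (Restr r (underS r b))) C (\<lambda>a. U (F a)) Fm L \<iota> \<Longrightarrow>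
      \<exists>e\<in>St b. U e = L \<and> (\<forall>a\<in>underS r b. H (F a) e (\<iota> a))"
  obtains F Fm where "is_section_on C r St U H (Field r) F Fm"
    "\<And>z. is_bottom r z \<Longrightarrow> F z = e0"
    "\<And>a b. is_successor r a b \<Longrightarrow> T a F Fm (F b) (Fm (a, b))"
    "\<And>b. is_limit_element r b \<Longrightarrow>
      is_colimit (order_cat (Restr r (underS r b))) C (\<lambda>a. U (F a)) Fm (U (F b)) (\<lambda>a. Fm (a, b))"
proof -
  note ord = Well_orderD[OF r]
  \<comment> \<open>A value at \<open>b\<close> is a pair: the state at \<open>b\<close>, and the family of arrows into it indexed by their sources.\<close>
  define P where "P f b v \<longleftrightarrow> (b \<in> Field r \<longrightarrow>
      fst v \<in> St b \<and> snd v b = Ident C (U (fst v)) \<and>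
      (\<forall>a\<in>underS r b. H (fst (f a)) (fst v) (snd v a)) \<and>
      (\<forall>a\<in>underS r b. \<forall>c\<in>underS r a. snd v a \<cdot> snd (f a) c = snd v c) \<and>
      (is_bottom r b \<longrightarrow> fst v = e0) \<and>
      (\<forall>a. is_successor r a b \<longrightarrow> T a (\<lambda>c. fst (f c)) (\<lambda>u. snd (f (snd u)) (fst u)) (fst v) (snd v a)) \<and>
      (is_limit_element r b \<longrightarrow> is_colimit (order_cat (Restr r (underS r b))) C (\<lambda>a. U (fst (f a)))
         (\<lambda>u. snd (f (snd u)) (fst u)) (U (fst v)) (snd v)))"
    for f :: "'a \<Rightarrow> 's \<times> ('a \<Rightarrow> 'm)" and b v
  have under: "(a, b) \<in> r - Id \<longleftrightarrow> a \<in> underS r b" for a b by (auto simp: underS_def)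
  have underS_trans: "c \<in> underS r b" if "c \<in> underS r a" "a \<in> underS r b" for a b c
    using that ord(2)[of c a b] ord(3)[of a b] by (auto simp: underS_def)
  have earlier: "is_section_on C r St U H (underS r b) (\<lambda>c. fst (f c)) (\<lambda>u. snd (f (snd u)) (fst u))"
    if f: "\<And>a. a \<in> underS r b \<Longrightarrow> P f a (f a)" for f b
  proof -
    have 1: "fst (f a) \<in> St a" "snd (f a) a = Ident C (U (fst (f a)))"
      "\<And>c. c \<in> underS r a \<Longrightarrow> H (fst (f c)) (fst (f a)) (snd (f a) c)"
      "\<And>c d. c \<in> underS r a \<Longrightarrow> d \<in> underS r c \<Longrightarrow> snd (f a) c \<cdot> snd (f c) d = snd (f a) d"
      if "a \<in> underS r b" for a
      using f[OF that] that by (auto simp: P_def underS_def Field_def)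
    have 2: "H (fst (f c)) (fst (f a)) (snd (f a) c)" if "a \<in> underS r b" "(c, a) \<in> r" for a c
      using 1[OF that(1)] H_Ident that(2) by (cases "a = c") (auto simp: underS_def)
    have 3: "snd (f a) c \<cdot> snd (f c) d = snd (f a) d"
      if "a \<in> underS r b" "c \<in> underS r b" "d \<in> underS r b" "(c, a) \<in> r" "(d, c) \<in> r" for a c d
    proof -
      have m: "snd (f a) c \<in> hom C (U (fst (f c))) (U (fst (f a)))" "snd (f c) d \<in> hom C (U (fst (f d))) (U (fst (f c)))"
        using 2 H that by blast+
      show ?thesis
      proof (cases "c = a \<or> d = c")
        case True
        then show ?thesis using 1(2)[OF that(1)] 1(2)[OF that(2)] m Comp_Ident Ident_Comp by auto
      next
        case False
        then show ?thesis using 1(4)[OF that(1), of c d] that by (auto simp: underS_def)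
      qed
    qed
    show ?thesis unfolding is_section_on_def using 1(1,2) 2 3 by auto
  qed
  have "\<exists>f. \<forall>b. P f b (f b)"
  proof (rule dependent_wf_choice[OF ord(5)])
    have "P g b v" if fg: "\<And>a. a \<in> underS r b \<Longrightarrow> f a = g a" and P: "P f b v" for f g b v
      unfolding P_def
    proof (intro impI conjI)
      assume b: "b \<in> Field r"
      note P = P[unfolded P_def, rule_format, OF b]
      show "fst v \<in> St b" "snd v b = Ident C (U (fst v))" "is_bottom r b \<Longrightarrow> fst v = e0" using P by blast+
      show "\<forall>a\<in>underS r b. H (fst (g a)) (fst v) (snd v a)"
        "\<forall>a\<in>underS r b. \<forall>c\<in>underS r a. snd v a \<cdot> snd (g a) c = snd v c" using P fg by auto
      show "\<forall>a. is_successor r a b \<longrightarrow> T a (\<lambda>c. fst (g c)) (\<lambda>u. snd (g (snd u)) (fst u)) (fst v) (snd v a)"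
      proof (intro allI impI)
        fix a assume a: "is_successor r a b"
        then have "c \<in> underS r b" if "(c, a) \<in> r" for c
          using successor_below(1)[OF r a] that by (simp add: under_def)
        then have "f c = g c" if "(c, a) \<in> r" for c using fg that by blast
        moreover have "T a (\<lambda>c. fst (f c)) (\<lambda>u. snd (f (snd u)) (fst u)) (fst v) (snd v a)" using P a by blast
        ultimately show "T a (\<lambda>c. fst (g c)) (\<lambda>u. snd (g (snd u)) (fst u)) (fst v) (snd v a)"
          by (elim T_cong[rotated 2]) (simp_all add: under_def)
      qed
      assume "is_limit_element r b"
      then have "is_colimit (order_cat (Restr r (underS r b))) C (\<lambda>a. U (fst (f a)))
         (\<lambda>u. snd (f (snd u)) (fst u)) (U (fst v)) (snd v)" using P by blast
      then show "is_colimit (order_cat (Restr r (underS r b))) C (\<lambda>a. U (fst (g a)))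
         (\<lambda>u. snd (g (snd u)) (fst u)) (U (fst v)) (snd v)"
        by (subst (asm) is_colimit_cong) (auto simp: Field_Restr_underS[OF r] fg)
    qed
    then show "P f b v = P g b v" if "\<And>a. (a, b) \<in> r - Id \<Longrightarrow> f a = g a" for f g b v
      using that unfolding under by metis
  next
    fix b f assume IH: "\<And>a. (a, b) \<in> r - Id \<Longrightarrow> P f a (f a)"
    let ?F = "\<lambda>c. fst (f c)" and ?Fm = "\<lambda>u. snd (f (snd u)) (fst u)"
    have sec: "is_section_on C r St U H (underS r b) ?F ?Fm" using earlier IH unfolding under by blast
    show "\<exists>v. P f b v"
    proof (cases "b \<in> Field r")
      case True
      then consider (bottom) "is_bottom r b" | (succ) a where "is_successor r a b" | (limit) "is_limit_element r b"
        using bottom_successor_limit[OF True] by blast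
      then show ?thesis
      proof cases
        case bottom
        have below: "x \<notin> underS r b" for x
          using bottom ord(3)[of x b] FieldI1[of x b r] unfolding is_bottom_def underS_def by blast
        have "\<not> is_limit_element r b" "\<And>a. \<not> is_successor r a b"
          using bottom successor_below(3)[OF r] by (auto simp: is_limit_element_def)
        then show ?thesis
          unfolding P_def using assms(8)[OF bottom] below
          by (intro exI[of _ "(e0, \<lambda>_. Ident C (U e0))"]) (auto simp only: fst_conv snd_conv)
      next
        case (succ a)
        note below = successor_below[OF r succ]
        have sec': "is_section_on C r St U H (under r a) ?F ?Fm" using sec below(1) by simp
        obtain e m where e: "e \<in> St b" "H (?F a) e m" "T a ?F ?Fm e m" using assms(9)[OF succ sec'] by blast
        have a: "(a, a) \<in> r" using succ ord(1) by (auto simp: is_successor_def Field_def)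
        define k where "k c = (if c = b then Ident C (U e) else m \<cdot> ?Fm (c, a))" for c
        have Hc: "H (?F c) (?F a) (?Fm (c, a))" if "c \<in> underS r b" for c
          using is_section_onD(3)[OF sec that below(2)] that unfolding below(1) by (simp add: under_def)
        have "?Fm (a, a) = Ident C (U (?F a))" using is_section_onD(2)[OF sec below(2)] .
        then have ka: "k a = m" using Comp_Ident[OF H[OF e(2)]] below(2) by (auto simp: k_def underS_def)
        have "P f b (e, k)"
          unfolding P_def fst_conv snd_conv
        proof (intro impI conjI ballI allI)
          show "e \<in> St b" "k b = Ident C (U e)" using e(1) by (auto simp: k_def)
          show kH: "H (?F c) e (k c)" if "c \<in> underS r b" for c
            using H_Comp[OF Hc[OF that] e(2)] that by (auto simp: k_def underS_def)
          show "k c \<cdot> snd (f c) d = k d" if c: "c \<in> underS r b" and d: "d \<in> underS r c" for c d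
          proof -
            have cd: "(d, c) \<in> r" "(c, a) \<in> r" "d \<in> underS r b"
              using underS_trans[OF d c] d c[unfolded below(1)] by (simp_all add: underS_def under_def)
            have dc: "?Fm (d, c) \<in> hom C (U (?F d)) (U (?F c))"
              by (rule H, rule is_section_onD(3)[OF sec cd(3) c cd(1)])
            have "?Fm (c, a) \<cdot> ?Fm (d, c) = ?Fm (d, a)"
              by (rule is_section_onD(4)[OF sec cd(3) c below(2) cd(1,2)])
            then show ?thesis
              using Comp_assoc[OF dc H[OF Hc[OF c]] H[OF e(2)]] cd c by (auto simp: k_def underS_def)
          qed
          show "e = e0" if "is_bottom r b" using that below(3) by blast
          show "T a' ?F ?Fm e (k a')" if "is_successor r a' b" for a'
            using successor_unique[OF r that succ] e(3) ka by simp
          show "is_colimit (order_cat (Restr r (underS r b))) C (\<lambda>a. U (?F a)) ?Fm (U e) k" if "is_limit_element r b"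
            using that succ by (auto simp: is_limit_element_def)
        qed
        then show ?thesis by blast
      next
        case limit
        have "is_functor (order_cat (Restr r (underS r b))) C (\<lambda>a. U (?F a)) ?Fm"
          by (rule section_is_functor[OF sec]) (fact H, fact U)
        then obtain L \<iota> where L: "is_colimit (order_cat (Restr r (underS r b))) C (\<lambda>a. U (?F a)) ?Fm L \<iota>"
          using colimits[OF True] by blast
        obtain e where e: "e \<in> St b" "U e = L" "\<And>a. a \<in> underS r b \<Longrightarrow> H (?F a) e (\<iota> a)"
          using assms(10)[OF limit sec L] by blast
        define k where "k c = (if c = b then Ident C (U e) else \<iota> c)" for c
        have k: "k c = \<iota> c" if "c \<in> underS r b" for c using that by (auto simp: k_def underS_def)
        have "P f b (e, k)"
          unfolding P_def fst_conv snd_conv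
        proof (intro impI conjI ballI allI)
          show "e \<in> St b" "k b = Ident C (U e)" using e(1) by (auto simp: k_def)
          show "H (?F c) e (k c)" if "c \<in> underS r b" for c using e(3)[OF that] k[OF that] by simp
          show "k c \<cdot> snd (f c) d = k d" if c: "c \<in> underS r b" and d: "d \<in> underS r c" for c d
            using colimit_cocone(3)[OF L, of d c] k c underS_trans[OF d c] d by (auto simp: underS_def)
          show "e = e0" if "is_bottom r b" using that limit by (auto simp: is_limit_element_def)
          show "T a ?F ?Fm e (k a)" if "is_successor r a b" for a
            using that limit by (auto simp: is_limit_element_def)
          show "is_colimit (order_cat (Restr r (underS r b))) C (\<lambda>a. U (?F a)) ?Fm (U e) k"
            using L unfolding e(2) by (subst is_colimit_cong) (auto simp: Field_Restr_underS[OF r] k)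
        qed
        then show ?thesis by blast
      qed
    qed (simp add: P_def)
  qed
  then obtain f where f: "\<And>b. P f b (f b)" by blast
  let ?F = "\<lambda>c. fst (f c)" and ?Fm = "\<lambda>u. snd (f (snd u)) (fst u)"
  show thesis
  proof
    show "is_section_on C r St U H (Field r) ?F ?Fm"
    proof -
      have *: "fst (f a) \<in> St a" "snd (f a) a = Ident C (U (fst (f a)))"
        "\<And>c. c \<in> underS r a \<Longrightarrow> H (fst (f c)) (fst (f a)) (snd (f a) c)"
        "\<And>c d. c \<in> underS r a \<Longrightarrow> d \<in> underS r c \<Longrightarrow> snd (f a) c \<cdot> snd (f c) d = snd (f a) d"
        if "a \<in> Field r" for a
        using f[of a] that by (auto simp: P_def)
      have 2: "H (fst (f c)) (fst (f a)) (snd (f a) c)" if "(c, a) \<in> r" for a c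
        using *[of a] H_Ident FieldI2[OF that] that by (cases "a = c") (auto simp: underS_def)
      have "snd (f a) c \<cdot> snd (f c) d = snd (f a) d" if "(c, a) \<in> r" "(d, c) \<in> r" for a c d
      proof (cases "c = a \<or> d = c")
        case True
        then show ?thesis
          using *(2)[of a] *(2)[of c] H[OF 2] that Comp_Ident Ident_Comp FieldI1 FieldI2 by metis
      next
        case False
        then show ?thesis using *(4)[OF FieldI2, of c a c d] that by (auto simp: underS_def)
      qed
      then show ?thesis unfolding is_section_on_def using *(1,2) 2 by auto
    qed
    show "fst (f z) = e0" if "is_bottom r z" for z using f[of z] that by (auto simp: P_def is_bottom_def)
    show "T a ?F ?Fm (?F b) (?Fm (a, b))" if "is_successor r a b" for a b
      using f[of b] that FieldI2[of a b r] by (auto simp: P_def is_successor_def)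
    show "is_colimit (order_cat (Restr r (underS r b))) C (\<lambda>a. U (?F a)) ?Fm (U (?F b)) (\<lambda>a. ?Fm (a, b))"
      if "is_limit_element r b" for b
      using f[of b] that by (auto simp: P_def is_limit_element_def)
  qed
qed

end


section \<open>Lifting properties of cell complexes\<close>

context category
begin

lemma lift:
  assumes "lifts_against C i p" "i \<in> hom C A B" "p \<in> hom C X Y" "u \<in> hom C A X" "v \<in> hom C B Y"
    "p \<cdot> u = v \<cdot> i"
  obtains h where "h \<in> hom C B X" "h \<cdot> i = u" "p \<cdot> h = v"
  using assms unfolding lifts_against_def by (metis homD(2,3))

lemma lifts_againstI:
  assumes "i \<in> hom C A B" "p \<in> hom C X Y"
    "\<And>u v. u \<in> hom C A X \<Longrightarrow> v \<in> hom C B Y \<Longrightarrow> p \<cdot> u = v \<cdot> i \<Longrightarrow> \<exists>h\<in>hom C B X. h \<cdot> i = u \<and> p \<cdot> h = v"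
  shows "lifts_against C i p"
  using assms unfolding lifts_against_def by (metis homD(2,3))

lemma lifts_against_pushout:
  assumes P: "is_pushout C k g p q" and l: "lifts_against C k f" and f: "f \<in> Mor C"
  shows "lifts_against C q f"
proof (rule lifts_againstI)
  note D = pushoutD[OF P]
  show "q \<in> hom C (Cod C g) (Cod C p)" by fact
  show f': "f \<in> hom C (Dom C f) (Cod C f)" using f by (rule in_hom)
  fix u v assume u: "u \<in> hom C (Cod C g) (Dom C f)" and v: "v \<in> hom C (Cod C p) (Cod C f)"
    and uv: "f \<cdot> u = v \<cdot> q"
  have "f \<cdot> (u \<cdot> g) = v \<cdot> p \<cdot> k"
    using Comp_assoc[OF D(2) u f'] Comp_assoc[OF D(2,4) v] Comp_assoc[OF D(1,3) v] D(5) uv by simp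
  then obtain h where h: "h \<in> hom C (Cod C k) (Dom C f)" "h \<cdot> k = u \<cdot> g" "f \<cdot> h = v \<cdot> p"
    using lift[OF l D(1) f' Comp_in_hom[OF D(2) u] Comp_in_hom[OF D(3) v]] by blast
  obtain w where w: "w \<in> hom C (Cod C p) (Dom C f)" "w \<cdot> p = h" "w \<cdot> q = u"
    using pushout_induced[OF P h(1) u h(2)] by blast
  have "f \<cdot> w = v"
  proof (rule pushout_eqI[OF P Comp_in_hom[OF w(1) f'] v])
    show "f \<cdot> w \<cdot> p = v \<cdot> p" using Comp_assoc[OF D(3) w(1) f'] w h by simp
    show "f \<cdot> w \<cdot> q = v \<cdot> q" using Comp_assoc[OF D(4) w(1) f'] w uv by simp
  qed
  with w show "\<exists>h\<in>hom C (Cod C p) (Dom C f). h \<cdot> q = u \<and> f \<cdot> h = v" by blast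
qed

lemma sequenceD:
  assumes "is_sequence C r Xo Xm"
  shows "Well_order r" "is_functor (order_cat r) C Xo Xm"
    "\<And>a. a \<in> Field r \<Longrightarrow> Xo a \<in> Obj C" "\<And>a. a \<in> Field r \<Longrightarrow> Xm (a, a) = Ident C (Xo a)"
    "\<And>a b. (a, b) \<in> r \<Longrightarrow> Xm (a, b) \<in> hom C (Xo a) (Xo b)"
    "\<And>a b c. (a, b) \<in> r \<Longrightarrow> (b, c) \<in> r \<Longrightarrow> Xm (b, c) \<cdot> Xm (a, b) = Xm (a, c)"
    "\<And>b. is_limit_element r b \<Longrightarrow>
      is_colimit (order_cat (Restr r (underS r b))) C Xo Xm (Xo b) (\<lambda>a. Xm (a, b))"
proof -
  show 1: "Well_order r" "is_functor (order_cat r) C Xo Xm"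
    and "\<And>b. is_limit_element r b \<Longrightarrow>
      is_colimit (order_cat (Restr r (underS r b))) C Xo Xm (Xo b) (\<lambda>a. Xm (a, b))"
    using assms unfolding is_sequence_def by blast+
  show "\<And>a. a \<in> Field r \<Longrightarrow> Xo a \<in> Obj C" "\<And>a. a \<in> Field r \<Longrightarrow> Xm (a, a) = Ident C (Xo a)"
    "\<And>a b. (a, b) \<in> r \<Longrightarrow> Xm (a, b) \<in> hom C (Xo a) (Xo b)"
    "\<And>a b c. (a, b) \<in> r \<Longrightarrow> (b, c) \<in> r \<Longrightarrow> Xm (b, c) \<cdot> Xm (a, b) = Xm (a, c)"
    using 1(2) unfolding is_functor_order_cat by auto
qed

lemma functor_Restr:
  "is_functor (order_cat r) C Xo Xm \<Longrightarrow> is_functor (order_cat (Restr r A)) C Xo Xm"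
  unfolding is_functor_order_cat by (auto simp: Field_def)

text \<open>
  A lift against a transfinite composition is a compatible family of lifts on the values of the
  sequence; it is extended over the successors by lifting and over the limits by the universal
  property.
\<close>

lemma lifts_against_transfinite_composition:
  assumes X: "is_sequence C r Xo Xm" and L: "is_colimit (order_cat r) C Xo Xm L \<iota>" and z: "is_bottom r z"
    and l: "\<And>a b. is_successor r a b \<Longrightarrow> lifts_against C (Xm (a, b)) f" and f: "f \<in> Mor C"
  shows "lifts_against C (\<iota> z) f"
proof (rule lifts_againstI)
  note c = colimit_cocone[OF L] note X' = sequenceD[OF X]
  note r = X'(1) note ord = Well_orderD[OF r]
  have zF: "z \<in> Field r" using z by (simp add: is_bottom_def)
  show "\<iota> z \<in> hom C (Xo z) L" using c(2) zF by blast
  show f': "f \<in> hom C (Dom C f) (Cod C f)" using f by (rule in_hom)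
  fix u v assume u: "u \<in> hom C (Xo z) (Dom C f)" and v: "v \<in> hom C L (Cod C f)" and uv: "f \<cdot> u = v \<cdot> \<iota> z"
  define P where "P h b w \<longleftrightarrow> (b \<in> Field r \<longrightarrow> w \<in> hom C (Xo b) (Dom C f) \<and> f \<cdot> w = v \<cdot> \<iota> b \<and>
      (\<forall>a\<in>underS r b. w \<cdot> Xm (a, b) = h a) \<and> (is_bottom r b \<longrightarrow> w = u))" for h b w
  have "\<exists>h. \<forall>b. P h b (h b)"
  proof (rule dependent_wf_choice[OF ord(5)])
    show "P h b w = P h' b w" if "\<And>a. (a, b) \<in> r - Id \<Longrightarrow> h a = h' a" for h h' b w
      using that unfolding P_def underS_def by auto
  next
    fix b h assume IH: "\<And>a. (a, b) \<in> r - Id \<Longrightarrow> P h a (h a)"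
    have h: "h a \<in> hom C (Xo a) (Dom C f)" "f \<cdot> h a = v \<cdot> \<iota> a" if "a \<in> underS r b" for a
      using IH[of a] that by (auto simp: P_def underS_def Field_def)
    have hX: "h a \<cdot> Xm (a', a) = h a'" if "a \<in> underS r b" "(a', a) \<in> r" for a a'
    proof (cases "a' = a")
      case True
      then show ?thesis using X'(4) h(1)[OF that(1)] Comp_Ident that(2) by (simp add: FieldI2)
    next
      case False
      then show ?thesis using IH[of a] that by (auto simp: P_def underS_def Field_def)
    qed
    show "\<exists>w. P h b w"
    proof (cases "b \<in> Field r")
      case True
      then consider (bottom) "is_bottom r b" | (succ) a where "is_successor r a b" | (limit) "is_limit_element r b"
        using bottom_successor_limit[OF True] by blast
      then show ?thesis
      proof cases
        case bottom
        then have "b = z" using bottom_unique[OF r] z by blast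
        moreover have "x \<notin> underS r b" for x
          using bottom ord(3)[of x b] FieldI1[of x b r] unfolding is_bottom_def underS_def by blast
        ultimately show ?thesis unfolding P_def using u uv by blast
      next
        case (succ a)
        note below = successor_below[OF r succ]
        have ab: "(a, b) \<in> r" using below(2) by (simp add: underS_def)
        have "f \<cdot> h a = v \<cdot> \<iota> b \<cdot> Xm (a, b)"
          using h(2)[OF below(2)] Comp_assoc[OF X'(5)[OF ab] c(2)[OF True] v] c(3)[OF ab] by simp
        then obtain w where w: "w \<in> hom C (Xo b) (Dom C f)" "w \<cdot> Xm (a, b) = h a" "f \<cdot> w = v \<cdot> \<iota> b"
          using lift[OF l[OF succ] X'(5)[OF ab] f' h(1)[OF below(2)] Comp_in_hom[OF c(2)[OF True] v]] by blast
        have "w \<cdot> Xm (d, b) = h d" if "d \<in> underS r b" for d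
        proof -
          have da: "(d, a) \<in> r" using that unfolding below(1) by (simp add: under_def)
          show ?thesis
            using Comp_assoc[OF X'(5)[OF da] X'(5)[OF ab] w(1)] X'(6)[OF da ab] w(2) hX[OF below(2) da] by simp
        qed
        then show ?thesis unfolding P_def using w below(3) by blast
      next
        case limit
        note col = X'(7)[OF limit]
        obtain w where w: "w \<in> hom C (Xo b) (Dom C f)" "\<And>a. a \<in> underS r b \<Longrightarrow> w \<cdot> Xm (a, b) = h a"
        proof (rule colimit_induced[OF col, where Z = "Dom C f" and j = h, unfolded Field_Restr_underS[OF r]])
          show "Dom C f \<in> Obj C" using f Dom_in_Obj by blast
        qed (use h hX in auto)
        have "f \<cdot> w = v \<cdot> \<iota> b"
        proof (rule colimit_eqI[OF col functor_Restr[OF X'(2)] Comp_in_hom[OF w(1) f'] Comp_in_hom[OF c(2)[OF True] v]])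
          fix a assume "a \<in> Field (Restr r (underS r b))"
          then have a: "a \<in> underS r b" "(a, b) \<in> r"
            unfolding Field_Restr_underS[OF r] by (simp_all add: underS_def)
          show "f \<cdot> w \<cdot> Xm (a, b) = v \<cdot> \<iota> b \<cdot> Xm (a, b)"
            using Comp_assoc[OF X'(5)[OF a(2)] w(1) f'] w(2)[OF a(1)] h(2)[OF a(1)]
              Comp_assoc[OF X'(5)[OF a(2)] c(2)[OF True] v] c(3)[OF a(2)] by simp
        qed
        then show ?thesis unfolding P_def using w limit by (auto simp: is_limit_element_def)
      qed
    qed (simp add: P_def)
  qed
  then obtain h where h: "\<And>b. P h b (h b)" by blast
  have h1: "h b \<in> hom C (Xo b) (Dom C f)" "f \<cdot> h b = v \<cdot> \<iota> b" if "b \<in> Field r" for b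
    using h[of b] that by (auto simp: P_def)
  have hX: "h b \<cdot> Xm (a, b) = h a" if "(a, b) \<in> r" for a b
  proof (cases "a = b")
    case True
    then show ?thesis using X'(4) h1(1) Comp_Ident that by (metis FieldI2)
  next
    case False
    then show ?thesis using h[of b] that by (auto simp: P_def underS_def Field_def)
  qed
  obtain w where w: "w \<in> hom C L (Dom C f)" "\<And>a. a \<in> Field r \<Longrightarrow> w \<cdot> \<iota> a = h a"
  proof (rule colimit_induced[OF L, where Z = "Dom C f" and j = h])
    show "Dom C f \<in> Obj C" using f Dom_in_Obj by blast
  qed (use h1 hX in auto)
  have "f \<cdot> w = v"
  proof (rule colimit_eqI[OF L X'(2) Comp_in_hom[OF w(1) f'] v])
    fix a assume a: "a \<in> Field r"
    show "f \<cdot> w \<cdot> \<iota> a = v \<cdot> \<iota> a" using Comp_assoc[OF c(2)[OF a] w(1) f'] w(2)[OF a] h1(2)[OF a] by simp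
  qed
  moreover have "w \<cdot> \<iota> z = u" using w(2)[OF zF] h[of z] zF z by (simp add: P_def)
  ultimately show "\<exists>h\<in>hom C L (Dom C f). h \<cdot> \<iota> z = u \<and> f \<cdot> h = v" using w(1) by blast
qed

text \<open>
  Classes of the form \<open>LLP C R\<close>, such as the cofibrations and the trivial cofibrations of a model
  category, are closed under pushouts and transfinite compositions.
\<close>

lemma cell_maps_subset_LLP:
  assumes K: "K \<subseteq> LLP C R" and R: "R \<subseteq> Mor C"
  shows "cell_maps \<kappa> C K \<subseteq> LLP C R"
proof
  fix c assume "c \<in> cell_maps \<kappa> C K"
  then obtain r Xo Xm L \<iota> z where "small_ordinal \<kappa> r" and X: "is_sequence C r Xo Xm" "steps_in r Xm (pushouts_of C K)"
    and L: "is_colimit (order_cat r) C Xo Xm L \<iota>" and z: "is_bottom r z" and c: "c = \<iota> z"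
    unfolding cell_maps_def transfinite_compositions_def by blast
  have "lifts_against C c p" if p: "p \<in> R" for p
    unfolding c
  proof (rule lifts_against_transfinite_composition[OF X(1) L z])
    show "p \<in> Mor C" using p R by blast
    then show "lifts_against C (Xm (a, b)) p" if "is_successor r a b" for a b
      using X(2) that K p lifts_against_pushout unfolding steps_in_def pushouts_of_def LLP_def by blast
  qed
  moreover have "c \<in> Mor C" using colimit_cocone(2)[OF L] z c by (auto simp: is_bottom_def hom_def)
  ultimately show "c \<in> LLP C R" by (simp add: LLP_def)
qed

lemma colimit_at_top:
  assumes F: "is_functor (order_cat r) C Xo Xm" and t: "\<And>a. a \<in> Field r \<Longrightarrow> (a, t) \<in> r" "t \<in> Field r"
  shows "is_colimit (order_cat r) C Xo Xm (Xo t) (\<lambda>a. Xm (a, t))"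
  unfolding is_colimit_def
proof (intro conjI allI impI)
  note F' = F[unfolded is_functor_order_cat]
  show "is_cocone (order_cat r) C Xo Xm (Xo t) (\<lambda>a. Xm (a, t))"
    unfolding is_cocone_order_cat using F' t by (metis FieldI2)
  fix Z j assume j: "is_cocone (order_cat r) C Xo Xm Z j"
  show "\<exists>!h. h \<in> hom C (Xo t) Z \<and> (\<forall>i\<in>Obj (order_cat r). h \<cdot> Xm (i, t) = j i)"
  proof (rule ex1I[of _ "j t"])
    show "j t \<in> hom C (Xo t) Z \<and> (\<forall>i\<in>Obj (order_cat r). j t \<cdot> Xm (i, t) = j i)"
      using j t unfolding is_cocone_order_cat by simp
    fix h assume "h \<in> hom C (Xo t) Z \<and> (\<forall>i\<in>Obj (order_cat r). h \<cdot> Xm (i, t) = j i)"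
    then show "h = j t" using F' t(2) Comp_Ident by (metis order_cat_simps(1))
  qed
qed

end

context cocomplete_category
begin

lemma Ident_in_cell_maps:
  assumes X: "X \<in> Obj C"
  shows "Ident C X \<in> cell_maps \<kappa> C K"
proof -
  obtain z where z: "z \<in> Field \<kappa>" using infinite_Field by fastforce
  define r where "r = {(z, z)}"
  have Fr: "Field r = {z}" by (auto simp: r_def)
  have r: "Well_order r"
    unfolding order_on_defs refl_on_def trans_def antisym_def total_on_def Fr by (auto simp: r_def)
  have "is_functor (order_cat r) C (\<lambda>_. X) (\<lambda>_. Ident C X)"
    unfolding is_functor_order_cat using X Comp_Ident[OF Ident_in_hom[OF X]] Ident_in_hom by auto
  moreover from this have "is_colimit (order_cat r) C (\<lambda>_. X) (\<lambda>_. Ident C X) X (\<lambda>_. Ident C X)"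
    using colimit_at_top[of r "\<lambda>_. X" "\<lambda>_. Ident C X" z] by (auto simp: r_def Field_def)
  moreover have "is_bottom r z" by (auto simp: is_bottom_def Fr r_def)
  moreover from this have "\<not> is_limit_element r b" for b by (auto simp: is_limit_element_def Fr)
  moreover have "\<not> is_successor r a b" for a b by (auto simp: is_successor_def r_def)
  ultimately show ?thesis
    unfolding cell_maps_def transfinite_compositions_def mem_Collect_eq
    using r Fr small_finite[of "{z}"]
    by (intro exI[of _ r] exI[of _ "\<lambda>_. X"] exI[of _ "\<lambda>_. Ident C X"] exI[of _ X] exI[of _ "\<lambda>_. Ident C X"] exI[of _ z])
      (auto simp: small_ordinal_def is_sequence_def steps_in_def)
qed

text \<open>The sequences of the small object argument have pushouts as their steps, while smallness is about steps
  that are cell complexes. A pushout is the transfinite composition of a sequence of length two.\<close>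

lemma pushouts_subset_cell_maps: "pushouts_of C K \<subseteq> cell_maps \<kappa> C K"
proof
  fix q assume q: "q \<in> pushouts_of C K"
  then have qM: "q \<in> Mor C" by (auto simp: pushouts_of_def is_pushout_def)
  obtain z where z: "z \<in> Field \<kappa>" using infinite_Field by fastforce
  obtain w where w: "w \<noteq> z" using no_maximum[OF z] by metis
  define r where "r = {(z, z), (w, w), (z, w)}"
  have Fr: "Field r = {z, w}" by (auto simp: r_def)
  have r: "Well_order r"
    unfolding order_on_defs refl_on_def trans_def antisym_def total_on_def Fr using w
    by (auto simp: r_def intro!: finite_acyclic_wf acyclicI_order[of _ "\<lambda>x. if x = z then (1::nat) else 0"])
  define Xo where "Xo a = (if a = z then Dom C q else Cod C q)" for a
  define Xm where "Xm u = (if fst u = snd u then Ident C (Xo (fst u)) else q)" for u :: "'u \<times> 'u"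
  have qh: "q \<in> hom C (Xo z) (Xo w)" using qM w by (simp add: Xo_def hom_def)
  then have F: "is_functor (order_cat r) C Xo Xm"
    unfolding is_functor_order_cat Fr using w hom_Obj[OF qh]
    by (auto simp: r_def Xm_def Ident_in_hom Comp_Ident Ident_Comp Comp_Ident[OF Ident_in_hom])
  then have L: "is_colimit (order_cat r) C Xo Xm (Xo w) (\<lambda>a. Xm (a, w))"
    by (rule colimit_at_top) (auto simp: Fr r_def)
  have zb: "is_bottom r z" by (auto simp: is_bottom_def Fr r_def)
  have "is_successor r z w" using w by (auto simp: is_successor_def r_def)
  then have "\<not> is_limit_element r b" for b using zb by (auto simp: is_limit_element_def Fr)
  moreover have "steps_in r Xm (pushouts_of C K)"
    using q by (auto simp: steps_in_def is_successor_def r_def Xm_def)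
  moreover have "Xm (z, w) = q" using w by (simp add: Xm_def)
  ultimately show "q \<in> cell_maps \<kappa> C K"
    unfolding cell_maps_def transfinite_compositions_def mem_Collect_eq
    using r Fr small_finite[of "{z, w}"] F L zb
    by (intro exI[of _ r] exI[of _ Xo] exI[of _ Xm] exI[of _ "Xo w"] exI[of _ "\<lambda>a. Xm (a, w)"] exI[of _ z])
      (auto simp: small_ordinal_def is_sequence_def)
qed

end

section \<open>Smallness\<close>

context category
begin

text \<open>Smallness in elementary terms: maps into the colimit, and equations between them, descend.\<close>

definition detects :: "'o \<Rightarrow> 'a rel \<Rightarrow> ('a \<Rightarrow> 'o) \<Rightarrow> ('a \<times> 'a \<Rightarrow> 'm) \<Rightarrow> 'o \<Rightarrow> ('a \<Rightarrow> 'm) \<Rightarrow> bool" where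
  "detects A r Xo Xm L \<iota> \<longleftrightarrow>
     (\<forall>u\<in>hom C A L. \<exists>a\<in>Field r. \<exists>g\<in>hom C A (Xo a). \<iota> a \<cdot> g = u) \<and>
     (\<forall>a\<in>Field r. \<forall>b\<in>Field r. \<forall>g\<in>hom C A (Xo a). \<forall>h\<in>hom C A (Xo b). \<iota> a \<cdot> g = \<iota> b \<cdot> h \<longrightarrow>
        (\<exists>c. (a, c) \<in> r \<and> (b, c) \<in> r \<and> Xm (a, c) \<cdot> g = Xm (b, c) \<cdot> h))"

text \<open>
  The canonical map out of the colimit of hom-sets is induced by \<open>(a, g) \<mapsto> \<iota> a \<cdot> g\<close>. It is surjective iff
  maps descend, and injective iff two maps with the same image are identified at a later stage,
  which is the equivalence relation that defines the colimit.
\<close>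

lemma hom_colim_bij_iff:
  assumes X: "is_sequence C r Xo Xm" and L: "is_colimit (order_cat r) C Xo Xm L \<iota>"
  shows "bij_betw (hom_colim_map C \<iota>) (hom_colim C A r Xo Xm) (hom C A L) \<longleftrightarrow> detects A r Xo Xm L \<iota>"
proof -
  note c = colimit_cocone[OF L] note X' = sequenceD[OF X]
  note ord = Well_orderD[OF X'(1)]
  define S where "S = (SIGMA a : Field r. hom C A (Xo a))"
  define R where "R = hom_colim_rel C A r Xo Xm"
  define \<phi> where "\<phi> x = \<iota> (fst x) \<cdot> snd x" for x :: "'a \<times> 'm"
  have R: "((a, g), (b, h)) \<in> R \<longleftrightarrow> (a, g) \<in> S \<and> (b, h) \<in> S \<and>
      (\<exists>c. (a, c) \<in> r \<and> (b, c) \<in> r \<and> Xm (a, c) \<cdot> g = Xm (b, c) \<cdot> h)" for a g b h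
    by (auto simp: R_def S_def hom_colim_rel_def)
  have push: "Xm (a, d) \<cdot> g = Xm (c, d) \<cdot> (Xm (a, c) \<cdot> g)"
    if "(a, c) \<in> r" "(c, d) \<in> r" "g \<in> hom C A (Xo a)" for a c d g
    using Comp_assoc[OF that(3) X'(5)[OF that(1)] X'(5)[OF that(2)]] X'(6)[OF that(1,2)] by simp
  have equiv: "equiv S R"
  proof (rule equivI)
    show "R \<subseteq> S \<times> S" using R by auto
    show "refl_on S R" using ord(1) R by (auto simp: refl_on_def S_def)
    show "sym R"
    proof (rule symI, clarify)
      fix a g b h assume 1: "((a, g), (b, h)) \<in> R"
      then obtain x where "(a, x) \<in> r" "(b, x) \<in> r" "Xm (a, x) \<cdot> g = Xm (b, x) \<cdot> h" unfolding R by blast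
      moreover from this(3) have "Xm (b, x) \<cdot> h = Xm (a, x) \<cdot> g" by (rule sym)
      ultimately show "((b, h), (a, g)) \<in> R" using 1 unfolding R by blast
    qed
    show "trans R"
    proof (rule transI, clarify)
      fix a g b h d k assume 1: "((a, g), (b, h)) \<in> R" "((b, h), (d, k)) \<in> R"
      then have m: "g \<in> hom C A (Xo a)" "h \<in> hom C A (Xo b)" "k \<in> hom C A (Xo d)" by (auto simp: R S_def)
      obtain x y where x: "(a, x) \<in> r" "(b, x) \<in> r" "Xm (a, x) \<cdot> g = Xm (b, x) \<cdot> h"
        and y: "(b, y) \<in> r" "(d, y) \<in> r" "Xm (b, y) \<cdot> h = Xm (d, y) \<cdot> k" using 1 unfolding R by blast
      have "(x, y) \<in> r \<or> (y, x) \<in> r" using ord(4) x y by (metis FieldI2)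
      then show "((a, g), (d, k)) \<in> R"
      proof
        assume xy: "(x, y) \<in> r"
        then have "(a, y) \<in> r" "Xm (a, y) \<cdot> g = Xm (d, y) \<cdot> k"
          using push[OF x(1) xy m(1)] push[OF x(2) xy m(2)] x y ord(2) by metis+
        then show ?thesis using 1 y unfolding R by blast
      next
        assume yx: "(y, x) \<in> r"
        then have "(d, x) \<in> r" "Xm (a, x) \<cdot> g = Xm (d, x) \<cdot> k"
          using push[OF y(1) yx m(2)] push[OF y(2) yx m(3)] x y ord(2) by metis+
        then show ?thesis using 1 x unfolding R by blast
      qed
    qed
  qed
  have \<phi>_resp: "\<phi> x = \<phi> y" if "(x, y) \<in> R" for x y
  proof -
    obtain a g b h where xy: "x = (a, g)" "y = (b, h)" by fastforce
    with that obtain d where d: "(a, d) \<in> r" "(b, d) \<in> r" "Xm (a, d) \<cdot> g = Xm (b, d) \<cdot> h"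
      and m: "g \<in> hom C A (Xo a)" "h \<in> hom C A (Xo b)" by (auto simp: R S_def)
    have "\<iota> a \<cdot> g = \<iota> d \<cdot> (Xm (a, d) \<cdot> g)" "\<iota> b \<cdot> h = \<iota> d \<cdot> (Xm (b, d) \<cdot> h)"
      using Comp_assoc[OF m(1) X'(5)[OF d(1)] c(2)] Comp_assoc[OF m(2) X'(5)[OF d(2)] c(2)] c(3) d
      by (metis FieldI2)+
    then show ?thesis using d(3) by (simp add: \<phi>_def xy)
  qed
  have map: "hom_colim_map C \<iota> (R `` {x}) = \<phi> x" if "x \<in> S" for x
  proof -
    have "x \<in> R `` {x}" using equiv that by (rule equiv_class_self)
    then have "(\<lambda>_. \<phi> x) ` (R `` {x}) = {\<phi> x}" by blast
    moreover have "(\<lambda>(a, g). \<iota> a \<cdot> g) ` (R `` {x}) = (\<lambda>_. \<phi> x) ` (R `` {x})"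
      using \<phi>_resp by (intro image_cong) (simp_all add: \<phi>_def case_prod_beta)
    ultimately have "(\<lambda>(a, g). \<iota> a \<cdot> g) ` (R `` {x}) = {\<phi> x}" by simp
    then show ?thesis by (simp add: hom_colim_map_def)
  qed
  have img: "hom_colim_map C \<iota> ` (S // R) = \<phi> ` S"
  proof -
    have "S // R = (\<lambda>x. R `` {x}) ` S" by (auto simp: quotient_def)
    then show ?thesis using map by (simp add: image_image)
  qed
  have sub: "\<phi> ` S \<subseteq> hom C A L"
    using c(2) Comp_in_hom by (auto simp: \<phi>_def S_def)
  have 1: "inj_on (hom_colim_map C \<iota>) (S // R) \<longleftrightarrow> (\<forall>x\<in>S. \<forall>y\<in>S. \<phi> x = \<phi> y \<longrightarrow> (x, y) \<in> R)"
  proof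
    assume i: "inj_on (hom_colim_map C \<iota>) (S // R)"
    show "\<forall>x\<in>S. \<forall>y\<in>S. \<phi> x = \<phi> y \<longrightarrow> (x, y) \<in> R"
    proof (intro ballI impI)
      fix x y assume x: "x \<in> S" and y: "y \<in> S" and xy: "\<phi> x = \<phi> y"
      then have "R `` {x} = R `` {y}" using inj_onD[OF i] map x y by (metis quotientI)
      then show "(x, y) \<in> R" using equiv eq_equiv_class_iff x y by metis
    qed
  next
    assume *: "\<forall>x\<in>S. \<forall>y\<in>S. \<phi> x = \<phi> y \<longrightarrow> (x, y) \<in> R"
    show "inj_on (hom_colim_map C \<iota>) (S // R)"
    proof (rule inj_onI)
      fix P Q assume "P \<in> S // R" "Q \<in> S // R" and eq: "hom_colim_map C \<iota> P = hom_colim_map C \<iota> Q"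
      then obtain x y where "x \<in> S" "P = R `` {x}" "y \<in> S" "Q = R `` {y}" by (metis quotientE)
      then show "P = Q" using eq map * equiv equiv_class_eq by metis
    qed
  qed
  have 2: "(\<forall>x\<in>S. \<forall>y\<in>S. \<phi> x = \<phi> y \<longrightarrow> (x, y) \<in> R) \<longleftrightarrow>
     (\<forall>a\<in>Field r. \<forall>b\<in>Field r. \<forall>g\<in>hom C A (Xo a). \<forall>h\<in>hom C A (Xo b). \<iota> a \<cdot> g = \<iota> b \<cdot> h \<longrightarrow>
        (\<exists>c. (a, c) \<in> r \<and> (b, c) \<in> r \<and> Xm (a, c) \<cdot> g = Xm (b, c) \<cdot> h))"
    unfolding S_def split_paired_Ball_Sigma R \<phi>_def by (simp add: S_def) blast
  have 3: "\<phi> ` S = hom C A L \<longleftrightarrow> (\<forall>u\<in>hom C A L. \<exists>a\<in>Field r. \<exists>g\<in>hom C A (Xo a). \<iota> a \<cdot> g = u)"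
  proof -
    have "\<phi> ` S = hom C A L \<longleftrightarrow> (\<forall>u\<in>hom C A L. u \<in> \<phi> ` S)" using sub by (auto del: imageE)
    also have "\<dots> \<longleftrightarrow> (\<forall>u\<in>hom C A L. \<exists>x\<in>S. \<phi> x = u)"
      unfolding image_iff by (intro ball_cong bex_cong refl eq_commute)
    finally have "\<phi> ` S = hom C A L \<longleftrightarrow> (\<forall>u\<in>hom C A L. \<exists>x\<in>S. \<phi> x = u)" .
    then show ?thesis unfolding S_def split_paired_Bex_Sigma by (simp add: \<phi>_def)
  qed
  have "hom_colim C A r Xo Xm = S // R" by (simp add: hom_colim_def S_def R_def)
  then show ?thesis unfolding bij_betw_def detects_def by (simp only: img 1 2 3 conj_commute)
qed

end


section \<open>The small object argument\<close>

lemma Restr_underS: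
  assumes r: "Well_order r" and s: "s = Restr r (underS r d)"
  shows "Well_order s" "Field s = underS r d"
    "\<And>a b. is_successor s a b \<longleftrightarrow> is_successor r a b \<and> b \<in> underS r d"
    "\<And>b. is_limit_element s b \<Longrightarrow> is_limit_element r b"
    "\<And>b. b \<in> underS r d \<Longrightarrow> Restr s (underS s b) = Restr r (underS r b)"
    "\<And>z. is_bottom r z \<Longrightarrow> underS r d \<noteq> {} \<Longrightarrow> is_bottom s z"
proof -
  note ord = Well_orderD[OF r]
  show "Well_order s" unfolding s by (rule Well_order_Restr[OF r])
  show F: "Field s = underS r d" unfolding s by (rule Field_Restr_underS[OF r])
  have down: "a \<in> underS r d" if "(a, b) \<in> r" "b \<in> underS r d" for a b
    using that ord(2)[of a b d] ord(3)[of a b] by (auto simp: underS_def)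
  have s_iff: "(a, b) \<in> s \<longleftrightarrow> (a, b) \<in> r \<and> b \<in> underS r d" for a b using down s by blast
  have beyond: "(b, c) \<in> r" if "b \<in> underS r d" "c \<in> Field r" "c \<notin> underS r d" for b c
    using that ord(1,2) ord(4)[of d c] by (auto simp: underS_def Field_def)
  show succ: "is_successor s a b \<longleftrightarrow> is_successor r a b \<and> b \<in> underS r d" for a b
    unfolding is_successor_def s_iff using beyond by (metis FieldI2)
  have bot: "is_bottom s z" if "is_bottom r z" "z \<in> underS r d" for z
    using that unfolding is_bottom_def F s_iff by (auto simp: underS_def Field_def)
  show "is_limit_element r b" if "is_limit_element s b" for b
  proof -
    have b: "b \<in> underS r d" using that by (simp add: is_limit_element_def F)
    then have "b \<in> Field r" by (auto simp: underS_def Field_def)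
    then show ?thesis using that bot[OF _ b] succ b unfolding is_limit_element_def by blast
  qed
  show "Restr s (underS s b) = Restr r (underS r b)" if "b \<in> underS r d" for b
  proof -
    have "underS s b = underS r b" unfolding underS_def[of s] underS_def[of r b] s_iff using that by auto
    moreover have "underS r b \<subseteq> underS r d" using down[OF _ that] by (auto simp: underS_def[of r b])
    ultimately show ?thesis unfolding s by auto
  qed
  show "is_bottom s z" if z: "is_bottom r z" and ne: "underS r d \<noteq> {}" for z
  proof (rule bot[OF z])
    obtain x where x: "x \<in> underS r d" using ne by blast
    then have "(z, x) \<in> r" using z by (auto simp: is_bottom_def underS_def Field_def)
    then show "z \<in> underS r d" using x by (rule down)
  qed
qed

context cocomplete_category
begin

text \<open>The squares from \<open>K\<close> to \<open>p\<close> are the cells that can be attached to the domain of \<open>p\<close> over its codomain.\<close>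

definition squares :: "'m set \<Rightarrow> 'm \<Rightarrow> ('m \<times> 'm \<times> 'm) set" where
  "squares K p = {(k, u, v). k \<in> K \<and> u \<in> hom C (Dom C k) (Dom C p) \<and> v \<in> hom C (Cod C k) (Cod C p) \<and>
     p \<cdot> u = v \<cdot> k}"

text \<open>Maps of a slice category of \<open>C\<close>, whose objects are encoded by their structure maps.\<close>

definition over :: "'m \<Rightarrow> 'm \<Rightarrow> 'm \<Rightarrow> bool" where
  "over p q m \<longleftrightarrow> p \<in> Mor C \<and> q \<in> Mor C \<and> Cod C p = Cod C q \<and> m \<in> hom C (Dom C p) (Dom C q) \<and> q \<cdot> m = p"

lemma small_squares:
  assumes "K \<subseteq> Mor C" "small \<kappa> K" "p \<in> Mor C"
  shows "small \<kappa> (squares K p)"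
proof (rule small_subset)
  show "small \<kappa> (SIGMA k:K. hom C (Dom C k) (Dom C p) \<times> hom C (Cod C k) (Cod C p))"
    using assms by (intro small_Sigma hom_small) (auto intro: Dom_in_Obj Cod_in_Obj)
  show "squares K p \<subseteq> (SIGMA k:K. hom C (Dom C k) (Dom C p) \<times> hom C (Cod C k) (Cod C p))"
    by (auto simp: squares_def)
qed

text \<open>Squares move forward along the construction, so the later values carry squares if the first one does.\<close>

lemma squares_over:
  assumes K: "K \<subseteq> Mor C" and m: "over p q m" and s: "(k, u, v) \<in> squares K p"
  shows "(k, m \<cdot> u, v) \<in> squares K q"
proof -
  have 1: "u \<in> hom C (Dom C k) (Dom C p)" "m \<in> hom C (Dom C p) (Dom C q)" "q \<in> hom C (Dom C q) (Cod C q)"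
    using m s by (auto simp: over_def squares_def in_hom)
  show ?thesis
    using s m Comp_assoc[OF 1] Comp_in_hom[OF 1(1,2)] by (auto simp: over_def squares_def)
qed

lemma squares_empty_inj:
  assumes "p \<in> Mor C" "squares K p = {}"
  shows "p \<in> inj_maps C K"
  using assms unfolding inj_maps_def RLP_def lifts_against_def squares_def by blast

lemma attach_cell:
  assumes K: "K \<subseteq> Mor C" and p: "p \<in> Mor C" and s: "(k, u, v) \<in> squares K p"
  obtains q m h where "over p q m" "m \<in> pushouts_of C K" "h \<in> hom C (Cod C k) (Dom C q)"
    "h \<cdot> k = m \<cdot> u" "q \<cdot> h = v"
proof -
  have k: "k \<in> K" "k \<in> hom C (Dom C k) (Cod C k)" and u: "u \<in> hom C (Dom C k) (Dom C p)"
    and v: "v \<in> hom C (Cod C k) (Cod C p)" and comm: "p \<cdot> u = v \<cdot> k"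
    using s K by (auto simp: squares_def in_hom)
  obtain h m where P: "is_pushout C k u h m" using pushout_exists[OF k(2) u] by blast
  note D = pushoutD[OF P]
  have Cu: "Cod C u = Dom C p" using u by (auto simp: hom_def)
  obtain q where q: "q \<in> hom C (Cod C h) (Cod C p)" "q \<cdot> h = v" "q \<cdot> m = p"
    using pushout_induced[OF P v, of p] comm in_hom[OF p] Cu by metis
  show thesis
  proof
    show "over p q m" using p q D Cu by (auto simp: over_def hom_def)
    show "m \<in> pushouts_of C K" using P k by (auto simp: pushouts_of_def)
    show "h \<in> hom C (Cod C k) (Dom C q)" using D q by (auto simp: hom_def)
    show "h \<cdot> k = m \<cdot> u" "q \<cdot> h = v" using D q by auto
  qed
qed

lemma over_Ident: "p \<in> Mor C \<Longrightarrow> over p p (Ident C (Dom C p))"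
  unfolding over_def using Comp_Ident[OF in_hom] Ident_in_hom Dom_in_Obj by blast

lemma over_Comp:
  assumes "over p q m" "over q s n"
  shows "over p s (n \<cdot> m)"
  using assms Comp_in_hom[of m "Dom C p" "Dom C q" n "Dom C s"]
    Comp_assoc[of m "Dom C p" "Dom C q" n "Dom C s" s "Cod C s"] in_hom[of s C]
  unfolding over_def by simp

text \<open>
  Cells are attached one at a time along the well-order \<open>\<kappa>\<close>, and bookkeeping ensures that each
  square on a value of the sequence is filled at some later stage. Since \<open>\<kappa>\<close> is inaccessible, there is
  a stage \<open>\<delta>\<close> of large cofinality before which all squares on the earlier values have been filled.
  As the domains of the generators are small, each square on the colimit up to \<open>\<delta>\<close> comes from
  an earlier value, so it has a filler.
\<close>

lemma small_object_argument:
  assumes K: "K \<subseteq> Mor C" "small \<kappa> K"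
    and dom: "\<And>k. k \<in> K \<Longrightarrow> small_relative \<kappa> C (cell_maps \<kappa> C K) (Dom C k)"
    and f: "f \<in> hom C X Y"
  obtains Z c p where "c \<in> cell_maps \<kappa> C K" "c \<in> hom C X Z" "p \<in> inj_maps C K" "p \<in> hom C Z Y" "p \<cdot> c = f"
  \<comment> \<open>Each step attaches a cell, so there must be a square to start with; otherwise \<open>f\<close> is in \<open>K\<close>-inj already.\<close>
proof (cases "squares K f = {}")
  case True
  have "X \<in> Obj C" using f hom_Obj by blast
  then show thesis
    using that[OF Ident_in_cell_maps Ident_in_hom squares_empty_inj[OF _ True] f] Comp_Ident[OF f] f
    by (auto simp: hom_def)
next
  case False
  note factored = that
  note wo = well_order and ord = Well_orderD[OF well_order]
  define St where "St a = {p \<in> Mor C. Cod C p = Y \<and> squares K p \<noteq> {}}" for a :: 'u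
  have "\<forall>p\<in>Mor C. \<exists>c. inj_on c (squares K p) \<and> c ` squares K p \<subseteq> Field \<kappa>"
    using small_embeds small_squares[OF K] by blast
  then obtain code where code: "inj_on (code p) (squares K p)" "code p ` squares K p \<subseteq> Field \<kappa>"
    if "p \<in> Mor C" for p by metis
  obtain e :: "'u \<Rightarrow> 'u \<times> 'u" where e: "\<exists>c. (a, c) \<in> \<kappa> \<and> e c = (x, y)"
    if "x \<in> Field \<kappa>" "y \<in> Field \<kappa>" "a \<in> Field \<kappa>" for x y a using ex_bookkeeping by blast
  \<comment> \<open>The task at stage \<open>a\<close> is the square with number \<open>snd (e a)\<close> on the value at \<open>c = fst (e a)\<close>. It is
    treated if \<open>c\<close> is not later than \<open>a\<close>; if there is no such square, any cell is attached.\<close>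
  define T where "T a F Fm q m \<longleftrightarrow> m \<in> pushouts_of C K \<and>
      (let c = fst (e a) in \<forall>k u v. (c, a) \<in> \<kappa> \<longrightarrow> (k, u, v) \<in> squares K (F c) \<longrightarrow> code (F c) (k, u, v) = snd (e a) \<longrightarrow>
        (\<exists>h\<in>hom C (Cod C k) (Dom C q). h \<cdot> k = m \<cdot> (Fm (c, a) \<cdot> u) \<and> q \<cdot> h = v))"
    for a and F :: "'u \<Rightarrow> 'm" and Fm q m
  have T_push: "m \<in> pushouts_of C K" if "T a F Fm q m" for a F Fm q m using that by (simp add: T_def)
  have T_fill: "\<exists>h\<in>hom C (Cod C k) (Dom C q). h \<cdot> k = m \<cdot> (Fm (c, a) \<cdot> u) \<and> q \<cdot> h = v"
    if "T a F Fm q m" "(c, a) \<in> \<kappa>" "(k, u, v) \<in> squares K (F c)" "e a = (c, code (F c) (k, u, v))"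
    for a c F Fm q m k u v
    using that unfolding T_def Let_def by (metis fst_conv snd_conv)
  obtain F Fm where sec: "is_section_on C \<kappa> St (Dom C) over (Field \<kappa>) F Fm"
    and F0: "\<And>z. is_bottom \<kappa> z \<Longrightarrow> F z = f"
    and succ: "\<And>a b. is_successor \<kappa> a b \<Longrightarrow> T a F Fm (F b) (Fm (a, b))"
    and limit: "\<And>b. is_limit_element \<kappa> b \<Longrightarrow>
      is_colimit (order_cat (Restr \<kappa> (underS \<kappa> b))) C (\<lambda>a. Dom C (F a)) Fm (Dom C (F b)) (\<lambda>a. Fm (a, b))"
  proof (rule transfinite_section[OF wo, where St = St and U = "Dom C" and H = over and T = T and ?e0.0 = f])
    show "\<And>a p. p \<in> St a \<Longrightarrow> Dom C p \<in> Obj C" by (simp add: St_def Dom_in_Obj)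
    show "\<And>p q m. over p q m \<Longrightarrow> m \<in> hom C (Dom C p) (Dom C q)" by (simp add: over_def)
    show "\<And>a p. p \<in> St a \<Longrightarrow> over p p (Ident C (Dom C p))" by (simp add: St_def over_Ident)
    show "\<And>p q s m n. over p q m \<Longrightarrow> over q s n \<Longrightarrow> over p s (n \<cdot> m)" by (rule over_Comp)
    show "\<And>z. is_bottom \<kappa> z \<Longrightarrow> f \<in> St z" using f False by (auto simp: St_def hom_def)
    show "T a F' Fm' q m" if "\<And>c. c \<in> under \<kappa> a \<Longrightarrow> F c = F' c"
      "\<And>c d. (c, d) \<in> \<kappa> \<Longrightarrow> (d, a) \<in> \<kappa> \<Longrightarrow> Fm (c, d) = Fm' (c, d)" "T a F Fm q m" for a F F' Fm Fm' q m
    proof -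
      have "F c = F' c \<and> Fm (c, a) = Fm' (c, a)" if "(c, a) \<in> \<kappa>" for c
        using \<open>\<And>c. c \<in> under \<kappa> a \<Longrightarrow> F c = F' c\<close>[of c]
          \<open>\<And>c d. (c, d) \<in> \<kappa> \<Longrightarrow> (d, a) \<in> \<kappa> \<Longrightarrow> Fm (c, d) = Fm' (c, d)\<close>[of c a] that ord(1)[of a]
        by (auto simp: under_def Field_def)
      then show ?thesis using \<open>T a F Fm q m\<close> unfolding T_def Let_def by auto
    qed
    show "\<exists>L \<iota>. is_colimit (order_cat (Restr \<kappa> (underS \<kappa> b))) C Xo Xm L \<iota>"
      if "b \<in> Field \<kappa>" "is_functor (order_cat (Restr \<kappa> (underS \<kappa> b))) C Xo Xm" for b Xo Xm
    proof (rule order_colimit_exists[OF _ _ _ that(2)])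
      note w = Well_orderD[OF Well_order_Restr[OF wo, of "underS \<kappa> b"]]
      show "small \<kappa> (Field (Restr \<kappa> (underS \<kappa> b)))"
        unfolding Field_Restr_underS[OF wo] by (rule small_underS[OF that(1)])
      show "(a, a) \<in> Restr \<kappa> (underS \<kappa> b)" if "a \<in> Field (Restr \<kappa> (underS \<kappa> b))" for a by (rule w(1)[OF that])
      show "(a, d) \<in> Restr \<kappa> (underS \<kappa> b)" if "(a, c) \<in> Restr \<kappa> (underS \<kappa> b)" "(c, d) \<in> Restr \<kappa> (underS \<kappa> b)" for a c d
        by (rule w(2)[OF that])
    qed
    show "\<exists>q\<in>St b. \<exists>m. over (F a) q m \<and> T a F Fm q m"
      if ab: "is_successor \<kappa> a b" and sec: "is_section_on C \<kappa> St (Dom C) over (under \<kappa> a) F Fm" for a b F Fm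
    proof -
      have aa: "(a, a) \<in> \<kappa>" "a \<in> under \<kappa> a" using ab ord(1) by (auto simp: is_successor_def under_def Field_def)
      have Fa: "F a \<in> Mor C" "Cod C (F a) = Y" "squares K (F a) \<noteq> {}"
        using is_section_onD(1)[OF sec aa(2)] by (auto simp: St_def)
      define c where "c = fst (e a)"
      \<comment> \<open>\<open>s\<close> is the square on the current value that is induced by the task \<open>t\<close>.\<close>
      define task where "task s t \<longleftrightarrow> (c, a) \<in> \<kappa> \<and> t \<in> squares K (F c) \<and> code (F c) t = snd (e a) \<and>
        s = (fst t, Fm (c, a) \<cdot> fst (snd t), snd (snd t))" for s t
      have "\<exists>s. s \<in> squares K (F a) \<and> (\<forall>t s'. task s' t \<longrightarrow> s = s')"
      proof (cases "\<exists>s t. task s t")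
        case True
        then obtain s t where st: "task s t" by blast
        then have ca: "(c, a) \<in> \<kappa>" by (simp add: task_def)
        have c: "c \<in> under \<kappa> a" using ca by (simp add: under_def)
        have "F c \<in> Mor C" using is_section_onD(1)[OF sec c] by (simp add: St_def)
        then have "s = s'" if "task s' t'" for s' t'
          using st that code(1)[of "F c"] unfolding task_def by (metis inj_onD)
        moreover have "s \<in> squares K (F a)"
          using st squares_over[OF K(1) is_section_onD(3)[OF sec c aa(2) ca]] unfolding task_def by (cases t) auto
        ultimately show ?thesis by blast
      next
        case False
        then show ?thesis using Fa(3) by blast
      qed
      then obtain k u v where s: "(k, u, v) \<in> squares K (F a)" "\<And>s t. task s t \<Longrightarrow> (k, u, v) = s" by (metis prod_cases3)
      obtain q m h where q: "over (F a) q m" "m \<in> pushouts_of C K" "h \<in> hom C (Cod C k) (Dom C q)"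
        "h \<cdot> k = m \<cdot> u" "q \<cdot> h = v" using attach_cell[OF K(1) Fa(1) s(1)] by blast
      have "T a F Fm q m"
        unfolding T_def Let_def c_def[symmetric]
      proof (intro conjI allI impI)
        fix k' u' v' assume "(c, a) \<in> \<kappa>" "(k', u', v') \<in> squares K (F c)" "code (F c) (k', u', v') = snd (e a)"
        then have "task (k', Fm (c, a) \<cdot> u', v') (k', u', v')" by (simp add: task_def)
        then have "(k, u, v) = (k', Fm (c, a) \<cdot> u', v')" by (rule s(2))
        then show "\<exists>h\<in>hom C (Cod C k') (Dom C q). h \<cdot> k' = m \<cdot> (Fm (c, a) \<cdot> u') \<and> q \<cdot> h = v'" using q by blast
      qed (rule q(2))
      moreover have "q \<in> St b"
        using q(1) Fa squares_over[OF K(1) q(1) s(1)] by (auto simp: St_def over_def)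
      ultimately show ?thesis using q(1) by blast
    qed
    show "\<exists>q\<in>St b. Dom C q = L \<and> (\<forall>a\<in>underS \<kappa> b. over (F a) q (\<iota> a))"
      if b: "is_limit_element \<kappa> b" and sec: "is_section_on C \<kappa> St (Dom C) over (underS \<kappa> b) F Fm"
        and L: "is_colimit (order_cat (Restr \<kappa> (underS \<kappa> b))) C (\<lambda>a. Dom C (F a)) Fm L \<iota>" for b F Fm L \<iota>
    proof -
      note c = colimit_cocone[OF L, unfolded Field_Restr_underS[OF wo]]
      have F: "F a \<in> Mor C" "Cod C (F a) = Y" "squares K (F a) \<noteq> {}" if "a \<in> underS \<kappa> b" for a
        using is_section_onD(1)[OF sec that] by (auto simp: St_def)
      obtain q where q: "q \<in> hom C L Y" "\<And>a. a \<in> underS \<kappa> b \<Longrightarrow> q \<cdot> \<iota> a = F a"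
      proof (rule colimit_induced[OF L, where Z = Y and j = F, unfolded Field_Restr_underS[OF wo]])
        show "Y \<in> Obj C" using f hom_Obj by blast
        show "F a \<in> hom C (Dom C (F a)) Y" if "a \<in> underS \<kappa> b" for a using F[OF that] by (auto simp: hom_def)
        show "F d \<cdot> Fm (a, d) = F a" if "(a, d) \<in> Restr \<kappa> (underS \<kappa> b)" for a d
          using is_section_onD(3)[OF sec, of a d] that by (auto simp: over_def)
      qed blast
      have over: "over (F a) q (\<iota> a)" if "a \<in> underS \<kappa> b" for a
        using q c(2)[OF that] F[OF that] that by (auto simp: over_def hom_def)
      obtain a where "a \<in> Field \<kappa>" "b \<in> Field \<kappa>" "(b, a) \<notin> \<kappa>"
        using b unfolding is_limit_element_def is_bottom_def by blast
      then have a: "a \<in> underS \<kappa> b" using ord(1)[of b] ord(4)[of a b] by (auto simp: underS_def)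
      have "squares K q \<noteq> {}" using F(3)[OF a] squares_over[OF K(1) over[OF a]] by fast
      then have "q \<in> St b" using q(1) by (auto simp: St_def hom_def)
      then show ?thesis using q(1) over by (auto simp: hom_def)
    qed
  qed blast
  have F: "F a \<in> Mor C" "F a \<in> hom C (Dom C (F a)) Y" if "a \<in> Field \<kappa>" for a
    using is_section_onD(1)[OF sec that] by (auto simp: St_def hom_def)
  have Fm: "Fm (a, b) \<in> hom C (Dom C (F a)) (Dom C (F b))" "F b \<cdot> Fm (a, b) = F a" if "(a, b) \<in> \<kappa>" for a b
    using is_section_onD(3)[OF sec FieldI1[OF that] FieldI2[OF that] that] by (auto simp: over_def)
  define t where "t \<alpha> \<xi> = (SOME c. (\<alpha>, c) \<in> \<kappa> \<and> e c = (\<alpha>, \<xi>))" for \<alpha> \<xi>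
  have t: "(\<alpha>, t \<alpha> \<xi>) \<in> \<kappa>" "e (t \<alpha> \<xi>) = (\<alpha>, \<xi>)" if "\<alpha> \<in> Field \<kappa>" "\<xi> \<in> Field \<kappa>" for \<alpha> \<xi>
    using someI_ex[OF e[OF that that(1)]] unfolding t_def by blast+
  have "\<exists>b\<in>Field \<kappa>. \<forall>s\<in>squares K (F a). t a (code (F a) s) \<in> underS \<kappa> b" if "a \<in> Field \<kappa>" for a
  proof -
    let ?A = "(\<lambda>s. t a (code (F a) s)) ` squares K (F a)"
    have "code (F a) s \<in> Field \<kappa>" if "s \<in> squares K (F a)" for s
      using code(2)[OF F(1)[OF \<open>a \<in> Field \<kappa>\<close>]] that by blast
    then have "?A \<subseteq> Field \<kappa>" using FieldI2[OF t(1)[OF that]] by blast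
    moreover have "small \<kappa> ?A" using small_image small_squares[OF K F(1)[OF that]] by blast
    ultimately show ?thesis using small_bounded[of ?A] by simp
  qed
  then have "\<exists>H. \<forall>a\<in>Field \<kappa>. H a \<in> Field \<kappa> \<and> (\<forall>s\<in>squares K (F a). t a (code (F a) s) \<in> underS \<kappa> (H a))"
    by (intro bchoice) blast
  then obtain H where "\<forall>a\<in>Field \<kappa>. H a \<in> Field \<kappa> \<and> (\<forall>s\<in>squares K (F a). t a (code (F a) s) \<in> underS \<kappa> (H a))" ..
  then have H: "H a \<in> Field \<kappa>" "\<And>s. s \<in> squares K (F a) \<Longrightarrow> t a (code (F a) s) \<in> underS \<kappa> (H a)"
    if "a \<in> Field \<kappa>" for a using that by blast+
  obtain \<mu> :: "'m \<Rightarrow> 'u rel" where \<mu>: "Card_order (\<mu> k)" "\<mu> k <o \<kappa>"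
    "cardinal_small_relative \<kappa> C (\<mu> k) (cell_maps \<kappa> C K) (Dom C k)" if "k \<in> K" for k
    using dom unfolding small_relative_def by metis
  \<comment> \<open>The cardinality of \<open>A\<close> is a common bound for the smallness of the domains, made infinite by \<open>nat\<close>.\<close>
  define A where "A = (\<Union>k\<in>K. Field (\<mu> k)) <+> (UNIV :: nat set)"
  have "small \<kappa> (\<Union>k\<in>K. Field (\<mu> k))"
    using K(2) by (rule small_UNION) (simp add: small_def ordLess_Field \<mu>(2))
  moreover have "|UNIV :: nat set| <o \<kappa>" using card_of_nat uncountable ordIso_ordLess_trans by blast
  ultimately have A: "small \<kappa> A"
    unfolding A_def small_def by (intro card_of_Plus_ordLess_infinite_Field[OF infinite_Field card_order])
  have A_inf: "infinite A" by (simp add: A_def)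
  have \<mu>A: "\<mu> k \<le>o |A|" if "k \<in> K" for k
  proof -
    have "|Field (\<mu> k)| \<le>o |A|"
      unfolding A_def using card_of_mono1[of "Field (\<mu> k)" "\<Union>k\<in>K. Field (\<mu> k)"] that
        ordLeq_transitive[OF _ card_of_Plus1] by blast
    then show ?thesis using card_of_Field_ordIso[OF \<mu>(1)[OF that]] ordIso_symmetric ordIso_ordLeq_trans by blast
  qed
  obtain \<delta> where \<delta>: "\<delta> \<in> Field \<kappa>" "underS \<kappa> \<delta> \<noteq> {}" "\<And>a. a \<in> underS \<kappa> \<delta> \<Longrightarrow> H a \<in> underS \<kappa> \<delta>"
    "\<And>a. a \<in> underS \<kappa> \<delta> \<Longrightarrow> \<exists>b\<in>underS \<kappa> \<delta>. a \<noteq> b \<and> (a, b) \<in> \<kappa>"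
    "\<And>B. B \<subseteq> underS \<kappa> \<delta> \<Longrightarrow> |B| \<le>o |A| \<Longrightarrow> \<exists>b\<in>underS \<kappa> \<delta>. \<forall>a\<in>B. (a, b) \<in> \<kappa>"
    using closed_ordinal_of_large_cofinality[OF A A_inf, of H] H(1) by blast
  define r where "r = Restr \<kappa> (underS \<kappa> \<delta>)"
  note R = Restr_underS[OF wo r_def]
  have r: "(a, b) \<in> r \<longleftrightarrow> a \<in> underS \<kappa> \<delta> \<and> b \<in> underS \<kappa> \<delta> \<and> (a, b) \<in> \<kappa>" for a b by (auto simp: r_def)
  have below: "underS \<kappa> \<delta> \<subseteq> Field \<kappa>" by (auto simp: underS_def Field_def)
  have r_succ: "\<exists>b. is_successor \<kappa> a b \<and> b \<in> underS \<kappa> \<delta>" if a: "a \<in> underS \<kappa> \<delta>" for a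
  proof -
    obtain b where b: "b \<in> underS \<kappa> \<delta>" "a \<noteq> b" "(a, b) \<in> \<kappa>" using \<delta>(4)[OF a] by blast
    have "\<exists>c. is_successor r a c" using b a by (intro ex_successor[OF R(1), of a b]) (auto simp: r)
    then show ?thesis using R(3) by blast
  qed
  define Xo where "Xo = (\<lambda>a. Dom C (F a))"
  have X: "is_functor (order_cat r) C Xo Fm"
    unfolding r_def Xo_def
    by (rule section_is_functor[OF is_section_on_subset[OF sec below]]) (auto simp: over_def St_def Dom_in_Obj)
  have seq: "is_sequence C r Xo Fm"
    unfolding is_sequence_def
  proof (intro conjI allI impI)
    show "Field r \<noteq> {}" using R(2) \<delta>(2) by simp
    fix b assume b: "is_limit_element r b"
    then have "b \<in> underS \<kappa> \<delta>" using R(2) by (simp add: is_limit_element_def)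
    then show "is_colimit (order_cat (Restr r (underS r b))) C Xo Fm (Xo b) (\<lambda>a. Fm (a, b))"
      using limit[OF R(4)[OF b]] R(5) by (simp add: Xo_def)
  qed (rule R(1) X)+
  have steps: "steps_in r Fm (pushouts_of C K)"
    unfolding steps_in_def using succ T_push R(3) by blast
  have small_r: "small_ordinal \<kappa> r" using R(1,2) small_underS[OF \<delta>(1)] by (simp add: small_ordinal_def)
  have "\<exists>L \<iota>. is_colimit (order_cat r) C Xo Fm L \<iota>"
  proof (rule order_colimit_exists[OF _ _ _ X])
    show "small \<kappa> (Field r)" using small_r by (simp add: small_ordinal_def)
    show "(a, a) \<in> r" if "a \<in> Field r" for a using Well_orderD(1)[OF R(1) that] .
    show "(a, c) \<in> r" if "(a, b) \<in> r" "(b, c) \<in> r" for a b c using Well_orderD(2)[OF R(1) that] .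
  qed
  then obtain L \<iota> where L: "is_colimit (order_cat r) C Xo Fm L \<iota>" by blast
  note c = colimit_cocone[OF L, unfolded R(2)]
  obtain p where p: "p \<in> hom C L Y" "\<And>a. a \<in> underS \<kappa> \<delta> \<Longrightarrow> p \<cdot> \<iota> a = F a"
  proof (rule colimit_induced[OF L, where Z = Y and j = F, unfolded R(2)])
    show "Y \<in> Obj C" using f hom_Obj by blast
    show "F a \<in> hom C (Xo a) Y" if "a \<in> underS \<kappa> \<delta>" for a using F(2) that below unfolding Xo_def by blast
    show "F b \<cdot> Fm (a, b) = F a" if "(a, b) \<in> r" for a b using Fm(2) that r by blast
  qed blast
  have fil: "filtered_ordinal (\<mu> k) r" if k: "k \<in> K" for k
    unfolding filtered_ordinal_def is_limit_ordinal_def R(2)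
  proof (intro conjI allI impI ballI)
    show "\<exists>b. is_successor r a b" if "a \<in> underS \<kappa> \<delta>" for a using r_succ[OF that] R(3) by blast
    fix B assume B: "B \<subseteq> underS \<kappa> \<delta>" "|B| \<le>o \<mu> k"
    obtain b where b: "b \<in> underS \<kappa> \<delta>" "\<forall>a\<in>B. (a, b) \<in> \<kappa>"
      using \<delta>(5)[OF B(1) ordLeq_transitive[OF B(2) \<mu>A[OF k]]] by blast
    have "(a, b) \<in> r" if "a \<in> B" for a using b that B(1) by (auto simp: r)
    then show "\<exists>b\<in>underS \<kappa> \<delta>. \<forall>a\<in>B. (a, b) \<in> r" using b(1) by blast
  qed (use R(1,2) \<delta>(2) in simp_all)
  have "lifts_against C k p" if k: "k \<in> K" for k
  proof (rule lifts_againstI)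
    show k': "k \<in> hom C (Dom C k) (Cod C k)" using K(1) k by (auto simp: hom_def)
    show "p \<in> hom C L Y" by (rule p(1))
    fix u v assume u: "u \<in> hom C (Dom C k) L" and v: "v \<in> hom C (Cod C k) Y" and uv: "p \<cdot> u = v \<cdot> k"
    have "steps_in r Fm (cell_maps \<kappa> C K)"
      using steps pushouts_subset_cell_maps unfolding steps_in_def by blast
    then have "bij_betw (hom_colim_map C \<iota>) (hom_colim C (Dom C k) r Xo Fm) (hom C (Dom C k) L)"
      using \<mu>(3)[OF k] small_r fil[OF k] seq L unfolding cardinal_small_relative_def by blast
    then have "detects (Dom C k) r Xo Fm L \<iota>" using hom_colim_bij_iff[OF seq L] by blast
    then obtain a g where a: "a \<in> underS \<kappa> \<delta>" and g: "g \<in> hom C (Dom C k) (Dom C (F a))" "\<iota> a \<cdot> g = u"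
      using u unfolding detects_def R(2) Xo_def by blast
    have aF: "a \<in> Field \<kappa>" using a below by blast
    have \<iota>a: "\<iota> a \<in> hom C (Dom C (F a)) L" using c(2)[OF a] by (simp add: Xo_def)
    have sq: "(k, g, v) \<in> squares K (F a)"
      using k g v F(2)[OF aF] p(2)[OF a] uv Comp_assoc[OF g(1) \<iota>a p(1)]
      by (auto simp: squares_def dest: homD(3))
    \<comment> \<open>The square descends to the stage \<open>a\<close>; the stage \<open>\<gamma>\<close> where it is treated lies below \<open>\<delta>\<close>.\<close>
    define \<gamma> where "\<gamma> = t a (code (F a) (k, g, v))"
    have "code (F a) (k, g, v) \<in> Field \<kappa>" using code(2)[OF F(1)[OF aF]] sq by blast
    then have \<gamma>: "(a, \<gamma>) \<in> \<kappa>" "e \<gamma> = (a, code (F a) (k, g, v))" using t[OF aF] by (auto simp: \<gamma>_def)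
    have "\<gamma> \<in> underS \<kappa> (H a)" using H(2)[OF aF sq] by (simp add: \<gamma>_def)
    then have \<gamma>\<delta>: "\<gamma> \<in> underS \<kappa> \<delta>"
      using \<delta>(3)[OF a] ord(2)[of \<gamma> "H a" \<delta>] ord(3)[of \<gamma> "H a"] by (auto simp: underS_def)
    obtain \<gamma>' where \<gamma>': "is_successor \<kappa> \<gamma> \<gamma>'" "\<gamma>' \<in> underS \<kappa> \<delta>" using r_succ[OF \<gamma>\<delta>] by blast
    then have \<gamma>\<gamma>': "(\<gamma>, \<gamma>') \<in> \<kappa>" by (simp add: is_successor_def)
    obtain h where h: "h \<in> hom C (Cod C k) (Dom C (F \<gamma>'))" "h \<cdot> k = Fm (\<gamma>, \<gamma>') \<cdot> (Fm (a, \<gamma>) \<cdot> g)" "F \<gamma>' \<cdot> h = v"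
      using T_fill[OF succ[OF \<gamma>'(1)] \<gamma>(1) sq \<gamma>(2)] by blast
    have \<iota>\<gamma>: "\<iota> \<gamma>' \<in> hom C (Dom C (F \<gamma>')) L" using c(2)[OF \<gamma>'(2)] by (simp add: Xo_def)
    have "\<iota> \<gamma>' \<cdot> h \<cdot> k = \<iota> \<gamma>' \<cdot> (Fm (\<gamma>, \<gamma>') \<cdot> (Fm (a, \<gamma>) \<cdot> g))"
      using Comp_assoc[OF k' h(1) \<iota>\<gamma>] h(2) by simp
    also have "\<dots> = \<iota> \<gamma>' \<cdot> Fm (\<gamma>, \<gamma>') \<cdot> (Fm (a, \<gamma>) \<cdot> g)"
      using Comp_assoc[OF Comp_in_hom[OF g(1) Fm(1)[OF \<gamma>(1)]] Fm(1)[OF \<gamma>\<gamma>'] \<iota>\<gamma>] .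
    also have "\<dots> = \<iota> \<gamma> \<cdot> (Fm (a, \<gamma>) \<cdot> g)" using c(3)[of \<gamma> \<gamma>'] r \<gamma>\<delta> \<gamma>' \<gamma>\<gamma>' by simp
    also have "\<dots> = \<iota> \<gamma> \<cdot> Fm (a, \<gamma>) \<cdot> g"
      using Comp_assoc[OF g(1) Fm(1)[OF \<gamma>(1)]] c(2)[OF \<gamma>\<delta>] by (simp add: Xo_def)
    also have "\<dots> = u" using c(3)[of a \<gamma>] r \<gamma>\<delta> \<gamma>(1) a g(2) by simp
    finally have "\<iota> \<gamma>' \<cdot> h \<cdot> k = u" .
    moreover have "p \<cdot> (\<iota> \<gamma>' \<cdot> h) = v" using Comp_assoc[OF h(1) \<iota>\<gamma> p(1)] p(2)[OF \<gamma>'(2)] h(3) by simp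
    ultimately show "\<exists>h\<in>hom C (Cod C k) L. h \<cdot> k = u \<and> p \<cdot> h = v" using Comp_in_hom[OF h(1) \<iota>\<gamma>] by blast
  qed
  then have "p \<in> inj_maps C K" using p(1) by (auto simp: inj_maps_def RLP_def hom_def)
  moreover obtain z where z: "is_bottom \<kappa> z" using ex_bottom[OF wo] \<delta>(1) by blast
  then have zr: "is_bottom r z" using R(6) \<delta>(2) by blast
  then have z\<delta>: "z \<in> underS \<kappa> \<delta>" using R(2) by (simp add: is_bottom_def)
  have "\<iota> z \<in> cell_maps \<kappa> C K"
    unfolding cell_maps_def transfinite_compositions_def using small_r seq steps L zr by blast
  moreover have "\<iota> z \<in> hom C X L" using c(2)[OF z\<delta>] F0[OF z] f by (simp add: Xo_def hom_def)
  moreover have "p \<cdot> \<iota> z = f" using p(2)[OF z\<delta>] F0[OF z] by simp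
  ultimately show thesis using p(1) factored by blast
qed

end


section \<open>Smallness relative to all cofibrations\<close>

context category
begin

text \<open>
  Both maps are induced on colimits by the components of the retraction, and their composite is the
  identity since it is so on each component.
\<close>

lemma retract_of_colimit:
  assumes X: "is_functor (order_cat r) C Xo Xm" "is_colimit (order_cat r) C Xo Xm L \<iota>"
    and Y: "is_functor (order_cat r) C Yo Ym" "is_colimit (order_cat r) C Yo Ym L' \<iota>'"
    and s: "\<And>a. a \<in> Field r \<Longrightarrow> s a \<in> hom C (Xo a) (Yo a)" "\<And>a b. (a, b) \<in> r \<Longrightarrow> Ym (a, b) \<cdot> s a = s b \<cdot> Xm (a, b)"
    and t: "\<And>a. a \<in> Field r \<Longrightarrow> t a \<in> hom C (Yo a) (Xo a)" "\<And>a b. (a, b) \<in> r \<Longrightarrow> t b \<cdot> Ym (a, b) = Xm (a, b) \<cdot> t a"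
    and ts: "\<And>a. a \<in> Field r \<Longrightarrow> t a \<cdot> s a = Ident C (Xo a)"
  obtains \<sigma> \<tau> where "\<sigma> \<in> hom C L L'" "\<And>a. a \<in> Field r \<Longrightarrow> \<sigma> \<cdot> \<iota> a = \<iota>' a \<cdot> s a"
    "\<tau> \<in> hom C L' L" "\<And>a. a \<in> Field r \<Longrightarrow> \<tau> \<cdot> \<iota>' a = \<iota> a \<cdot> t a" "\<tau> \<cdot> \<sigma> = Ident C L"
proof -
  note c = colimit_cocone[OF X(2)] and c' = colimit_cocone[OF Y(2)]
  have Xm: "Xm (a, b) \<in> hom C (Xo a) (Xo b)" and Ym: "Ym (a, b) \<in> hom C (Yo a) (Yo b)" if "(a, b) \<in> r" for a b
    using X(1) Y(1) that by (auto simp: is_functor_order_cat)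
  obtain \<sigma> where \<sigma>: "\<sigma> \<in> hom C L L'" "\<And>a. a \<in> Field r \<Longrightarrow> \<sigma> \<cdot> \<iota> a = \<iota>' a \<cdot> s a"
  proof (rule colimit_induced[OF X(2), where Z = L' and j = "\<lambda>a. \<iota>' a \<cdot> s a"])
    show "L' \<in> Obj C" by (rule c'(1))
    show "\<iota>' a \<cdot> s a \<in> hom C (Xo a) L'" if "a \<in> Field r" for a by (rule Comp_in_hom[OF s(1)[OF that] c'(2)[OF that]])
    show "\<iota>' b \<cdot> s b \<cdot> Xm (a, b) = \<iota>' a \<cdot> s a" if ab: "(a, b) \<in> r" for a b
    proof -
      have "a \<in> Field r" "b \<in> Field r" using ab by (auto simp: Field_def)
      then show ?thesis
        using Comp_assoc[OF Xm[OF ab] s(1) c'(2)] Comp_assoc[OF s(1) Ym[OF ab] c'(2)] s(2)[OF ab] c'(3)[OF ab] by simp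
    qed
  qed blast
  obtain \<tau> where \<tau>: "\<tau> \<in> hom C L' L" "\<And>a. a \<in> Field r \<Longrightarrow> \<tau> \<cdot> \<iota>' a = \<iota> a \<cdot> t a"
  proof (rule colimit_induced[OF Y(2), where Z = L and j = "\<lambda>a. \<iota> a \<cdot> t a"])
    show "L \<in> Obj C" by (rule c(1))
    show "\<iota> a \<cdot> t a \<in> hom C (Yo a) L" if "a \<in> Field r" for a by (rule Comp_in_hom[OF t(1)[OF that] c(2)[OF that]])
    show "\<iota> b \<cdot> t b \<cdot> Ym (a, b) = \<iota> a \<cdot> t a" if ab: "(a, b) \<in> r" for a b
    proof -
      have "a \<in> Field r" "b \<in> Field r" using ab by (auto simp: Field_def)
      then show ?thesis
        using Comp_assoc[OF Ym[OF ab] t(1) c(2)] Comp_assoc[OF t(1) Xm[OF ab] c(2)] t(2)[OF ab] c(3)[OF ab] by simp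
    qed
  qed blast
  have "\<tau> \<cdot> \<sigma> = Ident C L"
  proof (rule colimit_eqI[OF X(2,1) Comp_in_hom[OF \<sigma>(1) \<tau>(1)] Ident_in_hom[OF c(1)]])
    fix a assume a: "a \<in> Field r"
    have "\<tau> \<cdot> \<sigma> \<cdot> \<iota> a = \<iota> a \<cdot> (t a \<cdot> s a)"
      using Comp_assoc[OF c(2)[OF a] \<sigma>(1) \<tau>(1)] Comp_assoc[OF s(1)[OF a] c'(2)[OF a] \<tau>(1)]
        Comp_assoc[OF s(1)[OF a] t(1)[OF a] c(2)[OF a]] \<sigma>(2)[OF a] \<tau>(2)[OF a] by simp
    then show "\<tau> \<cdot> \<sigma> \<cdot> \<iota> a = Ident C L \<cdot> \<iota> a"
      using ts[OF a] Comp_Ident[OF c(2)[OF a]] Ident_Comp[OF c(2)[OF a]] by simp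
  qed
  with \<sigma> \<tau> show thesis using that by blast
qed

text \<open>
  A map \<open>u : A \<rightarrow> L\<close> descends by descending \<open>\<sigma> \<cdot> u\<close> along \<open>Y\<close> and applying the retraction \<open>t\<close>; equations are
  treated in the same way.
\<close>

lemma retract_detects:
  assumes X: "is_functor (order_cat r) C Xo Xm" "is_colimit (order_cat r) C Xo Xm L \<iota>"
    and Y: "is_functor (order_cat r) C Yo Ym" "is_colimit (order_cat r) C Yo Ym L' \<iota>'"
    and s: "\<And>a. a \<in> Field r \<Longrightarrow> s a \<in> hom C (Xo a) (Yo a)" "\<And>a b. (a, b) \<in> r \<Longrightarrow> Ym (a, b) \<cdot> s a = s b \<cdot> Xm (a, b)"
    and t: "\<And>a. a \<in> Field r \<Longrightarrow> t a \<in> hom C (Yo a) (Xo a)" "\<And>a b. (a, b) \<in> r \<Longrightarrow> t b \<cdot> Ym (a, b) = Xm (a, b) \<cdot> t a"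
    and ts: "\<And>a. a \<in> Field r \<Longrightarrow> t a \<cdot> s a = Ident C (Xo a)"
    and det: "detects A r Yo Ym L' \<iota>'"
  shows "detects A r Xo Xm L \<iota>"
proof -
  note c = colimit_cocone[OF X(2)] and c' = colimit_cocone[OF Y(2)]
  have Xm: "Xm (a, b) \<in> hom C (Xo a) (Xo b)" and Ym: "Ym (a, b) \<in> hom C (Yo a) (Yo b)" if "(a, b) \<in> r" for a b
    using X(1) Y(1) that by (auto simp: is_functor_order_cat)
  obtain \<sigma> \<tau> where \<sigma>: "\<sigma> \<in> hom C L L'" "\<And>a. a \<in> Field r \<Longrightarrow> \<sigma> \<cdot> \<iota> a = \<iota>' a \<cdot> s a"
    and \<tau>: "\<tau> \<in> hom C L' L" "\<And>a. a \<in> Field r \<Longrightarrow> \<tau> \<cdot> \<iota>' a = \<iota> a \<cdot> t a" and \<tau>\<sigma>: "\<tau> \<cdot> \<sigma> = Ident C L"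
    using retract_of_colimit[OF X Y s t ts] by blast
  show ?thesis
    unfolding detects_def
  proof (intro conjI ballI impI)
    fix u assume u: "u \<in> hom C A L"
    obtain a g where a: "a \<in> Field r" and g: "g \<in> hom C A (Yo a)" "\<iota>' a \<cdot> g = \<sigma> \<cdot> u"
      using det Comp_in_hom[OF u \<sigma>(1)] unfolding detects_def by blast
    have "\<iota> a \<cdot> (t a \<cdot> g) = \<tau> \<cdot> (\<sigma> \<cdot> u)"
      using Comp_assoc[OF g(1) t(1)[OF a] c(2)[OF a]] Comp_assoc[OF g(1) c'(2)[OF a] \<tau>(1)] \<tau>(2)[OF a] g(2) by simp
    then have "\<iota> a \<cdot> (t a \<cdot> g) = u" using Comp_assoc[OF u \<sigma>(1) \<tau>(1)] \<tau>\<sigma> Ident_Comp[OF u] by simp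
    then show "\<exists>a\<in>Field r. \<exists>g\<in>hom C A (Xo a). \<iota> a \<cdot> g = u"
      using a Comp_in_hom[OF g(1) t(1)[OF a]] by blast
  next
    fix a b g h assume a: "a \<in> Field r" and b: "b \<in> Field r" and g: "g \<in> hom C A (Xo a)" and h: "h \<in> hom C A (Xo b)"
      and eq: "\<iota> a \<cdot> g = \<iota> b \<cdot> h"
    have "\<iota>' a \<cdot> (s a \<cdot> g) = \<iota>' b \<cdot> (s b \<cdot> h)"
      using Comp_assoc[OF g s(1)[OF a] c'(2)[OF a]] Comp_assoc[OF h s(1)[OF b] c'(2)[OF b]]
        Comp_assoc[OF g c(2)[OF a] \<sigma>(1)] Comp_assoc[OF h c(2)[OF b] \<sigma>(1)] \<sigma>(2)[OF a] \<sigma>(2)[OF b] eq by simp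
    then obtain d where d: "(a, d) \<in> r" "(b, d) \<in> r" "Ym (a, d) \<cdot> (s a \<cdot> g) = Ym (b, d) \<cdot> (s b \<cdot> h)"
      using det a b Comp_in_hom[OF g s(1)[OF a]] Comp_in_hom[OF h s(1)[OF b]] unfolding detects_def by blast
    have pull: "t d \<cdot> (Ym (x, d) \<cdot> (s x \<cdot> w)) = Xm (x, d) \<cdot> w"
      if "(x, d) \<in> r" "w \<in> hom C A (Xo x)" for x w
    proof -
      have x: "x \<in> Field r" "d \<in> Field r" using that(1) by (auto simp: Field_def)
      have "t d \<cdot> (Ym (x, d) \<cdot> (s x \<cdot> w)) = Xm (x, d) \<cdot> t x \<cdot> (s x \<cdot> w)"
        using Comp_assoc[OF Comp_in_hom[OF that(2) s(1)[OF x(1)]] Ym[OF that(1)] t(1)[OF x(2)]] t(2)[OF that(1)] by simp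
      also have "\<dots> = Xm (x, d) \<cdot> (t x \<cdot> s x \<cdot> w)"
        using Comp_assoc[OF Comp_in_hom[OF that(2) s(1)[OF x(1)]] t(1)[OF x(1)] Xm[OF that(1)]]
          Comp_assoc[OF that(2) s(1)[OF x(1)] t(1)[OF x(1)]] by simp
      finally show ?thesis using ts[OF x(1)] Ident_Comp[OF that(2)] by simp
    qed
    have "Xm (a, d) \<cdot> g = Xm (b, d) \<cdot> h" using pull[OF d(1) g] pull[OF d(2) h] d(3) by simp
    then show "\<exists>c. (a, c) \<in> r \<and> (b, c) \<in> r \<and> Xm (a, c) \<cdot> g = Xm (b, c) \<cdot> h" using d by blast
  qed
qed

end

context cocomplete_category
begin

text \<open>
  The sequence \<open>Y\<close> and the maps \<open>X \<rightarrow> Y \<rightarrow> X\<close> are built together. At a successor \<open>b\<close> of \<open>a\<close>, the map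
  \<open>Y\<^sub>a \<rightarrow> X\<^sub>a \<rightarrow> X\<^sub>b\<close> is factored by the small object argument into a relative cell complex \<open>Y\<^sub>a \<rightarrow> Y\<^sub>b\<close> and
  a map \<open>Y\<^sub>b \<rightarrow> X\<^sub>b\<close> in \<open>K\<close>-inj. As \<open>X\<^sub>a \<rightarrow> X\<^sub>b\<close> is in \<open>K\<close>-cof, lifting yields a section of the latter that
  extends \<open>X\<^sub>a \<rightarrow> Y\<^sub>a \<rightarrow> Y\<^sub>b\<close>. At limits both maps are induced on colimits. Lifting replaces
  functoriality of the factorization.
\<close>

lemma cofibration_sequence_retract:
  fixes r :: "'u rel"
  assumes K: "K \<subseteq> Mor C" "small \<kappa> K"
    and dom: "\<And>k. k \<in> K \<Longrightarrow> small_relative \<kappa> C (cell_maps \<kappa> C K) (Dom C k)"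
    and X: "is_sequence C r Xo Xm" "steps_in r Xm (cof_maps C K)" and small_r: "small \<kappa> (Field r)"
  obtains Yo Ym s t where "is_sequence C r Yo Ym" "steps_in r Ym (cell_maps \<kappa> C K)"
    "\<And>a. a \<in> Field r \<Longrightarrow> s a \<in> hom C (Xo a) (Yo a)" "\<And>a b. (a, b) \<in> r \<Longrightarrow> Ym (a, b) \<cdot> s a = s b \<cdot> Xm (a, b)"
    "\<And>a. a \<in> Field r \<Longrightarrow> t a \<in> hom C (Yo a) (Xo a)" "\<And>a b. (a, b) \<in> r \<Longrightarrow> t b \<cdot> Ym (a, b) = Xm (a, b) \<cdot> t a"
    "\<And>a. a \<in> Field r \<Longrightarrow> t a \<cdot> s a = Ident C (Xo a)"
proof -
  note retract = that
  note X' = sequenceD[OF X(1)]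
  note wo = X'(1) note ord = Well_orderD[OF wo]
  note FR = Field_Restr_underS[OF wo]
  \<comment> \<open>A state \<open>(a, s, t)\<close> exhibits \<open>X\<^sub>a\<close> as a retract of the codomain of \<open>s\<close>.\<close>
  define U :: "'u \<times> 'm \<times> 'm \<Rightarrow> 'o" where "U = (\<lambda>(a, s, t). Cod C s)"
  define St where "St a = {(a', s, t). a' = a \<and> a \<in> Field r \<and> s \<in> hom C (Xo a) (Cod C s) \<and> t \<in> hom C (Cod C s) (Xo a) \<and>
    t \<cdot> s = Ident C (Xo a)}" for a
  define H where "H = (\<lambda>(a, s, t) (b, s', t') m. (a, b) \<in> r \<and> (a, s, t) \<in> St a \<and> (b, s', t') \<in> St b \<and>
    m \<in> hom C (Cod C s) (Cod C s') \<and> m \<cdot> s = s' \<cdot> Xm (a, b) \<and> t' \<cdot> m = Xm (a, b) \<cdot> t)"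
  have U [simp]: "U (a, s, t) = Cod C s" for a s t by (simp add: U_def)
  have St: "(a', s, t) \<in> St a \<longleftrightarrow> a' = a \<and> a \<in> Field r \<and> s \<in> hom C (Xo a) (Cod C s) \<and> t \<in> hom C (Cod C s) (Xo a) \<and>
    t \<cdot> s = Ident C (Xo a)" for a' a s t by (simp add: St_def)
  have H: "H (a, s, t) (b, s', t') m \<longleftrightarrow> (a, b) \<in> r \<and> (a, s, t) \<in> St a \<and> (b, s', t') \<in> St b \<and>
    m \<in> hom C (Cod C s) (Cod C s') \<and> m \<cdot> s = s' \<cdot> Xm (a, b) \<and> t' \<cdot> m = Xm (a, b) \<cdot> t" for a s t b s' t' m
    by (simp add: H_def)
  obtain z where z: "is_bottom r z" using ex_bottom[OF wo] X(1) by (auto simp: is_sequence_def)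
  have zF: "z \<in> Field r" using z by (simp add: is_bottom_def)
  have limit_step: "\<exists>e\<in>St b. U e = L \<and> (\<forall>a\<in>underS r b. H (F a) e (\<iota> a))"
    if b: "is_limit_element r b" and sec: "is_section_on C r St U H (underS r b) F Fm"
      and L: "is_colimit (order_cat (Restr r (underS r b))) C (\<lambda>a. U (F a)) Fm L \<iota>"
      and Y: "is_functor (order_cat (Restr r (underS r b))) C (\<lambda>a. U (F a)) Fm" for b F Fm L \<iota>
  proof -
    let ?r = "Restr r (underS r b)"
    define s t where "s a = fst (snd (F a))" and "t a = snd (snd (F a))" for a
    have F: "F a = (a, s a, t a)" "F a \<in> St a" if "a \<in> underS r b" for a
      using is_section_onD(1)[OF sec that] by (auto simp: s_def t_def St_def)
    have HF: "H (a, s a, t a) (d, s d, t d) (Fm (a, d))" if "(a, d) \<in> ?r" for a d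
      using is_section_onD(3)[OF sec, of a d] F(1)[of a] F(1)[of d] that by auto
    have st: "s a \<in> hom C (Xo a) (Cod C (s a))" "t a \<in> hom C (Cod C (s a)) (Xo a)" "t a \<cdot> s a = Ident C (Xo a)"
      "U (F a) = Cod C (s a)" if "a \<in> underS r b" for a
      using F[OF that] by (auto simp: St)
    obtain \<sigma> \<tau> where \<sigma>: "\<sigma> \<in> hom C (Xo b) L" "\<And>a. a \<in> underS r b \<Longrightarrow> \<sigma> \<cdot> Xm (a, b) = \<iota> a \<cdot> s a"
      and \<tau>: "\<tau> \<in> hom C L (Xo b)" "\<And>a. a \<in> underS r b \<Longrightarrow> \<tau> \<cdot> \<iota> a = Xm (a, b) \<cdot> t a" "\<tau> \<cdot> \<sigma> = Ident C (Xo b)"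
    proof (rule retract_of_colimit[OF functor_Restr[OF X'(2)] X'(7)[OF b] Y L, where s = s and t = t, unfolded FR])
      show "s a \<in> hom C (Xo a) (U (F a))" "t a \<in> hom C (U (F a)) (Xo a)" "t a \<cdot> s a = Ident C (Xo a)"
        if "a \<in> underS r b" for a using st[OF that] by auto
      show "Fm (a, d) \<cdot> s a = s d \<cdot> Xm (a, d)" "t d \<cdot> Fm (a, d) = Xm (a, d) \<cdot> t a" if "(a, d) \<in> ?r" for a d
        using HF[OF that] by (simp_all add: H)
    qed blast
    have bF: "b \<in> Field r" using b by (simp add: is_limit_element_def)
    have CL: "Cod C \<sigma> = L" using \<sigma>(1) by (rule homD)
    have e: "(b, \<sigma>, \<tau>) \<in> St b" using \<sigma>(1) \<tau>(1,3) bF by (simp add: St CL)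
    have "H (F a) (b, \<sigma>, \<tau>) (\<iota> a)" if a: "a \<in> underS r b" for a
    proof -
      have "\<iota> a \<in> hom C (U (F a)) L" using colimit_cocone(2)[OF L, unfolded FR, OF a] .
      then show ?thesis
        using e F[OF a] \<sigma>(2)[OF a] \<tau>(2)[OF a] a by (simp add: H CL underS_def)
    qed
    then show ?thesis using e CL by (intro bexI[OF _ e]) simp
  qed
  have H_hom: "m \<in> hom C (U e) (U e')" if "H e e' m" for e e' m
    using that by (cases e, cases e') (simp add: H)
  have U_Obj: "U e \<in> Obj C" if "e \<in> St a" for a e
    using that hom_Obj by (cases e) (auto simp: St)
  obtain F Ym where sec: "is_section_on C r St U H (Field r) F Ym"
    and steps: "\<And>a b. is_successor r a b \<Longrightarrow> Ym (a, b) \<in> cell_maps \<kappa> C K"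
    and limit: "\<And>b. is_limit_element r b \<Longrightarrow>
      is_colimit (order_cat (Restr r (underS r b))) C (\<lambda>a. U (F a)) Ym (U (F b)) (\<lambda>a. Ym (a, b))"
  proof (rule transfinite_section[OF wo, where St = St and U = U and H = H
        and T = "\<lambda>a F Fm e m. m \<in> cell_maps \<kappa> C K" and ?e0.0 = "(z, Ident C (Xo z), Ident C (Xo z))"])
    show "\<And>a e. e \<in> St a \<Longrightarrow> U e \<in> Obj C" by (rule U_Obj)
    show "\<And>e e' m. H e e' m \<Longrightarrow> m \<in> hom C (U e) (U e')" by (rule H_hom)
    show "H e e (Ident C (U e))" if "e \<in> St a" for a e
    proof -
      obtain s t where e: "e = (a, s, t)" using \<open>e \<in> St a\<close> by (cases e) (simp add: St)
      have a: "a \<in> Field r" "s \<in> hom C (Xo a) (Cod C s)" "t \<in> hom C (Cod C s) (Xo a)"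
        using \<open>e \<in> St a\<close> e by (auto simp: St)
      show ?thesis
        using \<open>e \<in> St a\<close> a ord(1)[OF a(1)] X'(4)[OF a(1)] U_Obj[OF \<open>e \<in> St a\<close>]
        by (simp add: e H Ident_in_hom Ident_Comp[OF a(2)] Comp_Ident[OF a(2)] Ident_Comp[OF a(3)] Comp_Ident[OF a(3)])
    qed
    show "H e e'' (m' \<cdot> m)" if "H e e' m" "H e' e'' m'" for e e' e'' m m'
    proof -
      obtain a s t b s' t' d s'' t'' where e: "e = (a, s, t)" "e' = (b, s', t')" "e'' = (d, s'', t'')"
        by (metis prod_cases3)
      have 1: "(a, b) \<in> r" "(b, d) \<in> r" "s \<in> hom C (Xo a) (Cod C s)" "t \<in> hom C (Cod C s) (Xo a)"
        "s' \<in> hom C (Xo b) (Cod C s')" "t' \<in> hom C (Cod C s') (Xo b)" "s'' \<in> hom C (Xo d) (Cod C s'')"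
        "t'' \<in> hom C (Cod C s'') (Xo d)" "m \<in> hom C (Cod C s) (Cod C s')" "m' \<in> hom C (Cod C s') (Cod C s'')"
        and 2: "m \<cdot> s = s' \<cdot> Xm (a, b)" "t' \<cdot> m = Xm (a, b) \<cdot> t" "m' \<cdot> s' = s'' \<cdot> Xm (b, d)" "t'' \<cdot> m' = Xm (b, d) \<cdot> t'"
        using that unfolding e H St by auto
      note X1 = X'(5)[OF 1(1)] and X2 = X'(5)[OF 1(2)]
      have "m' \<cdot> m \<cdot> s = s'' \<cdot> (Xm (b, d) \<cdot> Xm (a, b))"
        using Comp_assoc[OF 1(3,9,10)] Comp_assoc[OF X1 1(5,10)] Comp_assoc[OF X1 X2 1(7)] 2 by simp
      moreover have "t'' \<cdot> (m' \<cdot> m) = Xm (b, d) \<cdot> Xm (a, b) \<cdot> t"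
        using Comp_assoc[OF 1(9,10,8)] Comp_assoc[OF 1(9,6) X2] Comp_assoc[OF 1(4) X1 X2] 2 by simp
      ultimately show ?thesis
        using that ord(2)[OF 1(1,2)] Comp_in_hom[OF 1(9,10)] X'(6)[OF 1(1,2)] unfolding e H by simp
    qed
    show "\<exists>L \<iota>. is_colimit (order_cat (Restr r (underS r b))) C Zo Zm L \<iota>"
      if "b \<in> Field r" "is_functor (order_cat (Restr r (underS r b))) C Zo Zm" for b Zo Zm
    proof (rule order_colimit_exists[OF _ _ _ that(2)])
      note w = Well_orderD[OF Well_order_Restr[OF wo, of "underS r b"]]
      show "small \<kappa> (Field (Restr r (underS r b)))"
        unfolding FR by (rule small_subset[OF small_r]) (auto simp: underS_def Field_def)
      show "(a, a) \<in> Restr r (underS r b)" if "a \<in> Field (Restr r (underS r b))" for a by (rule w(1)[OF that])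
      show "(a, d) \<in> Restr r (underS r b)" if "(a, c) \<in> Restr r (underS r b)" "(c, d) \<in> Restr r (underS r b)" for a c d
        by (rule w(2)[OF that])
    qed
    show "(z, Ident C (Xo z), Ident C (Xo z)) \<in> St z'" if "is_bottom r z'" for z'
    proof -
      have "z' = z" by (rule bottom_unique[OF wo that z])
      then show ?thesis
        using zF Ident_in_hom[OF X'(3)[OF zF]] Comp_Ident[OF Ident_in_hom[OF X'(3)[OF zF]]] by (simp add: St homD(3))
    qed
    show "\<exists>e\<in>St b. \<exists>m. H (F a) e m \<and> m \<in> cell_maps \<kappa> C K"
      if ab: "is_successor r a b" and sec: "is_section_on C r St U H (under r a) F Fm" for a b F Fm
    proof -
      have ab': "(a, b) \<in> r" using ab by (simp add: is_successor_def)
      have F: "a \<in> Field r" "b \<in> Field r" using ab' by (auto simp: Field_def)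
      have "F a \<in> St a" using is_section_onD(1)[OF sec, of a] ord(1)[OF F(1)] by (simp add: under_def)
      then obtain s t where Fa: "F a = (a, s, t)" and s: "s \<in> hom C (Xo a) (Cod C s)" and t: "t \<in> hom C (Cod C s) (Xo a)"
        and ts: "t \<cdot> s = Ident C (Xo a)" by (cases "F a") (auto simp: St)
      note Xab = X'(5)[OF ab']
      obtain Z c p where c: "c \<in> cell_maps \<kappa> C K" "c \<in> hom C (Cod C s) Z"
        and p: "p \<in> inj_maps C K" "p \<in> hom C Z (Xo b)" and pc: "p \<cdot> c = Xm (a, b) \<cdot> t"
        using small_object_argument[OF K dom Comp_in_hom[OF t Xab]] by blast
      have "lifts_against C (Xm (a, b)) p"
        using X(2) ab p(1) unfolding steps_in_def cof_maps_def LLP_def by blast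
      moreover have "p \<cdot> (c \<cdot> s) = Ident C (Xo b) \<cdot> Xm (a, b)"
        using Comp_assoc[OF s c(2) p(2)] Comp_assoc[OF s t Xab] pc ts Comp_Ident[OF Xab] Ident_Comp[OF Xab] by simp
      ultimately obtain s' where s': "s' \<in> hom C (Xo b) Z" "s' \<cdot> Xm (a, b) = c \<cdot> s" "p \<cdot> s' = Ident C (Xo b)"
        using lift[OF _ Xab p(2) Comp_in_hom[OF s c(2)] Ident_in_hom[OF X'(3)[OF F(2)]]] by blast
      have CZ: "Cod C s' = Z" using s'(1) by (rule homD)
      have e: "(b, s', p) \<in> St b" using s' p(2) F(2) by (simp add: St CZ)
      moreover have "H (F a) (b, s', p) c"
        using e \<open>F a \<in> St a\<close> ab' c(2) s'(2) pc unfolding Fa H by (simp add: CZ)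
      ultimately show ?thesis using c(1) by blast
    qed
    show "\<exists>e\<in>St b. U e = L \<and> (\<forall>a\<in>underS r b. H (F a) e (\<iota> a))"
      if "is_limit_element r b" "is_section_on C r St U H (underS r b) F Fm"
        "is_colimit (order_cat (Restr r (underS r b))) C (\<lambda>a. U (F a)) Fm L \<iota>" for b F Fm L \<iota>
      by (rule limit_step[OF that section_is_functor[OF that(2)]]) (fact H_hom, fact U_Obj)
  qed blast+
  define s t where "s a = fst (snd (F a))" and "t a = snd (snd (F a))" for a
  define Yo where "Yo = (\<lambda>a. U (F a))"
  have F: "F a = (a, s a, t a)" "F a \<in> St a" if "a \<in> Field r" for a
    using is_section_onD(1)[OF sec that] by (auto simp: s_def t_def St_def)
  have HF: "H (a, s a, t a) (b, s b, t b) (Ym (a, b))" if "(a, b) \<in> r" for a b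
    using is_section_onD(3)[OF sec, of a b] F(1)[of a] F(1)[of b] that FieldI1[OF that] FieldI2[OF that] by simp
  have "is_functor (order_cat (Restr r (Field r))) C Yo Ym"
    unfolding Yo_def by (rule section_is_functor[OF sec]) (fact H_hom, fact U_Obj)
  moreover have "Restr r (Field r) = r" by (auto simp: Field_def)
  ultimately have "is_sequence C r Yo Ym"
    using X(1) limit unfolding is_sequence_def by (simp add: Yo_def)
  then show thesis
  proof (rule retract)
    show "steps_in r Ym (cell_maps \<kappa> C K)" using steps by (simp add: steps_in_def)
    show "s a \<in> hom C (Xo a) (Yo a)" "t a \<in> hom C (Yo a) (Xo a)" "t a \<cdot> s a = Ident C (Xo a)" if "a \<in> Field r" for a
      using F[OF that] by (auto simp: St Yo_def)
    show "Ym (a, b) \<cdot> s a = s b \<cdot> Xm (a, b)" "t b \<cdot> Ym (a, b) = Xm (a, b) \<cdot> t a" if "(a, b) \<in> r" for a b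
      using HF[OF that] by (simp_all add: H)
  qed
qed

text \<open>
  Smallness for the sequence of relative cell complexes passes to its retract.
\<close>

lemma small_relative_cof_maps:
  assumes K: "K \<subseteq> Mor C" "small \<kappa> K"
    and dom: "\<And>k. k \<in> K \<Longrightarrow> small_relative \<kappa> C (cell_maps \<kappa> C K) (Dom C k)"
    and A: "small_relative \<kappa> C (cell_maps \<kappa> C K) A" and S: "S \<subseteq> cof_maps C K"
  shows "small_relative \<kappa> C S A"
proof -
  obtain \<mu> :: "'u rel" where \<mu>: "Card_order \<mu>" "\<mu> <o \<kappa>" "cardinal_small_relative \<kappa> C \<mu> (cell_maps \<kappa> C K) A"
    using A unfolding small_relative_def by blast
  have "cardinal_small_relative \<kappa> C \<mu> S A"
    unfolding cardinal_small_relative_def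
  proof (intro allI impI, elim conjE)
    fix r :: "'u rel" and Xo Xm L \<iota>
    assume r: "small_ordinal \<kappa> r" "filtered_ordinal \<mu> r" and X: "is_sequence C r Xo Xm" "steps_in r Xm S"
      and L: "is_colimit (order_cat r) C Xo Xm L \<iota>"
    have small_r: "small \<kappa> (Field r)" using r(1) by (simp add: small_ordinal_def)
    have "steps_in r Xm (cof_maps C K)" using X(2) S by (auto simp: steps_in_def)
    then obtain Yo Ym s t where Y: "is_sequence C r Yo Ym" "steps_in r Ym (cell_maps \<kappa> C K)"
      and st: "\<And>a. a \<in> Field r \<Longrightarrow> s a \<in> hom C (Xo a) (Yo a)" "\<And>a b. (a, b) \<in> r \<Longrightarrow> Ym (a, b) \<cdot> s a = s b \<cdot> Xm (a, b)"
      "\<And>a. a \<in> Field r \<Longrightarrow> t a \<in> hom C (Yo a) (Xo a)" "\<And>a b. (a, b) \<in> r \<Longrightarrow> t b \<cdot> Ym (a, b) = Xm (a, b) \<cdot> t a"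
      "\<And>a. a \<in> Field r \<Longrightarrow> t a \<cdot> s a = Ident C (Xo a)"
      using cofibration_sequence_retract[OF K dom X(1) _ small_r] by blast
    note ord = Well_orderD[OF sequenceD(1)[OF X(1)]]
    have "\<exists>L' \<iota>'. is_colimit (order_cat r) C Yo Ym L' \<iota>'"
      using ord(1,2) by (rule order_colimit_exists[OF _ _ small_r sequenceD(2)[OF Y(1)]])
    then obtain L' \<iota>' where L': "is_colimit (order_cat r) C Yo Ym L' \<iota>'" by blast
    have "bij_betw (hom_colim_map C \<iota>') (hom_colim C A r Yo Ym) (hom C A L')"
      using \<mu>(3) r Y L' unfolding cardinal_small_relative_def by blast
    then have "detects A r Yo Ym L' \<iota>'" using hom_colim_bij_iff[OF Y(1) L'] by blast
    then have "detects A r Xo Xm L \<iota>"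
      using retract_detects[OF sequenceD(2)[OF X(1)] L sequenceD(2)[OF Y(1)] L', of s t A] st by blast
    then show "bij_betw (hom_colim_map C \<iota>) (hom_colim C A r Xo Xm) (hom C A L)"
      using hom_colim_bij_iff[OF X(1) L] by blast
  qed
  then show ?thesis using \<mu> unfolding small_relative_def by blast
qed

end


section \<open>Homotopies between maps into fibrant objects\<close>

locale universe_model_category = model_category M \<kappa> + universe \<kappa>
  for M :: "('o, 'm, 'x) model_structure_scheme" (structure) and \<kappa> :: "'u rel"
begin

sublocale cocomplete_category M \<kappa>
  by unfold_locales (fact cocomplete, fact hom_small)

lemma Cof_eq: "Cof M = LLP M (TFib M)" and TFib_eq: "TFib M = RLP M (Cof M)"
  and TCof_eq: "TCof M = LLP M (Fib M)" and Fib_eq: "Fib M = RLP M (TCof M)"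
  using wfs_Cof_TFib wfs_TCof_Fib unfolding weak_factorization_system_def by blast+

lemma Mor: "f \<in> Cof M \<Longrightarrow> f \<in> Mor M" "f \<in> Fib M \<Longrightarrow> f \<in> Mor M"
    "f \<in> TCof M \<Longrightarrow> f \<in> Mor M" "f \<in> TFib M \<Longrightarrow> f \<in> Mor M"
  by (simp add: Cof_eq LLP_def, simp add: Fib_eq RLP_def, simp add: TCof_eq LLP_def, simp add: TFib_eq RLP_def)

lemma Cof_lifts_TFib: "i \<in> Cof M \<Longrightarrow> p \<in> TFib M \<Longrightarrow> lifts_against M i p"
  unfolding Cof_eq LLP_def by blast

lemma TCof_lifts_Fib: "i \<in> TCof M \<Longrightarrow> p \<in> Fib M \<Longrightarrow> lifts_against M i p"
  unfolding TCof_eq LLP_def by blast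

lemma Cof_TFib_factorization:
  assumes "f \<in> hom M X Y"
  obtains Z i p where "i \<in> Cof M" "i \<in> hom M X Z" "p \<in> TFib M" "p \<in> hom M Z Y" "p \<cdot> i = f"
proof -
  obtain i p where ip: "i \<in> Cof M" "p \<in> TFib M" "Cod M i = Dom M p" "f = p \<cdot> i"
    using wfs_Cof_TFib homD(1)[OF assms] unfolding weak_factorization_system_def by blast
  have "Dom M i = X" "Cod M p = Y" using Comp_Mor[OF Mor(1)[OF ip(1)] Mor(4)[OF ip(2)] ip(3)] ip(4) assms by (auto simp: hom_def)
  then show thesis using that[of i "Dom M p" p] ip in_hom[OF Mor(1)[OF ip(1)]] in_hom[OF Mor(4)[OF ip(2)]] by simp
qed

lemma TCof_Fib_factorization:
  assumes "f \<in> hom M X Y"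
  obtains Z j p where "j \<in> TCof M" "j \<in> hom M X Z" "p \<in> Fib M" "p \<in> hom M Z Y" "p \<cdot> j = f"
proof -
  obtain i p where ip: "i \<in> TCof M" "p \<in> Fib M" "Cod M i = Dom M p" "f = p \<cdot> i"
    using wfs_TCof_Fib homD(1)[OF assms] unfolding weak_factorization_system_def by blast
  have "Dom M i = X" "Cod M p = Y" using Comp_Mor[OF Mor(3)[OF ip(1)] Mor(2)[OF ip(2)] ip(3)] ip(4) assms by (auto simp: hom_def)
  then show thesis using that[of i "Dom M p" p] ip in_hom[OF Mor(3)[OF ip(1)]] in_hom[OF Mor(2)[OF ip(2)]] by simp
qed

lemma Ident_Weq:
  assumes "X \<in> Obj M"
  shows "Ident M X \<in> Weq M"
proof -
  note I = Ident_in_hom[OF assms]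
  have "lifts_against M (Ident M X) p" if "p \<in> Fib M" for p
  proof (rule lifts_againstI[OF I in_hom[OF Mor(2)[OF that]]])
    fix u v assume "u \<in> hom M X (Dom M p)" "v \<in> hom M X (Cod M p)" "p \<cdot> u = v \<cdot> Ident M X"
    then show "\<exists>h\<in>hom M X (Dom M p). h \<cdot> Ident M X = u \<and> p \<cdot> h = v" using Comp_Ident by metis
  qed
  then have "Ident M X \<in> TCof M" using I by (simp add: TCof_eq LLP_def hom_def)
  then show ?thesis by (simp add: TCof_def)
qed

text \<open>An extension of \<open>u\<close> along \<open>j\<close> is a lift against the map from \<open>X\<close> to the terminal object.\<close>

lemma fibrant_extension:
  assumes j: "j \<in> TCof M" "j \<in> hom M A B" and u: "u \<in> hom M A X" and X: "fibrant M X"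
  obtains w where "w \<in> hom M B X" "w \<cdot> j = u"
proof -
  obtain T t where T: "terminal M T" and t: "t \<in> hom M X T" "t \<in> Fib M" using X unfolding fibrant_def by blast
  have "A \<in> Obj M" "B \<in> Obj M" using j(2) hom_Obj by blast+
  then obtain v where v: "v \<in> hom M B T" using T unfolding terminal_def by blast
  have "t \<cdot> u = v \<cdot> j"
    using T \<open>A \<in> Obj M\<close> Comp_in_hom[OF u t(1)] Comp_in_hom[OF j(2) v] unfolding terminal_def by blast
  then show thesis using lift[OF TCof_lifts_Fib[OF j(1) t(2)] j(2) t(1) u v] that by blast
qed

text \<open>
  Let \<open>j : X \<rightarrow> Z\<close> be a trivial cofibration with retraction \<open>\<rho>\<close>. The maps \<open>j \<rho>\<close> and \<open>id\<close> agree
  on \<open>X\<close>, and they are homotopic relative to \<open>X\<close> as \<open>Z\<close> is fibrant: the inclusion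
  \<open>c : Z \<amalg>\<^sub>X Z \<rightarrow> D\<close> of the relative cylinder of \<open>j\<close> is again a trivial cofibration. Indeed \<open>a1\<close> is a
  pushout of \<open>j\<close> and \<open>c \<cdot> a1\<close> is a section of the weak equivalence \<open>d\<close>, so two-out-of-three applies.
\<close>

lemma deformation_retraction:
  assumes j: "j \<in> TCof M" "j \<in> hom M X Z" and \<rho>: "\<rho> \<in> hom M Z X" "\<rho> \<cdot> j = Ident M X" and Z: "fibrant M Z"
  obtains P a0 a1 c D d E where "is_pushout M j j a0 a1" "Cod M a0 = P" "c \<in> hom M P D" "d \<in> TFib M" "d \<in> hom M D Z"
    "d \<cdot> (c \<cdot> a0) = Ident M Z" "d \<cdot> (c \<cdot> a1) = Ident M Z"
    "E \<in> hom M D Z" "E \<cdot> (c \<cdot> a0) = j \<cdot> \<rho>" "E \<cdot> (c \<cdot> a1) = Ident M Z"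
proof -
  have ZO: "Z \<in> Obj M" using j(2) hom_Obj by blast
  obtain a0 a1 where P: "is_pushout M j j a0 a1" using pushout_exists[OF j(2,2)] by blast
  have Cj: "Cod M j = Z" "Dom M j = X" using j(2) by (auto simp: hom_def)
  define P' where "P' = Cod M a0"
  note p = pushoutD[OF P, unfolded Cj, folded P'_def]
  note I = Ident_in_hom[OF ZO]
  obtain codiag where codiag: "codiag \<in> hom M P' Z" "codiag \<cdot> a0 = Ident M Z" "codiag \<cdot> a1 = Ident M Z"
    using pushout_induced[OF P, unfolded Cj, folded P'_def, OF I I] by blast
  obtain D c d where c: "c \<in> Cof M" "c \<in> hom M P' D" and d: "d \<in> TFib M" "d \<in> hom M D Z" and dc: "d \<cdot> c = codiag"
    using Cof_TFib_factorization[OF codiag(1)] by blast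
  have "a1 \<in> TCof M"
    using lifts_against_pushout[OF P TCof_lifts_Fib[OF j(1)] Mor(2)] homD(1)[OF p(4)] by (auto simp: TCof_eq LLP_def)
  then have a1: "a1 \<in> Weq M" by (simp add: TCof_def)
  have dca: "d \<cdot> (c \<cdot> a0) = Ident M Z" "d \<cdot> (c \<cdot> a1) = Ident M Z"
    using Comp_assoc[OF p(3) c(2) d(2)] Comp_assoc[OF p(4) c(2) d(2)] dc codiag by simp_all
  have "d \<in> Weq M" using d(1) by (simp add: TFib_def)
  then have "c \<cdot> a1 \<in> Weq M"
    using two_out_of_three[OF Comp_in_hom[OF p(4) c(2)] d(2)] dca(2) Ident_Weq[OF ZO] by simp
  then have "c \<in> TCof M" using two_out_of_three[OF p(4) c(2)] a1 c(1) by (simp add: TCof_def)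
  moreover have j\<rho>: "j \<cdot> \<rho> \<in> hom M Z Z" using Comp_in_hom[OF \<rho>(1) j(2)] .
  have "j \<cdot> \<rho> \<cdot> j = Ident M Z \<cdot> j"
    using Comp_assoc[OF j(2) \<rho>(1) j(2)] \<rho>(2) Comp_Ident[OF j(2)] Ident_Comp[OF j(2)] by simp
  then obtain e where e: "e \<in> hom M P' Z" "e \<cdot> a0 = j \<cdot> \<rho>" "e \<cdot> a1 = Ident M Z"
    using pushout_induced[OF P, unfolded Cj, folded P'_def, OF j\<rho> I] by blast
  ultimately obtain E where E: "E \<in> hom M D Z" "E \<cdot> c = e" using fibrant_extension[OF _ c(2) e(1) Z] by blast
  have "E \<cdot> (c \<cdot> a0) = j \<cdot> \<rho>" "E \<cdot> (c \<cdot> a1) = Ident M Z"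
    using Comp_assoc[OF p(3) c(2) E(1)] Comp_assoc[OF p(4) c(2) E(1)] E(2) e by simp_all
  then show thesis using that[OF P P'_def[symmetric] c(2) d dca E(1)] by blast
qed

lemma relative_cylinderE:
  assumes "relative_cylinder M i \<iota>\<^sub>0 \<iota>\<^sub>1 s" and i: "i \<in> hom M U V"
  obtains P in\<^sub>0 in\<^sub>1 k N where "is_pushout M i i in\<^sub>0 in\<^sub>1" "in\<^sub>0 \<in> hom M V P" "in\<^sub>1 \<in> hom M V P" "in\<^sub>0 \<cdot> i = in\<^sub>1 \<cdot> i"
    "k \<in> Cof M" "k \<in> hom M P N" "s \<in> TFib M" "s \<in> hom M N V" "s \<cdot> \<iota>\<^sub>0 = Ident M V" "s \<cdot> \<iota>\<^sub>1 = Ident M V"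
    "\<iota>\<^sub>0 = k \<cdot> in\<^sub>0" "\<iota>\<^sub>1 = k \<cdot> in\<^sub>1" "\<iota>\<^sub>0 \<in> hom M V N" "\<iota>\<^sub>1 \<in> hom M V N"
proof -
  obtain in\<^sub>0 in\<^sub>1 k where P: "is_pushout M i i in\<^sub>0 in\<^sub>1" and k: "k \<in> Cof M" "Dom M k = Cod M in\<^sub>0"
    and s: "s \<in> TFib M" "Dom M s = Cod M k" "(s \<cdot> k) \<cdot> in\<^sub>0 = Ident M (Cod M i)" "(s \<cdot> k) \<cdot> in\<^sub>1 = Ident M (Cod M i)"
    and \<iota>: "\<iota>\<^sub>0 = k \<cdot> in\<^sub>0" "\<iota>\<^sub>1 = k \<cdot> in\<^sub>1"
    using assms(1) unfolding relative_cylinder_def by blast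
  have Ci: "Cod M i = V" using i by (rule homD)
  note p = pushoutD[OF P, unfolded Ci]
  have k': "k \<in> hom M (Cod M in\<^sub>0) (Cod M k)" using in_hom[OF Mor(1)[OF k(1)]] k(2) by simp
  have s': "s \<in> hom M (Cod M k) (Cod M s)" using in_hom[OF Mor(4)[OF s(1)]] s(2) by simp
  have "Cod M s = V"
    using homD(3)[OF Comp_in_hom[OF p(3) Comp_in_hom[OF k' s']]] s(3) Ident_in_hom[OF hom_Obj(2)[OF i]]
    by (auto simp: Ci hom_def)
  then have s'': "s \<in> hom M (Cod M k) V" using s' by simp
  show thesis
    by (rule that[OF P p(3,4,5) k(1) k' s(1) s''])
      (use s(3,4) Comp_assoc[OF p(3) k' s''] Comp_assoc[OF p(4) k' s''] \<iota> Ci Comp_in_hom[OF p(3) k'] Comp_in_hom[OF p(4) k'] in simp_all)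
qed

text \<open>
  The map \<open>\<iota>\<^sub>0\<close> is the composite of a pushout of \<open>i\<close> and the cofibration \<open>k\<close>, and a section of the
  trivial fibration \<open>s\<close>.
\<close>

lemma cylinder_inclusion_TCof:
  assumes cyl: "relative_cylinder M i \<iota>\<^sub>0 \<iota>\<^sub>1 s" and i: "i \<in> Cof M"
  shows "\<iota>\<^sub>0 \<in> TCof M" "Dom M \<iota>\<^sub>0 = Cod M i"
proof -
  define V where "V = Cod M i"
  have i': "i \<in> hom M (Dom M i) V" using in_hom[OF Mor(1)[OF i]] by (simp add: V_def)
  obtain P in\<^sub>0 in\<^sub>1 k N where P: "is_pushout M i i in\<^sub>0 in\<^sub>1" and in0: "in\<^sub>0 \<in> hom M V P" "in\<^sub>1 \<in> hom M V P" "in\<^sub>0 \<cdot> i = in\<^sub>1 \<cdot> i"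
    and k: "k \<in> Cof M" "k \<in> hom M P N" and s: "s \<in> TFib M" "s \<in> hom M N V" "s \<cdot> \<iota>\<^sub>0 = Ident M V"
    and \<iota>: "\<iota>\<^sub>0 = k \<cdot> in\<^sub>0" "\<iota>\<^sub>0 \<in> hom M V N"
    using relative_cylinderE[OF cyl i'] by metis
  have P': "is_pushout M i i in\<^sub>1 in\<^sub>0"
    using P unfolding is_pushout_def by metis
  have "lifts_against M \<iota>\<^sub>0 p" if p: "p \<in> TFib M" for p
  proof (rule lifts_againstI[OF \<iota>(2) in_hom[OF Mor(4)[OF p]]])
    fix u v assume u: "u \<in> hom M V (Dom M p)" and v: "v \<in> hom M N (Cod M p)" and uv: "p \<cdot> u = v \<cdot> \<iota>\<^sub>0"
    note p' = in_hom[OF Mor(4)[OF p]]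
    have "p \<cdot> u = v \<cdot> k \<cdot> in\<^sub>0" using uv \<iota>(1) Comp_assoc[OF in0(1) k(2) v] by simp
    then obtain h where h: "h \<in> hom M P (Dom M p)" "h \<cdot> in\<^sub>0 = u" "p \<cdot> h = v \<cdot> k"
      using lift[OF lifts_against_pushout[OF P' Cof_lifts_TFib[OF i p] Mor(4)[OF p]] in0(1) p' u Comp_in_hom[OF k(2) v]] by blast
    obtain w where w: "w \<in> hom M N (Dom M p)" "w \<cdot> k = h" "p \<cdot> w = v"
      using lift[OF Cof_lifts_TFib[OF k(1) p] k(2) p' h(1) v h(3)] by blast
    then show "\<exists>h\<in>hom M N (Dom M p). h \<cdot> \<iota>\<^sub>0 = u \<and> p \<cdot> h = v"
      using Comp_assoc[OF in0(1) k(2) w(1)] h(2) \<iota>(1) by (intro bexI[OF _ w(1)]) simp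
  qed
  then have "\<iota>\<^sub>0 \<in> Cof M" using \<iota>(2) by (simp add: Cof_eq LLP_def hom_def)
  moreover have "\<iota>\<^sub>0 \<in> Weq M"
    using two_out_of_three[OF \<iota>(2) s(2)] s(1,3) Ident_Weq[OF hom_Obj(2)[OF i']] by (simp add: TFib_def)
  ultimately show "\<iota>\<^sub>0 \<in> TCof M" by (simp add: TCof_def)
  show "Dom M \<iota>\<^sub>0 = Cod M i" using \<iota>(2) by (simp add: V_def hom_def)
qed

text \<open>
  A weak equivalence \<open>f : X \<rightarrow> Y\<close> between fibrant objects lifts a square on a cofibration \<open>i : U \<rightarrow> V\<close>
  up to homotopy relative to \<open>U\<close>: factor \<open>f = p j\<close> into a trivial cofibration and a trivial
  fibration, lift against \<open>p\<close> and compose with a retraction \<open>\<rho>\<close> of \<open>j\<close>; the homotopy is a deformation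
  of \<open>j \<rho>\<close> to the identity, transported to the cylinder of \<open>i\<close>. If \<open>f\<close> lifts against \<open>\<iota>\<^sub>0\<close>, the homotopy
  lifts as well, and its other end is a strict lift.
\<close>

lemma weak_equivalence_lifts:
  assumes fibrant: "\<And>X. X \<in> Obj M \<Longrightarrow> fibrant M X"
    and i: "i \<in> Cof M" and cyl: "relative_cylinder M i \<iota>\<^sub>0 \<iota>\<^sub>1 s"
    and f: "f \<in> Weq M" and l: "lifts_against M \<iota>\<^sub>0 f"
  shows "lifts_against M i f"
proof -
  have "f \<in> Mor M" using f Weq_subset by blast
  define X Y U V where "X = Dom M f" and "Y = Cod M f" and "U = Dom M i" and "V = Cod M i"
  have f': "f \<in> hom M X Y" using in_hom[OF \<open>f \<in> Mor M\<close>] by (simp add: X_def Y_def)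
  have i': "i \<in> hom M U V" using in_hom[OF Mor(1)[OF i]] by (simp add: U_def V_def)
  obtain Z j p where j: "j \<in> TCof M" "j \<in> hom M X Z" and p: "p \<in> Fib M" "p \<in> hom M Z Y" and pj: "p \<cdot> j = f"
    using TCof_Fib_factorization[OF f'] by blast
  have O: "X \<in> Obj M" "Z \<in> Obj M" using j(2) hom_Obj by blast+
  have "p \<in> Weq M" using two_out_of_three[OF j(2) p(2)] j(1) f pj by (simp add: TCof_def)
  then have pT: "p \<in> TFib M" using p(1) by (simp add: TFib_def)
  obtain \<rho> where \<rho>: "\<rho> \<in> hom M Z X" "\<rho> \<cdot> j = Ident M X"
    using fibrant_extension[OF j Ident_in_hom[OF O(1)] fibrant[OF O(1)]] by blast
  obtain P a0 a1 c D d E where P: "is_pushout M j j a0 a1" "Cod M a0 = P" and c: "c \<in> hom M P D"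
    and d: "d \<in> TFib M" "d \<in> hom M D Z" "d \<cdot> (c \<cdot> a0) = Ident M Z" "d \<cdot> (c \<cdot> a1) = Ident M Z"
    and E: "E \<in> hom M D Z" "E \<cdot> (c \<cdot> a0) = j \<cdot> \<rho>" "E \<cdot> (c \<cdot> a1) = Ident M Z"
    using deformation_retraction[OF j \<rho> fibrant[OF O(2)]] by metis
  have a: "a0 \<in> hom M Z P" "a1 \<in> hom M Z P" "a0 \<cdot> j = a1 \<cdot> j"
    using pushoutD(3-5)[OF P(1)] P(2) homD(3)[OF j(2)] by simp_all
  obtain P' in\<^sub>0 in\<^sub>1 k N where P': "is_pushout M i i in\<^sub>0 in\<^sub>1" and in0: "in\<^sub>0 \<in> hom M V P'" "in\<^sub>1 \<in> hom M V P'" "in\<^sub>0 \<cdot> i = in\<^sub>1 \<cdot> i"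
    and k: "k \<in> Cof M" "k \<in> hom M P' N" and s: "s \<in> hom M N V" "s \<cdot> \<iota>\<^sub>0 = Ident M V" "s \<cdot> \<iota>\<^sub>1 = Ident M V"
    and \<iota>: "\<iota>\<^sub>0 = k \<cdot> in\<^sub>0" "\<iota>\<^sub>1 = k \<cdot> in\<^sub>1" "\<iota>\<^sub>0 \<in> hom M V N" "\<iota>\<^sub>1 \<in> hom M V N"
    using relative_cylinderE[OF cyl i'] by metis
  have \<iota>i: "\<iota>\<^sub>0 \<cdot> i = \<iota>\<^sub>1 \<cdot> i"
    using Comp_assoc[OF i' in0(1) k(2)] Comp_assoc[OF i' in0(2) k(2)] in0(3) \<iota> by simp
  show ?thesis
  proof (rule lifts_againstI[OF i' f'])
    fix u v assume u: "u \<in> hom M U X" and v: "v \<in> hom M V Y" and uv: "f \<cdot> u = v \<cdot> i"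
    have "p \<cdot> (j \<cdot> u) = v \<cdot> i" using Comp_assoc[OF u j(2) p(2)] pj uv by simp
    then obtain w where w: "w \<in> hom M V Z" "w \<cdot> i = j \<cdot> u" "p \<cdot> w = v"
      using lift[OF Cof_lifts_TFib[OF i pT] i' p(2) Comp_in_hom[OF u j(2)] v] by blast
    have aw: "a0 \<cdot> w \<in> hom M V P" "a1 \<cdot> w \<in> hom M V P" using Comp_in_hom w(1) a by blast+
    have "a0 \<cdot> w \<cdot> i = a1 \<cdot> w \<cdot> i"
      using Comp_assoc[OF i' w(1) a(1)] Comp_assoc[OF i' w(1) a(2)] Comp_assoc[OF u j(2) a(1)]
        Comp_assoc[OF u j(2) a(2)] w(2) a(3) by simp
    then obtain b where b: "b \<in> hom M P' P" "b \<cdot> in\<^sub>0 = a0 \<cdot> w" "b \<cdot> in\<^sub>1 = a1 \<cdot> w"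
      using pushout_induced[OF P', of "a0 \<cdot> w" P "a1 \<cdot> w"] aw homD(3)[OF in0(1)] homD(3)[OF i'] by metis
    note cb = Comp_in_hom[OF b(1) c] and ws = Comp_in_hom[OF s(1) w(1)]
    \<comment> \<open>For \<open>x = d\<close> this is the boundary of the lifting problem for \<open>m\<close>, for \<open>x = E\<close> the two ends of the homotopy.\<close>
    have end_eq: "x \<cdot> (c \<cdot> b) \<cdot> in\<^sub>0 = x \<cdot> (c \<cdot> a0) \<cdot> w" "x \<cdot> (c \<cdot> b) \<cdot> in\<^sub>1 = x \<cdot> (c \<cdot> a1) \<cdot> w"
      if x: "x \<in> hom M D B" for x B
      using Comp_assoc[OF in0(1) cb x] Comp_assoc[OF in0(1) b(1) c] Comp_assoc[OF w(1) a(1) c]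
        Comp_assoc[OF w(1) Comp_in_hom[OF a(1) c] x] Comp_assoc[OF in0(2) cb x] Comp_assoc[OF in0(2) b(1) c]
        Comp_assoc[OF w(1) a(2) c] Comp_assoc[OF w(1) Comp_in_hom[OF a(2) c] x] b by simp_all
    have "d \<cdot> (c \<cdot> b) = w \<cdot> s \<cdot> k"
    proof (rule pushout_eqI[OF P', unfolded homD(3)[OF in0(1)], OF Comp_in_hom[OF cb d(2)] Comp_in_hom[OF k(2) ws]])
      show "d \<cdot> (c \<cdot> b) \<cdot> in\<^sub>0 = w \<cdot> s \<cdot> k \<cdot> in\<^sub>0"
        using end_eq(1)[OF d(2)] d(3) Ident_Comp[OF w(1)] Comp_assoc[OF in0(1) k(2) ws] \<iota>(1)
          Comp_assoc[OF \<iota>(3) s(1) w(1)] s(2) Comp_Ident[OF w(1)] by simp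
      show "d \<cdot> (c \<cdot> b) \<cdot> in\<^sub>1 = w \<cdot> s \<cdot> k \<cdot> in\<^sub>1"
        using end_eq(2)[OF d(2)] d(4) Ident_Comp[OF w(1)] Comp_assoc[OF in0(2) k(2) ws] \<iota>(2)
          Comp_assoc[OF \<iota>(4) s(1) w(1)] s(3) Comp_Ident[OF w(1)] by simp
    qed
    then obtain m where m: "m \<in> hom M N D" "m \<cdot> k = c \<cdot> b"
      using lift[OF Cof_lifts_TFib[OF k(1) d(1)] k(2) d(2) cb ws] by blast
    have Em: "E \<cdot> m \<in> hom M N Z" using Comp_in_hom[OF m(1) E(1)] .
    have Em_ends: "E \<cdot> m \<cdot> \<iota>\<^sub>0 = E \<cdot> (c \<cdot> a0) \<cdot> w" "E \<cdot> m \<cdot> \<iota>\<^sub>1 = E \<cdot> (c \<cdot> a1) \<cdot> w"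
      using end_eq[OF E(1)] Comp_assoc[OF in0(1) k(2) Em] Comp_assoc[OF in0(2) k(2) Em] Comp_assoc[OF k(2) m(1) E(1)] m(2) \<iota>
      by simp_all
    \<comment> \<open>\<open>h\<close> is a homotopy from \<open>f \<cdot> (\<rho> \<cdot> w)\<close> to \<open>v\<close>.\<close>
    define h where "h = p \<cdot> (E \<cdot> m)"
    have h: "h \<in> hom M N Y" using Comp_in_hom[OF Em p(2)] by (simp add: h_def)
    note \<rho>w = Comp_in_hom[OF w(1) \<rho>(1)]
    have "h \<cdot> \<iota>\<^sub>0 = p \<cdot> (j \<cdot> \<rho> \<cdot> w)"
      using Comp_assoc[OF \<iota>(3) Em p(2)] Em_ends(1) E(2) by (simp add: h_def)
    then have h0: "f \<cdot> (\<rho> \<cdot> w) = h \<cdot> \<iota>\<^sub>0"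
      using Comp_assoc[OF w(1) \<rho>(1) j(2)] Comp_assoc[OF \<rho>w j(2) p(2)] pj by simp
    have h1: "h \<cdot> \<iota>\<^sub>1 = v"
      using Comp_assoc[OF \<iota>(4) Em p(2)] Em_ends(2) E(3) Ident_Comp[OF w(1)] w(3) by (simp add: h_def)
    obtain g where g: "g \<in> hom M N X" "g \<cdot> \<iota>\<^sub>0 = \<rho> \<cdot> w" "f \<cdot> g = h" using lift[OF l \<iota>(3) f' \<rho>w h h0] by blast
    have "g \<cdot> \<iota>\<^sub>1 \<cdot> i = \<rho> \<cdot> w \<cdot> i"
      using Comp_assoc[OF i' \<iota>(4) g(1)] Comp_assoc[OF i' \<iota>(3) g(1)] \<iota>i g(2) by simp
    also have "\<dots> = u"
      using Comp_assoc[OF i' w(1) \<rho>(1)] w(2) Comp_assoc[OF u j(2) \<rho>(1)] \<rho>(2) Ident_Comp[OF u] by simp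
    finally have "g \<cdot> \<iota>\<^sub>1 \<cdot> i = u" .
    moreover have "f \<cdot> (g \<cdot> \<iota>\<^sub>1) = v" using Comp_assoc[OF \<iota>(4) g(1) f'] g(3) h1 by simp
    ultimately show "\<exists>h\<in>hom M V X. h \<cdot> i = u \<and> f \<cdot> h = v" using Comp_in_hom[OF \<iota>(4) g(1)] by blast
  qed
qed

section \<open>Generating trivial cofibrations\<close>

text \<open>
  Let the set \<open>J\<close> of trivial cofibrations permit the small object argument, and let every weak
  equivalence in \<open>J\<close>-inj be a trivial fibration. A trivial cofibration \<open>t\<close> factors as
  \<open>t = q c\<close> with \<open>c\<close> a relative \<open>J\<close>-cell complex and \<open>q\<close> in \<open>J\<close>-inj. By two-out-of-three \<open>q\<close> is a weak
  equivalence, so \<open>t\<close> lifts against it and is a retract of \<open>c\<close>.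
\<close>

lemma Fib_eq_inj_maps:
  assumes J: "J \<subseteq> TCof M" "small \<kappa> J" "permits_small_object_argument \<kappa> M J"
    and weq: "inj_maps M J \<inter> Weq M \<subseteq> TFib M"
  shows "Fib M = inj_maps M J"
proof
  show "Fib M \<subseteq> inj_maps M J" using J(1) by (auto simp: Fib_eq inj_maps_def RLP_def)
  show "inj_maps M J \<subseteq> Fib M"
  proof
    fix f assume f: "f \<in> inj_maps M J"
    have fM: "f \<in> Mor M" using f by (simp add: inj_maps_def RLP_def)
    note f' = in_hom[OF fM]
    have JM: "J \<subseteq> Mor M" using J(1) Mor(3) by blast
    have "lifts_against M t f" if t: "t \<in> TCof M" for t
    proof -
      define A B where "A = Dom M t" and "B = Cod M t"
      have t': "t \<in> hom M A B" using in_hom[OF Mor(3)[OF t]] by (simp add: A_def B_def)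
      obtain Z c q where c: "c \<in> cell_maps \<kappa> M J" "c \<in> hom M A Z" and q: "q \<in> inj_maps M J" "q \<in> hom M Z B"
        and qc: "q \<cdot> c = t"
        using small_object_argument[OF JM J(2) _ t'] J(3) unfolding permits_small_object_argument_def by blast
      have "J \<subseteq> LLP M (inj_maps M J)" using JM by (auto simp: LLP_def inj_maps_def RLP_def)
      then have "cell_maps \<kappa> M J \<subseteq> LLP M (inj_maps M J)"
        by (rule cell_maps_subset_LLP) (auto simp: inj_maps_def RLP_def)
      then have cf: "lifts_against M c f" using c(1) f by (auto simp: LLP_def)
      have "cell_maps \<kappa> M J \<subseteq> TCof M"
        using J(1) Mor(2) unfolding TCof_eq by (intro cell_maps_subset_LLP) auto
      then have "c \<in> Weq M" using c(1) by (auto simp: TCof_def)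
      then have "q \<in> Weq M" using two_out_of_three[OF c(2) q(2)] qc t by (simp add: TCof_def)
      then have "q \<in> TFib M" using weq q(1) by blast
      moreover have "t \<in> Cof M" using t by (simp add: TCof_def)
      ultimately have tq: "lifts_against M t q" by (rule Cof_lifts_TFib[rotated])
      have BO: "B \<in> Obj M" using t' hom_Obj by blast
      obtain r where r: "r \<in> hom M B Z" "r \<cdot> t = c" "q \<cdot> r = Ident M B"
        using lift[OF tq t' q(2) c(2) Ident_in_hom[OF BO]] qc Ident_Comp[OF t'] by metis
      show "lifts_against M t f"
      proof (rule lifts_againstI[OF t' f'])
        fix u v assume u: "u \<in> hom M A (Dom M f)" and v: "v \<in> hom M B (Cod M f)" and uv: "f \<cdot> u = v \<cdot> t"
        have "f \<cdot> u = v \<cdot> q \<cdot> c" using uv qc Comp_assoc[OF c(2) q(2) v] by simp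
        then obtain h where h: "h \<in> hom M Z (Dom M f)" "h \<cdot> c = u" "f \<cdot> h = v \<cdot> q"
          using lift[OF cf c(2) f' u Comp_in_hom[OF q(2) v]] by blast
        have "h \<cdot> r \<cdot> t = u" using Comp_assoc[OF t' r(1) h(1)] r(2) h(2) by simp
        moreover have "f \<cdot> (h \<cdot> r) = v"
          using Comp_assoc[OF r(1) h(1) f'] h(3) Comp_assoc[OF r(1) q(2) v] r(3) Comp_Ident[OF v] by simp
        ultimately show "\<exists>h\<in>hom M B (Dom M f). h \<cdot> t = u \<and> f \<cdot> h = v" using Comp_in_hom[OF r(1) h(1)] by blast
      qed
    qed
    then show "f \<in> Fib M" using fM by (simp add: Fib_eq RLP_def)
  qed
qed

end

theorem corollary3p2:
  fixes \<kappa> :: "'u rel"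
    and M :: "('o, 'm) model_structure"
    and I :: "'m set"
    and \<iota>\<^sub>0 \<iota>\<^sub>1 \<sigma> :: "'m \<Rightarrow> 'm"
  assumes "inaccessible \<kappa>"
    and "model_category M \<kappa>"
    and "\<And>X. X \<in> Obj M \<Longrightarrow> fibrant M X"
    and "I \<subseteq> Mor M"
    and "small \<kappa> I"
    and "cof_maps M I = Cof M"
    and "\<And>i. i \<in> I \<Longrightarrow> small_relative \<kappa> M (cell_maps \<kappa> M I) (Dom M i)"
    and "\<And>i. i \<in> I \<Longrightarrow> small_relative \<kappa> M (cell_maps \<kappa> M I) (Cod M i)"
    and "\<And>i. i \<in> I \<Longrightarrow> relative_cylinder M i (\<iota>\<^sub>0 i) (\<iota>\<^sub>1 i) (\<sigma> i)"
  shows "cofibrantly_generated \<kappa> M I {\<iota>\<^sub>0 i | i. i \<in> I}"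
proof -
  note fibrant = assms(3) and I = assms(4,5) and cof = assms(6)
    and Dom_small = assms(7) and Cod_small = assms(8) and cylinder = assms(9)
  interpret model_category M \<kappa> by fact
  interpret universe_model_category M \<kappa> by unfold_locales fact
  let ?J = "{\<iota>\<^sub>0 i | i. i \<in> I}"
  have I_Cof: "i \<in> Cof M" if "i \<in> I" for i
    using that I(1) by (auto simp: cof[symmetric] cof_maps_def LLP_def inj_maps_def RLP_def)
  have TFib: "TFib M = inj_maps M I"
  proof
    show "TFib M \<subseteq> inj_maps M I" using I_Cof by (auto simp: TFib_eq inj_maps_def RLP_def)
    show "inj_maps M I \<subseteq> TFib M"
      unfolding TFib_eq cof[symmetric] by (auto simp: cof_maps_def LLP_def inj_maps_def RLP_def)
  qed
  have J_TCof: "?J \<subseteq> TCof M" using cylinder_inclusion_TCof(1)[OF cylinder I_Cof] by auto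
  then have J_Mor: "?J \<subseteq> Mor M" using Mor(3) by blast
  have "?J = \<iota>\<^sub>0 ` I" by blast
  then have J_small: "small \<kappa> ?J" using small_image[OF I(2)] by simp
  have "cell_maps \<kappa> M ?J \<subseteq> TCof M"
    using J_TCof Mor(2) unfolding TCof_eq by (intro cell_maps_subset_LLP) auto
  then have J_cell: "cell_maps \<kappa> M ?J \<subseteq> cof_maps M I" by (auto simp: cof TCof_def)
  have "small_relative \<kappa> M (cell_maps \<kappa> M ?J) (Dom M (\<iota>\<^sub>0 i))" if i: "i \<in> I" for i
    using small_relative_cof_maps[OF I Dom_small Cod_small[OF i] J_cell]
      cylinder_inclusion_TCof(2)[OF cylinder I_Cof] i by simp
  then have J_soa: "permits_small_object_argument \<kappa> M ?J"
    unfolding permits_small_object_argument_def by blast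
  have "inj_maps M ?J \<inter> Weq M \<subseteq> TFib M"
  proof
    fix f assume "f \<in> inj_maps M ?J \<inter> Weq M"
    then have f: "f \<in> Mor M" "\<And>i. i \<in> I \<Longrightarrow> lifts_against M (\<iota>\<^sub>0 i) f" "f \<in> Weq M"
      by (auto simp: inj_maps_def RLP_def)
    then show "f \<in> TFib M"
      unfolding TFib inj_maps_def RLP_def
      using weak_equivalence_lifts[OF fibrant I_Cof cylinder f(3) f(2)] by blast
  qed
  then have "Fib M = inj_maps M ?J" by (rule Fib_eq_inj_maps[OF J_TCof J_small J_soa])
  moreover have "permits_small_object_argument \<kappa> M I"
    using Dom_small by (simp add: permits_small_object_argument_def)
  ultimately show ?thesis
    unfolding cofibrantly_generated_def using I J_Mor J_small J_soa TFib by blast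
qed

end
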